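(* Let $F$ be a graph on $[k]$ with $k>1$ and let $0<p<1$. Then the following are equivalent: (i) $F$ is hereditary induced-forcing for $p$; (ii) for every graphon $W$, if $\widetilde{\Psi}^*_{F,W}(x_1,\dots,x_k)=\beta_F(p)$ for a.e. $(x_1,\dots,x_k)\in[0,1]^k$, then $W=p$ a.e. or $W=\bar p$ a.e.; (iii) for every graphon $W$, if $\widetilde{\Psi}^*_{F,W}(x_1,\dots,x_k)=\beta_F(p)$ for all $(x_1,\dots,x_k)\in[0,1]^k$, then $W\equiv p$ or $W\equiv\bar p$; (iv) if $u,v\in\{p,\bar p\}$ and $s\in[0,1]$ (understood as real numbers in $[0,1]$) satisfy $Q_k'(u,v,s):=Q_j(u,v,s)=\binom kj\beta_F(p)$ for every $j=1,\dots,k-1$, then $u=v=s$.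
   Context: A graphon is a symmetric measurable $W:[0,1]^2\to[0,1]$. For a graph $F$ on $[k]$, $\Psi^*_{F,W}(x_1,\dots,x_k)=\prod_{ij\in E(F)}W(x_i,x_j)\prod_{i<j,\,ij\notin E(F)}(1-W(x_i,x_j))$, and $\widetilde{\Psi}^*_{F,W}(x_1,\dots,x_k)=\frac1{k!}\sum_{\sigma\in S_k}\Psi^*_{F,W}(x_{\sigma(1)},\dots,x_{\sigma(k)})$. $\beta_F(q)=q^{e(F)}(1-q)^{\binom k2-e(F)}$; if $F$ is neither empty nor complete and $p_F=e(F)/\binom k2$, then for $q\ne p_F$ the conjugate $\bar q$ is the unique other number in $[0,1]$ with $\beta_F(\bar q)=\beta_F(q)$, and $\bar q=q$ if $q=p_F$ or $F$ is empty or complete. For $j=0,\dots,k$, $Q_j(u,v,s)=\sum_{A\subseteq[k],|A|=j}u^{e(A)}(1-u)^{\binom j2-e(A)}v^{e(\bar A)}(1-v)^{\binom{k-j}2-e(\bar A)}s^{e(A,\bar A)}(1-s)^{j(k-j)-e(A,\bar A)}$, where $\bar A=[k]\setminus A$, $e(A)$ is the number of edges of $F$ inside $A$ and $e(A,\bar A)$ the number of edges between $A$ and $\bar A$. Graphs are finite simple; $N^*(F,G;U)$ is the number of injective maps $\varphi:[k]\to U\subseteq V(G)$ with $ij\in E(F)\iff\varphi(i)\varphi(j)\in E(G)$ for $i\neq j$, and $N(H,G)$ the number of injective homomorphisms $H\to G$. $(G_n)$ with $|G_n|\to\infty$ is $q$-quasi-random if $N(H,G_n)=(q^{e(H)}+o(1))|G_n|^{|H|}$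 for all graphs $H$; it is $[p,\bar p]$-quasi-random if $\mathbb N$ splits into $I_1,I_2$ with $(G_n)_{I_1}$ $p$-quasi-random and $(G_n)_{I_2}$ $\bar p$-quasi-random (when infinite). $F$ is hereditary induced-forcing for $p$ if every $(G_n)$ with $|G_n|\to\infty$ and $N^*(F,G_n;U)=\beta_F(p)|U|^k+o(|G_n|^k)$ uniformly over all $U\subseteq V(G_n)$ is $[p,\bar p]$-quasi-random. *)

theory Defs
  imports
    "HOL-Analysis.Analysis"
    "HOL-Combinatorics.Permutations"
    "HOL-Library.Landau_Symbols"
    "HOL-Library.Ramsey"
begin

text \<open>Finite simple graphs on natural numbers. Every finite graph is isomorphic to one of these, so
  quantifying over them is quantifying over all finite graphs.\<close>

record ugraph =
  verts :: "nat set"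
  edges :: "nat set set"

definition simple_graph :: "ugraph \<Rightarrow> bool" where
  "simple_graph G \<longleftrightarrow> finite (verts G) \<and> edges G \<subseteq> nsets (verts G) 2"

definition num_verts :: "ugraph \<Rightarrow> nat" where
  "num_verts G = card (verts G)"

definition num_edges :: "ugraph \<Rightarrow> nat" where
  "num_edges G = card (edges G)"

definition edges_in :: "ugraph \<Rightarrow> nat set \<Rightarrow> nat" where
  "edges_in F A = card {e \<in> edges F. e \<subseteq> A}"

definition edges_between :: "ugraph \<Rightarrow> nat set \<Rightarrow> nat set \<Rightarrow> nat" where
  "edges_between F A B = card {e \<in> edges F. \<exists>a\<in>A. \<exists>b\<in>B. e = {a, b}}"

text \<open>Maps are taken in the extensional function space so that counting them is meaningful.\<close>

definition inj_homs :: "ugraph \<Rightarrow> ugraph \<Rightarrow> nat" where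
  "inj_homs H G = card {\<phi> \<in> verts H \<rightarrow>\<^sub>E verts G. inj_on \<phi> (verts H) \<and>
     (\<forall>i\<in>verts H. \<forall>j\<in>verts H. {i, j} \<in> edges H \<longrightarrow> {\<phi> i, \<phi> j} \<in> edges G)}"

definition ind_embs_into :: "ugraph \<Rightarrow> ugraph \<Rightarrow> nat set \<Rightarrow> nat" where
  "ind_embs_into F G U = card {\<phi> \<in> verts F \<rightarrow>\<^sub>E U. inj_on \<phi> (verts F) \<and>
     (\<forall>i\<in>verts F. \<forall>j\<in>verts F. i \<noteq> j \<longrightarrow>
        ({i, j} \<in> edges F \<longleftrightarrow> {\<phi> i, \<phi> j} \<in> edges G))}"

definition graphon :: "(real \<Rightarrow> real \<Rightarrow> real) \<Rightarrow> bool" where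
  "graphon W \<longleftrightarrow>
     (\<lambda>(x, y). W x y) \<in> borel_measurable (lebesgue_on ({0..1} \<times> {0..1})) \<and>
     (\<forall>x\<in>{0..1}. \<forall>y\<in>{0..1}. W x y \<in> {0..1} \<and> W x y = W y x)"

text \<open>Lebesgue measure on the cube of points \<open>(x\<^sub>i)\<close>, \<open>i \<in> I\<close>. It is not completed, but completion
  does not change the meaning of ``almost everywhere''.\<close>

definition cube :: "nat set \<Rightarrow> (nat \<Rightarrow> real) measure" where
  "cube I = PiM I (\<lambda>_. restrict_space lborel {0..1})"

text \<open>Each unordered pair \<open>ij\<close> is represented by the ordered pair with \<open>i < j\<close>; since graphons are
  symmetric, the choice does not matter.\<close>

definition Psi :: "ugraph \<Rightarrow> (real \<Rightarrow> real \<Rightarrow> real) \<Rightarrow> (nat \<Rightarrow> real) \<Rightarrow> real" where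
  "Psi F W x =
     (\<Prod>(i, j) \<in> {(i, j). i \<in> verts F \<and> j \<in> verts F \<and> i < j \<and> {i, j} \<in> edges F}.
        W (x i) (x j)) *
     (\<Prod>(i, j) \<in> {(i, j). i \<in> verts F \<and> j \<in> verts F \<and> i < j \<and> {i, j} \<notin> edges F}.
        1 - W (x i) (x j))"

definition Psi_sym :: "ugraph \<Rightarrow> (real \<Rightarrow> real \<Rightarrow> real) \<Rightarrow> (nat \<Rightarrow> real) \<Rightarrow> real" where
  "Psi_sym F W x =
     (\<Sum>\<sigma> | \<sigma> permutes verts F. Psi F W (\<lambda>i. x (\<sigma> i))) / fact (num_verts F)"

definition beta :: "ugraph \<Rightarrow> real \<Rightarrow> real" where
  "beta F q = q ^ num_edges F * (1 - q) ^ ((num_verts F choose 2) - num_edges F)"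

definition edge_density :: "ugraph \<Rightarrow> real" where
  "edge_density F = num_edges F / (num_verts F choose 2)"

definition conjugate :: "ugraph \<Rightarrow> real \<Rightarrow> real" where
  "conjugate F q =
     (if edges F = {} \<or> edges F = nsets (verts F) 2 \<or> q = edge_density F then q
      else (THE r. r \<in> {0..1} \<and> r \<noteq> q \<and> beta F r = beta F q))"

definition Q :: "ugraph \<Rightarrow> nat \<Rightarrow> real \<Rightarrow> real \<Rightarrow> real \<Rightarrow> real" where
  "Q F j u v s = (\<Sum>A | A \<subseteq> verts F \<and> card A = j.
     let B = verts F - A; k = num_verts F in
       u ^ edges_in F A * (1 - u) ^ ((j choose 2) - edges_in F A) *
       v ^ edges_in F B * (1 - v) ^ (((k - j) choose 2) - edges_in F B) *
       s ^ edges_between F A B * (1 - s) ^ (j * (k - j) - edges_between F A B))"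

definition order_to_infinity :: "(nat \<Rightarrow> ugraph) \<Rightarrow> bool" where
  "order_to_infinity G \<longleftrightarrow> filterlim (\<lambda>n. num_verts (G n)) at_top sequentially"

definition quasi_random :: "real \<Rightarrow> (nat \<Rightarrow> ugraph) \<Rightarrow> bool" where
  "quasi_random q G \<longleftrightarrow> order_to_infinity G \<and>
     (\<forall>H. simple_graph H \<longrightarrow>
        (\<lambda>n. real (inj_homs H (G n)) - q ^ num_edges H * real (num_verts (G n)) ^ num_verts H)
          \<in> o(\<lambda>n. real (num_verts (G n)) ^ num_verts H))"

text \<open>\<open>enumerate I\<close> lists the infinite set \<open>I\<close> increasingly, so \<open>G \<circ> enumerate I\<close> is the
  subsequence of \<open>G\<close> indexed by \<open>I\<close>.\<close>

definition mixed_quasi_random :: "real \<Rightarrow> real \<Rightarrow> (nat \<Rightarrow> ugraph) \<Rightarrow> bool" where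
  "mixed_quasi_random p p' G \<longleftrightarrow>
     (\<exists>I1 I2. I1 \<union> I2 = UNIV \<and> I1 \<inter> I2 = {} \<and>
        (infinite I1 \<longrightarrow> quasi_random p (G \<circ> enumerate I1)) \<and>
        (infinite I2 \<longrightarrow> quasi_random p' (G \<circ> enumerate I2)))"

definition hereditary_induced_forcing :: "ugraph \<Rightarrow> real \<Rightarrow> bool" where
  "hereditary_induced_forcing F p \<longleftrightarrow>
     (\<forall>G. (\<forall>n. simple_graph (G n)) \<and> order_to_infinity G \<and>
        (\<forall>\<epsilon>>0. \<forall>\<^sub>F n in sequentially. \<forall>U\<subseteq>verts (G n).
           \<bar>real (ind_embs_into F (G n) U) - beta F p * real (card U) ^ num_verts F\<bar>
             \<le> \<epsilon> * real (num_verts (G n)) ^ num_verts F)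
        \<longrightarrow> mixed_quasi_random p (conjugate F p) G)"

end

theory Submission
  imports Defs "HOL-Probability.Infinite_Product_Measure"
begin

text \<open>Conditions (i), (ii) and (iii) are each shown to be equivalent to (iv), which is called \<open>rigid\<close>.

  Passing from one of them to (iv): a triple \<open>(u, v, s)\<close> solving the equations of (iv) gives a
  two-step graphon with constant symmetrized pattern density, and a sequence of explicit
  pseudo-random graphs with two blocks converging to it; being constant, respectively having the
  densities of \<open>K\<^sub>2\<close>, of the path with two edges and of the triangle of a quasi-random sequence, forces
  \<open>u = v = s\<close>.

  Passing from (iv) to (ii) or (i): suppose that a graphon (or a large graph) is neither close
  to \<open>p\<close> nor to the conjugate \<open>p'\<close>. Then it has a blow-up: four groups of many points (or of many
  disjoint linear-sized, pairwise regular vertex sets) such that the densities between the first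
  two groups stay away from \<open>p\<close> and those between the last two stay away from \<open>p'\<close>, while every transversal
  still has the right symmetrized pattern density. By Ramsey's theorem and compactness all
  densities inside and between the groups may be assumed to be constant. Then (iv) applies
  to any two groups and shows that all these constants are equal to the same element of \<open>{p, p'}\<close>,
  a contradiction.\<close>

section \<open>Pattern densities\<close>

text \<open>The obstacle is the diagonal: for a graphon known only up to null sets, or for a graph,
  no value W(x, x) is available as the parameter u or v of (iv). If the density is right at every
  point, a point can simply be repeated, which settles (iii). Otherwise the constant that Ramsey's
  theorem produces inside one group stands in for W(x, x). There are four groups because a
  counterexample violates both alternatives and each violation is witnessed by one pair.

  In a graph the hereditary hypothesis fixes counts only inside single sets U. Inclusion-exclusion
  over unions of disjoint blocks turns this into control of transversals summed over all assignments
  of blocks to vertices; this is where the symmetrization comes from. The blocks come from density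
  increments on single pairs rather than from a regularity partition, because an increment can be
  directed away from a prescribed density, so that the witnesses survive.

  The equations for j = 0 and j = k, absent from (iv), are equivalent to u and v lying in {p,
  p'}.\<close>

definition pairs :: "nat set \<Rightarrow> (nat \<times> nat) set" where
  "pairs I = {(i, j). i \<in> I \<and> j \<in> I \<and> i < j}"

lemma finite_pairs [simp]: "finite I \<Longrightarrow> finite (pairs I)"
  by (rule finite_subset[of _ "I \<times> I"]) (auto simp: pairs_def)

lemma prod_pairs_eq_prod_nsets:
  "(\<Prod>(i, j)\<in>pairs I. h {i, j}) = (\<Prod>e\<in>nsets I 2. h e)"
proof -
  have inj: "inj_on (\<lambda>(i, j). {i, j}) (pairs I)"
    by (auto simp: inj_on_def pairs_def doubleton_eq_iff)
  have "(\<lambda>(i, j). {i, j}) ` pairs I = nsets I 2"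
    by (force simp: pairs_def ordered_nsets_2_eq)
  then have "(\<Prod>e\<in>nsets I 2. h e) = (\<Prod>e\<in>(\<lambda>(i, j). {i, j}) ` pairs I. h e)" by simp
  also have "\<dots> = (\<Prod>(i, j)\<in>pairs I. h {i, j})"
    unfolding prod.reindex[OF inj] by (intro prod.cong) auto
  finally show ?thesis ..
qed

text \<open>\<open>Psi\<close> with the graphon values replaced by an arbitrary array indexed by the
  vertices of \<open>F\<close>. The same expression then serves for sampled points of a graphon, for
  densities between vertex sets and for limits of such arrays.\<close>

definition pat :: "ugraph \<Rightarrow> (nat \<Rightarrow> nat \<Rightarrow> real) \<Rightarrow> real" where
  "pat F D = (\<Prod>(i, j)\<in>pairs (verts F). if {i, j} \<in> edges F then D i j else 1 - D i j)"

definition sym_pat :: "ugraph \<Rightarrow> (nat \<Rightarrow> nat \<Rightarrow> real) \<Rightarrow> real" where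
  "sym_pat F D = (\<Sum>\<sigma> | \<sigma> permutes verts F. pat F (\<lambda>i j. D (\<sigma> i) (\<sigma> j))) / fact (num_verts F)"

lemma Psi_eq_pat:
  assumes "finite (verts F)"
  shows "Psi F W x = pat F (\<lambda>i j. W (x i) (x j))"
proof -
  have "pat F (\<lambda>i j. W (x i) (x j)) =
    (\<Prod>e\<in>pairs (verts F). if e \<in> {(i, j). {i, j} \<in> edges F}
       then (case e of (i, j) \<Rightarrow> W (x i) (x j)) else (case e of (i, j) \<Rightarrow> 1 - W (x i) (x j)))"
    unfolding pat_def by (intro prod.cong) auto
  also have "\<dots> = (\<Prod>(i, j)\<in>pairs (verts F) \<inter> {(i, j). {i, j} \<in> edges F}. W (x i) (x j)) *
     (\<Prod>(i, j)\<in>pairs (verts F) \<inter> - {(i, j). {i, j} \<in> edges F}. 1 - W (x i) (x j))"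
    using assms by (subst prod.If_cases) auto
  also have "\<dots> = Psi F W x"
    unfolding Psi_def
    by (intro arg_cong2[where f = "(*)"] prod.cong) (auto simp: pairs_def)
  finally show ?thesis ..
qed

lemma Psi_sym_eq_sym_pat:
  assumes "finite (verts F)"
  shows "Psi_sym F W x = sym_pat F (\<lambda>i j. W (x i) (x j))"
  unfolding Psi_sym_def sym_pat_def Psi_eq_pat[OF assms] ..

text \<open>A permutation keeps distinct vertices distinct, so the diagonal of the array is never
  read.\<close>

lemma sym_pat_cong:
  assumes "\<And>i j. i \<in> verts F \<Longrightarrow> j \<in> verts F \<Longrightarrow> i \<noteq> j \<Longrightarrow> D i j = D' i j"
  shows "sym_pat F D = sym_pat F D'"
proof -
  have "pat F (\<lambda>i j. D (\<sigma> i) (\<sigma> j)) = pat F (\<lambda>i j. D' (\<sigma> i) (\<sigma> j))" if "\<sigma> permutes verts F" for \<sigma>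
    unfolding pat_def
  proof (intro prod.cong refl)
    fix e assume "e \<in> pairs (verts F)"
    then obtain i j where e: "e = (i, j)" "i \<in> verts F" "j \<in> verts F" "i < j" by (auto simp: pairs_def)
    have "\<sigma> i \<noteq> \<sigma> j" using e permutes_inj[OF that] by (auto dest: injD)
    then have "D (\<sigma> i) (\<sigma> j) = D' (\<sigma> i) (\<sigma> j)"
      using e permutes_in_image[OF that] by (intro assms) auto
    then show "(case e of (i, j) \<Rightarrow> if {i, j} \<in> edges F then D (\<sigma> i) (\<sigma> j) else 1 - D (\<sigma> i) (\<sigma> j)) =
      (case e of (i, j) \<Rightarrow> if {i, j} \<in> edges F then D' (\<sigma> i) (\<sigma> j) else 1 - D' (\<sigma> i) (\<sigma> j))"
      by (simp add: e)
  qed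
  then show ?thesis unfolding sym_pat_def by simp
qed

lemma prod_pat_nsets:
  fixes u :: real
  assumes "simple_graph F" "finite A"
  shows "(\<Prod>e\<in>nsets A 2. if e \<in> edges F then u else 1 - u) =
    u ^ edges_in F A * (1 - u) ^ ((card A choose 2) - edges_in F A)"
proof -
  let ?N = "nsets A 2"
  have fin: "finite ?N" using assms finite_imp_finite_nsets by blast
  have eq: "?N \<inter> edges F = {e \<in> edges F. e \<subseteq> A}"
    using assms by (auto simp: simple_graph_def nsets_def)
  have "card (?N - edges F) = card ?N - card (?N \<inter> edges F)"
    using fin by (metis card_Diff_subset_Int finite_Int)
  then have c: "card (?N \<inter> - edges F) = (card A choose 2) - edges_in F A"
    by (simp add: eq edges_in_def Diff_eq)
  have "(\<Prod>e\<in>?N. if e \<in> edges F then u else 1 - u) = 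
     (\<Prod>e\<in>?N \<inter> edges F. u) * (\<Prod>e\<in>?N \<inter> - edges F. 1 - u)"
    using fin by (subst prod.If_cases) auto
  then show ?thesis using c by (simp add: eq edges_in_def)
qed

definition cross_pairs :: "nat set \<Rightarrow> nat set \<Rightarrow> nat set set" where
  "cross_pairs A B = (\<lambda>(a, b). {a, b}) ` (A \<times> B)"

lemma prod_pat_cross:
  fixes u :: real
  assumes "simple_graph F" "finite A" "finite B" "A \<inter> B = {}"
  shows "(\<Prod>e\<in>cross_pairs A B. if e \<in> edges F then u else 1 - u) =
    u ^ edges_between F A B * (1 - u) ^ (card A * card B - edges_between F A B)"
proof -
  let ?N = "cross_pairs A B"
  have fin: "finite ?N" using assms by (simp add: cross_pairs_def)
  have eq: "?N \<inter> edges F = {e \<in> edges F. \<exists>a\<in>A. \<exists>b\<in>B. e = {a, b}}"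
    by (auto simp: cross_pairs_def)
  have "inj_on (\<lambda>(a, b). {a, b}) (A \<times> B)"
    using assms by (auto simp: inj_on_def doubleton_eq_iff)
  then have cN: "card ?N = card A * card B"
    by (simp add: cross_pairs_def card_image card_cartesian_product)
  have "card (?N - edges F) = card ?N - card (?N \<inter> edges F)"
    using fin by (metis card_Diff_subset_Int finite_Int)
  then have c: "card (?N \<inter> - edges F) = card A * card B - edges_between F A B"
    by (simp add: eq edges_between_def Diff_eq cN)
  have "(\<Prod>e\<in>?N. if e \<in> edges F then u else 1 - u) = 
     (\<Prod>e\<in>?N \<inter> edges F. u) * (\<Prod>e\<in>?N \<inter> - edges F. 1 - u)"
    using fin by (subst prod.If_cases) auto
  then show ?thesis using c by (simp add: eq edges_between_def)
qed

definition two_type :: "nat set \<Rightarrow> real \<Rightarrow> real \<Rightarrow> real \<Rightarrow> nat \<Rightarrow> nat \<Rightarrow> real" where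
  "two_type A u v s i j = (if i \<in> A \<and> j \<in> A then u else if i \<notin> A \<and> j \<notin> A then v else s)"

text \<open>The summand of \<open>Q\<close> with \<open>j\<close> replaced by \<open>card A\<close>:
  it depends on the set alone and can be averaged over permutations.\<close>

definition Q_term :: "ugraph \<Rightarrow> real \<Rightarrow> real \<Rightarrow> real \<Rightarrow> nat set \<Rightarrow> real" where
  "Q_term F u v s A = (let B = verts F - A; k = num_verts F; j = card A in
       u ^ edges_in F A * (1 - u) ^ ((j choose 2) - edges_in F A) *
       v ^ edges_in F B * (1 - v) ^ (((k - j) choose 2) - edges_in F B) *
       s ^ edges_between F A B * (1 - s) ^ (j * (k - j) - edges_between F A B))"

lemma Q_eq_sum_Q_term: "Q F j u v s = (\<Sum>A | A \<subseteq> verts F \<and> card A = j. Q_term F u v s A)"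
  unfolding Q_def Q_term_def by (intro sum.cong) (auto simp: Let_def)

text \<open>Each pair of vertices lies inside \<open>A\<close>, inside the complement or across, and
  the product splits accordingly into the factors in \<open>u\<close>, \<open>v\<close> and
  \<open>s\<close>.\<close>

lemma pat_two_type:
  assumes F: "simple_graph F" and A: "A \<subseteq> verts F"
  shows "pat F (two_type A u v s) = Q_term F u v s A"
proof -
  define B where "B = verts F - A"
  have fin: "finite (verts F)" "finite A" "finite B" and V: "verts F = A \<union> B" and d: "A \<inter> B = {}"
    using F A finite_subset by (auto simp: B_def simple_graph_def)
  have cB: "card B = num_verts F - card A"
    unfolding B_def num_verts_def using A fin by (simp add: card_Diff_subset)
  define h where "h e = (if e \<subseteq> A then u else if e \<subseteq> B then v else s)" for e
  define g where "g e = (if e \<in> edges F then h e else 1 - h e)" for e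
  have "pat F (two_type A u v s) = (\<Prod>(i, j)\<in>pairs (verts F). g {i, j})"
    unfolding pat_def by (intro prod.cong) (auto simp: pairs_def two_type_def g_def h_def B_def)
  also have "\<dots> = (\<Prod>e\<in>nsets (verts F) 2. g e)" by (rule prod_pairs_eq_prod_nsets)
  also have "nsets (verts F) 2 = (nsets A 2 \<union> nsets B 2) \<union> cross_pairs A B"
  proof (intro equalityI subsetI)
    fix e assume "e \<in> nsets (verts F) 2"
    then obtain x y where e: "e = {x, y}" "x \<noteq> y" "x \<in> A \<union> B" "y \<in> A \<union> B"
      by (auto simp: V nsets_2_eq)
    have "{x, y} \<in> cross_pairs A B" if "x \<in> A \<and> y \<in> B \<or> x \<in> B \<and> y \<in> A"
      using that by (auto simp: cross_pairs_def image_iff insert_commute)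
    then show "e \<in> (nsets A 2 \<union> nsets B 2) \<union> cross_pairs A B"
      using e by auto
  next
    fix e assume "e \<in> (nsets A 2 \<union> nsets B 2) \<union> cross_pairs A B"
    then show "e \<in> nsets (verts F) 2"
    proof (elim UnE)
      assume "e \<in> cross_pairs A B"
      then show ?thesis using d by (auto simp: cross_pairs_def V)
    qed (auto simp: V nsets_def)
  qed
  also have "(\<Prod>e\<in>\<dots>. g e) = (\<Prod>e\<in>nsets A 2 \<union> nsets B 2. g e) * (\<Prod>e\<in>cross_pairs A B. g e)"
    using fin d by (intro prod.union_disjoint)
      (auto simp: finite_imp_finite_nsets cross_pairs_def nsets_2_eq doubleton_eq_iff)
  also have "(\<Prod>e\<in>nsets A 2 \<union> nsets B 2. g e) = (\<Prod>e\<in>nsets A 2. g e) * (\<Prod>e\<in>nsets B 2. g e)"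
    using fin d by (intro prod.union_disjoint)
      (auto simp: finite_imp_finite_nsets nsets_2_eq doubleton_eq_iff)
  also have "(\<Prod>e\<in>nsets A 2. g e) = (\<Prod>e\<in>nsets A 2. if e \<in> edges F then u else 1 - u)"
    by (intro prod.cong) (auto simp: g_def h_def nsets_def)
  also have "(\<Prod>e\<in>nsets B 2. g e) = (\<Prod>e\<in>nsets B 2. if e \<in> edges F then v else 1 - v)"
    using d by (intro prod.cong) (auto simp: g_def h_def nsets_2_eq)
  also have "(\<Prod>e\<in>cross_pairs A B. g e) = (\<Prod>e\<in>cross_pairs A B. if e \<in> edges F then s else 1 - s)"
    using d by (intro prod.cong) (auto simp: g_def h_def cross_pairs_def)
  finally show ?thesis
    using F fin d by (simp add: prod_pat_nsets prod_pat_cross Q_term_def Let_def cB[symmetric] B_def[symmetric] mult.assoc)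
qed

lemma ex_permutes_image_eq:
  assumes "finite V" "A \<subseteq> V" "B \<subseteq> V" "card A = card B"
  obtains \<tau> where "\<tau> permutes V" "\<tau> ` A = B"
proof -
  have fin: "finite A" "finite B" using assms finite_subset by auto
  obtain f where f: "bij_betw f A B" using finite_same_card_bij[OF fin assms(4)] by auto
  have "card (V - A) = card (V - B)" using assms fin by (simp add: card_Diff_subset)
  then obtain g where g: "bij_betw g (V - A) (V - B)"
    using finite_same_card_bij[of "V - A" "V - B"] assms by auto
  define t where "t x = (if x \<in> A then f x else if x \<in> V then g x else x)" for x
  have "bij_betw t A B" using f by (rule bij_betw_cong[THEN iffD1, rotated]) (auto simp: t_def)
  moreover have "bij_betw t (V - A) (V - B)"
    using g by (rule bij_betw_cong[THEN iffD1, rotated]) (auto simp: t_def)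
  ultimately have "bij_betw t (A \<union> (V - A)) (B \<union> (V - B))" by (rule bij_betw_combine) auto
  then have "bij_betw t V V" using assms by (simp add: Un_absorb1)
  then have "t permutes V" using assms by (intro bij_imp_permutes) (auto simp: t_def)
  moreover have "t ` A = B" using \<open>bij_betw t A B\<close> by (simp add: bij_betw_def)
  ultimately show ?thesis by (rule that)
qed

text \<open>The left-hand sum depends only on the cardinality of \<open>A\<close>, so it may be averaged over all sets of that size.\<close>

lemma sum_permutes_preimage:
  fixes \<phi> :: "'a set \<Rightarrow> real"
  assumes V: "finite V" and A: "A \<subseteq> V"
  shows "real (card V choose card A) * (\<Sum>\<sigma> | \<sigma> permutes V. \<phi> {x \<in> V. \<sigma> x \<in> A}) =
    fact (card V) * (\<Sum>B | B \<subseteq> V \<and> card B = card A. \<phi> B)"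
proof -
  define j where "j = card A"
  define P where "P = {\<sigma>. \<sigma> permutes V}"
  define S where "S = {B. B \<subseteq> V \<and> card B = j}"
  have finP: "finite P" "card P = fact (card V)" using V by (auto simp: P_def finite_permutations card_permutations)
  have finS: "finite S" using V by (auto simp: S_def)
  have cS: "card S = card V choose j" using n_subsets[OF V] by (simp add: S_def)
  define T where "T A = (\<Sum>\<sigma>\<in>P. \<phi> {x \<in> V. \<sigma> x \<in> A})" for A
  have TA: "T B = T A" if "B \<in> S" for B
  proof -
    have "B \<subseteq> V" "card A = card B" using that by (auto simp: S_def j_def)
    from ex_permutes_image_eq[OF V A this] obtain \<tau> where t: "\<tau> permutes V" "\<tau> ` A = B" .
    have "T B = (\<Sum>\<sigma>\<in>P. \<phi> {x \<in> V. (\<tau> \<circ> \<sigma>) x \<in> B})"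
      unfolding T_def P_def using t(1)
      by (rule setum_permutations_compose_left)
    also have "\<dots> = T A"
      unfolding T_def P_def
    proof (intro sum.cong arg_cong[of _ _ \<phi>] refl Collect_cong)
      fix \<sigma> x assume "\<sigma> \<in> {\<sigma>. \<sigma> permutes V}"
      show "(x \<in> V \<and> (\<tau> \<circ> \<sigma>) x \<in> B) = (x \<in> V \<and> \<sigma> x \<in> A)"
        using inj_image_mem_iff[OF permutes_inj[OF t(1)], of "\<sigma> x" A] t(2) by simp
    qed
    finally show ?thesis .
  qed
  have inner: "(\<Sum>B\<in>S. \<phi> {x \<in> V. \<sigma> x \<in> B}) = (\<Sum>B\<in>S. \<phi> B)" if "\<sigma> \<in> P" for \<sigma>
  proof -
    have s: "\<sigma> permutes V" using that by (simp add: P_def)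
    show ?thesis
    proof (rule sum.reindex_bij_witness[of _ "\<lambda>B. \<sigma> ` B" "\<lambda>B. {x \<in> V. \<sigma> x \<in> B}"])
      fix B assume B: "B \<in> S"
      show "\<sigma> ` {x \<in> V. \<sigma> x \<in> B} = B"
        using B s by (auto simp: S_def image_iff) (metis permutes_def subsetD)
      then have "card {x \<in> V. \<sigma> x \<in> B} = card B"
        by (metis (no_types, lifting) card_image inj_on_subset permutes_inj s subset_UNIV)
      then show "{x \<in> V. \<sigma> x \<in> B} \<in> S" using B by (auto simp: S_def)
      show "{x \<in> V. \<sigma> x \<in> \<sigma> ` B} = B"
        using B permutes_inj[OF s] by (auto simp: S_def inj_image_mem_iff)
      show "\<sigma> ` B \<in> S"
        using B s by (auto simp: S_def permutes_in_image card_image permutes_inj_on)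
    qed auto
  qed
  have "real (card V choose j) * T A = (\<Sum>B\<in>S. T B)"
    using TA cS by simp
  also have "\<dots> = (\<Sum>\<sigma>\<in>P. \<Sum>B\<in>S. \<phi> {x \<in> V. \<sigma> x \<in> B})" unfolding T_def by (rule sum.swap)
  also have "\<dots> = fact (card V) * (\<Sum>B\<in>S. \<phi> B)" using inner finP by simp
  finally show ?thesis by (simp add: T_def P_def S_def j_def)
qed

text \<open>A uniformly random permutation moves \<open>A\<close> to a uniformly random set of the
  same size, so symmetrizing averages \<open>Q_term\<close> over all sets of that size. This
  translates the equations of (iv) into symmetrized densities and back.\<close>

lemma sym_pat_two_type:
  assumes F: "simple_graph F" and A: "A \<subseteq> verts F"
  shows "real (num_verts F choose card A) * sym_pat F (two_type A u v s) = Q F (card A) u v s"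
proof -
  have fin: "finite (verts F)" using F by (simp add: simple_graph_def)
  have "pat F (\<lambda>i j. two_type A u v s (\<sigma> i) (\<sigma> j)) = Q_term F u v s {x \<in> verts F. \<sigma> x \<in> A}" 
    if "\<sigma> permutes verts F" for \<sigma>
  proof -
    have "pat F (\<lambda>i j. two_type A u v s (\<sigma> i) (\<sigma> j)) = pat F (two_type {x \<in> verts F. \<sigma> x \<in> A} u v s)"
      unfolding pat_def by (intro prod.cong) (auto simp: pairs_def two_type_def)
    then show ?thesis using F by (simp add: pat_two_type)
  qed
  then have "sym_pat F (two_type A u v s) =
     (\<Sum>\<sigma> | \<sigma> permutes verts F. Q_term F u v s {x \<in> verts F. \<sigma> x \<in> A}) / fact (num_verts F)"
    unfolding sym_pat_def by simp
  then have "real (num_verts F choose card A) * sym_pat F (two_type A u v s) * fact (num_verts F) =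
      fact (num_verts F) * (\<Sum>B | B \<subseteq> verts F \<and> card B = card A. Q_term F u v s B)"
    using sum_permutes_preimage[OF fin A, of "Q_term F u v s"] by (simp add: num_verts_def)
  then show ?thesis unfolding Q_eq_sum_Q_term by simp
qed

section \<open>The conjugate density\<close>

lemma beta_bounds:
  assumes "0 < q" "q < 1" shows "0 < beta F q"
  using assms by (simp add: beta_def)

lemma num_edges_le:
  assumes "simple_graph F" shows "num_edges F \<le> num_verts F choose 2"
proof -
  have "card (edges F) \<le> card (nsets (verts F) 2)"
    using assms by (intro card_mono finite_imp_finite_nsets) (auto simp: simple_graph_def)
  then show ?thesis by (simp add: num_edges_def num_verts_def)
qed

lemma num_edges_eq_iff:
  assumes "simple_graph F"
  shows "num_edges F = 0 \<longleftrightarrow> edges F = {}"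
    and "num_edges F = num_verts F choose 2 \<longleftrightarrow> edges F = nsets (verts F) 2"
proof -
  have fin: "finite (nsets (verts F) 2)" "edges F \<subseteq> nsets (verts F) 2"
    using assms by (auto simp: simple_graph_def finite_imp_finite_nsets)
  then have "finite (edges F)" using finite_subset by blast
  then show "num_edges F = 0 \<longleftrightarrow> edges F = {}"
    by (simp add: num_edges_def)
  show "num_edges F = num_verts F choose 2 \<longleftrightarrow> edges F = nsets (verts F) 2"
  proof
    assume "num_edges F = num_verts F choose 2"
    then have "card (edges F) = card (nsets (verts F) 2)" by (simp add: num_edges_def num_verts_def)
    then show "edges F = nsets (verts F) 2" by (rule card_subset_eq[OF fin])
  qed (simp add: num_edges_def num_verts_def)
qed

text \<open>The derivative at t is t^(a-1) * (1-t)^(b-1) * (a - (a+b) * t), which is positive to the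
  left of a / (a+b).\<close>

lemma power_mult_power_strict_mono:
  fixes a b :: nat and x y :: real
  assumes "0 < a" "0 < b" "0 \<le> x" "x < y" "y \<le> a / (a + b)"
  shows "x ^ a * (1 - x) ^ b < y ^ a * (1 - y) ^ b"
proof -
  have ab: "real a / (a + b) < 1" using assms(1,2) by (simp add: field_simps)
  show ?thesis
  proof (rule DERIV_pos_imp_increasing_open[OF assms(4)])
    fix t assume t: "x < t" "t < y"
    then have t': "0 < t" "t < a / (a + b)" "t < 1" using assms ab by linarith+
    obtain a' b' where ab': "a = Suc a'" "b = Suc b'" using assms by (metis gr0_implies_Suc)
    have "((\<lambda>x. x ^ a * (1 - x) ^ b) has_real_derivative
       t ^ a' * (1 - t) ^ b' * (a - (a + b) * t)) (at t)"
    proof -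
      have 1: "((\<lambda>x. x ^ a) has_real_derivative (1 + a') * t ^ a') (at t)"
        using DERIV_pow[of a t UNIV] by (simp add: ab')
      have "((\<lambda>x. (1 - x) ^ b) has_real_derivative ((1 + b') * (1 - t) ^ b') * (0 - 1)) (at t)"
      proof (rule DERIV_chain2[where f = "\<lambda>x. x ^ b"])
        show "((\<lambda>x. x ^ b) has_real_derivative (1 + b') * (1 - t) ^ b') (at (1 - t))"
          using DERIV_pow[of b "1 - t" UNIV] by (simp only: ab' diff_Suc_Suc diff_zero plus_1_eq_Suc)
      qed (intro DERIV_diff DERIV_const DERIV_ident)
      note 2 = DERIV_mult[OF 1 this]
      have "(1 + real a') * A * ((1 - t) * B) + (1 + real b') * B * (0 - 1) * (t * A) =
          A * B * ((1 + real a') - ((1 + real a') + (1 + real b')) * t)" for A B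
        by (simp add: algebra_simps)
      from this[of "t ^ a'" "(1 - t) ^ b'"] show ?thesis
        by (intro DERIV_cong[OF 2]) (simp only: ab' power_Suc of_nat_Suc of_nat_add of_nat_1)
    qed
    moreover have "(a + b) * t < a"
      using t'(2) assms(1,2) by (simp add: pos_less_divide_eq mult.commute)
    then have "0 < t ^ a' * (1 - t) ^ b' * (a - (a + b) * t)"
      using t' by (intro mult_pos_pos zero_less_power) auto
    ultimately show "\<exists>d. ((\<lambda>x. x ^ a * (1 - x) ^ b) has_real_derivative d) (at t) \<and> 0 < d"
      by blast
  qed (intro continuous_intros)
qed

text \<open>The reflection t to 1 - t exchanges the two exponents and reduces this to the increasing
  side.\<close>

lemma power_mult_power_strict_antimono:
  fixes a b :: nat and x y :: real
  assumes "0 < a" "0 < b" "a / (a + b) \<le> x" "x < y" "y \<le> 1"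
  shows "y ^ a * (1 - y) ^ b < x ^ a * (1 - x) ^ b"
proof -
  have "1 - real a / (a + b) = b / (b + a)" using assms(1,2) by (simp add: field_simps)
  then have "1 - x \<le> b / (b + a)" using assms(3) by linarith
  then have "(1 - y) ^ b * (1 - (1 - y)) ^ a < (1 - x) ^ b * (1 - (1 - x)) ^ a"
    using assms by (intro power_mult_power_strict_mono) auto
  then show ?thesis by (simp only: mult.commute diff_diff_eq2 add_diff_cancel_left')
qed

text \<open>If \<open>F\<close> is neither empty nor complete, \<open>beta F\<close> vanishes at 0
  and 1, increases strictly up to the edge density and decreases strictly after it. So every
  positive value below the maximum is taken exactly once on either side, which makes the
  \<open>THE\<close> in \<open>conjugate\<close> well defined. The third claim later identifies a
  density from its \<open>beta\<close>.\<close>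

lemma beta_conjugate:
  fixes p :: real
  assumes F: "simple_graph F" and k: "num_verts F > 1" and p: "0 < p" "p < 1"
  shows "conjugate F p \<in> {0..1}" and "beta F (conjugate F p) = beta F p"
    and "\<And>r. r \<in> {0..1} \<Longrightarrow> beta F r = beta F p \<Longrightarrow> r \<in> {p, conjugate F p}"
proof -
  define e where "e = num_edges F"
  define N where "N = num_verts F choose 2"
  have N0: "N > 0" using k by (simp add: N_def zero_less_binomial_iff)
  have eN: "e \<le> N" using num_edges_le[OF F] by (simp add: e_def N_def)
  have b: "beta F q = q ^ e * (1 - q) ^ (N - e)" for q by (simp add: beta_def e_def N_def)
  have "conjugate F p \<in> {0..1} \<and> beta F (conjugate F p) = beta F p \<and>
    (\<forall>r\<in>{0..1}. beta F r = beta F p \<longrightarrow> r \<in> {p, conjugate F p})"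
  proof (cases "edges F = {} \<or> edges F = nsets (verts F) 2")
    case True
    from True have "edges F = {} \<or> edges F = nsets (verts F) 2 \<or> p = edge_density F" by blast
    then have c: "conjugate F p = p" unfolding conjugate_def by (rule if_P)
    \<comment> \<open>Here \<open>beta\<close> is a single power of q or of 1 - q, hence injective
      on the unit interval.\<close>
    have "e = 0 \<or> e = N" unfolding e_def N_def num_edges_eq_iff[OF F] by (rule True)
    then have "r = p" if "r \<in> {0..1}" "beta F r = beta F p" for r
    proof (cases "e = 0")
      case True
      have "(1 - r) ^ N = (1 - p) ^ N" using that(2) unfolding b True power_0 mult_1 diff_zero .
      then have "1 - r = 1 - p"
        by (rule power_eq_imp_eq_base) (use that(1) p N0 in simp_all)
      then show ?thesis by simp
    next
      case False
      then have "e = N" using \<open>e = 0 \<or> e = N\<close> by simp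
      have "r ^ N = p ^ N"
        using that(2) unfolding b \<open>e = N\<close> diff_self_eq_0 power_0 mult_1_right .
      then show ?thesis
        by (rule power_eq_imp_eq_base) (use that(1) p N0 in simp_all)
    qed
    then show ?thesis using p by (auto simp: c)
  next
    case False
    have "e \<noteq> 0" "e \<noteq> N" using False unfolding e_def N_def num_edges_eq_iff[OF F] by blast+
    then have e: "0 < e" "e < N" using eN by auto
    define m where "m = real e / N"
    have m: "0 < m" "m < 1" "m = edge_density F"
      using e N0 by (simp_all add: m_def edge_density_def flip: e_def N_def)
    have m': "m = real e / (real e + real (N - e))" using e by (simp add: m_def of_nat_diff)
    have inc: "beta F x < beta F y" if "0 \<le> x" "x < y" "y \<le> m" for x y
      unfolding b using e that m' by (intro power_mult_power_strict_mono) auto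
    have dec: "beta F y < beta F x" if "m \<le> x" "x < y" "y \<le> 1" for x y
      unfolding b using e that m' by (intro power_mult_power_strict_antimono) auto
    have b0: "beta F 0 = 0" "beta F 1 = 0" using e by (auto simp: b)
    have bp: "0 < beta F p" using p by (rule beta_bounds)
    have cont: "continuous_on S (beta F)" for S unfolding b[abs_def] by (intro continuous_intros)
    show ?thesis
    proof (cases "p = m")
      case True
      then have c: "conjugate F p = p" using m by (simp add: conjugate_def)
      have "r = p" if "r \<in> {0..1}" "beta F r = beta F p" for r
        using that inc[of r p] dec[of p r] True by (cases r p rule: linorder_cases) auto
      then show ?thesis using p by (auto simp: c)
    next
      case pm: False
      have ex: "\<exists>r\<in>{0..1}. r \<noteq> p \<and> beta F r = beta F p"
      proof (cases "p < m")
        case True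
        have "\<exists>r. m \<le> r \<and> r \<le> 1 \<and> beta F r = beta F p"
          using inc[of p m] True p m b0 bp by (intro IVT2') (auto intro: cont)
        then obtain r where "m \<le> r" "r \<le> 1" "beta F r = beta F p" by blast
        with True m show ?thesis by (intro bexI[of _ r]) auto
      next
        case False
        then have mp: "m < p" using pm by simp
        have "\<exists>r. 0 \<le> r \<and> r \<le> m \<and> beta F r = beta F p"
          using dec[of m p] mp p m b0 bp by (intro IVT') (auto intro: cont)
        then obtain r where "0 \<le> r" "r \<le> m" "beta F r = beta F p" by blast
        with mp m show ?thesis by (intro bexI[of _ r]) auto
      qed
      have same: "x = y" if xy: "x \<in> {0..1}" "y \<in> {0..1}" "beta F x = beta F y" "x \<le> m \<longleftrightarrow> y \<le> m" for x y
      proof (rule ccontr)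
        assume "x \<noteq> y"
        then consider "x < y" "y \<le> m" | "y < x" "x \<le> m" | "x < y" "m \<le> x" | "y < x" "m \<le> y"
          using xy(4) by linarith
        then have "beta F x \<noteq> beta F y"
          using xy(1,2) inc[of x y] inc[of y x] dec[of x y] dec[of y x] by cases auto
        then show False using xy(3) by simp
      qed
      have uniq: "r = r'" if "r \<in> {0..1}" "r \<noteq> p" "beta F r = beta F p" "r' \<in> {0..1}" "r' \<noteq> p" "beta F r' = beta F p" for r r'
      proof -
        have "r \<le> m \<longleftrightarrow> \<not> p \<le> m" using same[of r p] that p by auto
        moreover have "r' \<le> m \<longleftrightarrow> \<not> p \<le> m" using same[of r' p] that p by auto
        ultimately show ?thesis using same[of r r'] that by auto
      qed
      have c: "conjugate F p = (THE r. r \<in> {0..1} \<and> r \<noteq> p \<and> beta F r = beta F p)"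
        using False pm m by (auto simp: conjugate_def)
      from ex obtain r where r: "r \<in> {0..1}" "r \<noteq> p" "beta F r = beta F p" by auto
      have "conjugate F p = r" unfolding c using r uniq by (intro the_equality) auto
      moreover have "r' \<in> {p, r}" if "r' \<in> {0..1}" "beta F r' = beta F p" for r'
        using that r uniq[of r' r] by auto
      ultimately show ?thesis using r by auto
    qed
  qed
  then show "conjugate F p \<in> {0..1}" and "beta F (conjugate F p) = beta F p"
    and "\<And>r. r \<in> {0..1} \<Longrightarrow> beta F r = beta F p \<Longrightarrow> r \<in> {p, conjugate F p}" by blast+
qed

lemma edges_in_trivial:
  assumes "simple_graph F"
  shows "edges_in F {} = 0" and "edges_in F (verts F) = num_edges F"
proof -
  have "{e \<in> edges F. e \<subseteq> {}} = {}" "{e \<in> edges F. e \<subseteq> verts F} = edges F"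
    using assms by (auto simp: simple_graph_def nsets_def)
  then show "edges_in F {} = 0" "edges_in F (verts F) = num_edges F"
    unfolding edges_in_def num_edges_def by (simp_all only: card.empty)
qed

text \<open>These are the two values of j that (iv) leaves out. Together with
  \<open>beta_conjugate\<close> they express the condition that \<open>u\<close> and
  \<open>v\<close> belong to {p, \<open>conjugate F p\<close>}.\<close>

lemma Q_trivial:
  assumes F: "simple_graph F"
  shows "Q F (num_verts F) u v s = beta F u" and "Q F 0 u v s = beta F v"
proof -
  have fin: "finite (verts F)" using F by (simp add: simple_graph_def)
  have 1: "{A. A \<subseteq> verts F \<and> card A = num_verts F} = {verts F}"
    using fin by (auto simp: num_verts_def dest: card_subset_eq)
  have 2: "{A. A \<subseteq> verts F \<and> card A = 0} = {{}}"
    using fin by (auto simp: card_eq_0_iff dest: finite_subset)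
  have "edges_between F A B = 0" if "A = {} \<or> B = {}" for A B
    using that by (auto simp: edges_between_def)
  then show "Q F (num_verts F) u v s = beta F u" "Q F 0 u v s = beta F v"
    unfolding Q_eq_sum_Q_term 1 2
    by (simp_all add: Q_term_def Let_def beta_def edges_in_trivial[OF F] numeral_2_eq_2 flip: num_verts_def)
qed

section \<open>Homogeneous arrays\<close>

lemma tendsto_sym_pat:
  assumes "finite (verts F)"
    and "\<And>i j. i \<in> verts F \<Longrightarrow> j \<in> verts F \<Longrightarrow> i \<noteq> j \<Longrightarrow> (\<lambda>n. D n i j) \<longlonglongrightarrow> D' i j"
  shows "(\<lambda>n. sym_pat F (D n)) \<longlonglongrightarrow> sym_pat F D'"
proof -
  have "(\<lambda>n. pat F (\<lambda>i j. D n (\<sigma> i) (\<sigma> j))) \<longlonglongrightarrow> pat F (\<lambda>i j. D' (\<sigma> i) (\<sigma> j))"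
    if s: "\<sigma> permutes verts F" for \<sigma>
    unfolding pat_def
  proof (intro tendsto_prod)
    fix e assume "e \<in> pairs (verts F)"
    then obtain i j where e: "e = (i, j)" "i \<in> verts F" "j \<in> verts F" "i < j" by (auto simp: pairs_def)
    have "\<sigma> i \<noteq> \<sigma> j" using e permutes_inj[OF s] by (auto dest: injD)
    then have "(\<lambda>n. D n (\<sigma> i) (\<sigma> j)) \<longlonglongrightarrow> D' (\<sigma> i) (\<sigma> j)"
      using e permutes_in_image[OF s] by (intro assms) auto
    then show "(\<lambda>n. case e of (i, j) \<Rightarrow> if {i, j} \<in> edges F then D n (\<sigma> i) (\<sigma> j) else 1 - D n (\<sigma> i) (\<sigma> j))
       \<longlonglongrightarrow> (case e of (i, j) \<Rightarrow> if {i, j} \<in> edges F then D' (\<sigma> i) (\<sigma> j) else 1 - D' (\<sigma> i) (\<sigma> j))"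
      by (auto simp: e intro!: tendsto_intros)
  qed
  then show ?thesis unfolding sym_pat_def by (intro tendsto_divide tendsto_sum) auto
qed

lemma common_convergent_subsequence:
  fixes c :: "nat \<Rightarrow> 'i \<Rightarrow> real"
  assumes "finite I" "\<And>n i. i \<in> I \<Longrightarrow> c n i \<in> {0..1}"
  shows "\<exists>r l. strict_mono r \<and> (\<forall>i\<in>I. l i \<in> {0..1} \<and> (\<lambda>n. c (r n) i) \<longlonglongrightarrow> l i)"
  using assms
proof (induction I rule: finite_induct)
  case empty
  show ?case by (intro exI[of _ id]) (auto simp: strict_mono_def)
next
  case (insert x I)
  then obtain r l where r: "strict_mono r" "\<And>i. i \<in> I \<Longrightarrow> l i \<in> {0..1} \<and> (\<lambda>n. c (r n) i) \<longlonglongrightarrow> l i"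
    by fastforce
  have "compact {0..1::real}" by simp
  moreover have "\<forall>n. c (r n) x \<in> {0..1}" using insert by auto
  ultimately obtain y s where s: "y \<in> {0..1}" "strict_mono s" "((\<lambda>n. c (r n) x) \<circ> s) \<longlonglongrightarrow> y"
    unfolding compact_def by metis
  have "(\<lambda>n. c (r (s n)) i) \<longlonglongrightarrow> l i" if "i \<in> I" for i
    using LIMSEQ_subseq_LIMSEQ[OF _ s(2), of "\<lambda>n. c (r n) i"] r(2)[OF that] by (simp add: o_def)
  then show ?case
    using r s insert(2) strict_mono_o[OF r(1) s(2)]
    by (intro exI[of _ "r \<circ> s"] exI[of _ "l(x := y)"]) (auto simp: o_def)
qed

text \<open>The colouring \<open>f\<close> is not assumed symmetric. A two-element set receives the
  colour of its increasing pair (via \<open>Min\<close> and \<open>Max\<close>), and since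
  \<open>h\<close> is increasing the order is respected on the homogeneous set.\<close>

lemma finite_colour_ramsey:
  fixes k :: nat
  assumes "finite C"
  shows "\<exists>N::nat. \<forall>f. (\<forall>i j. i < j \<longrightarrow> j < N \<longrightarrow> f i j \<in> C) \<longrightarrow>
       (\<exists>c h. strict_mono_on {..<k} h \<and> h ` {..<k} \<subseteq> {..<N} \<and> (\<forall>i j. i < j \<longrightarrow> j < k \<longrightarrow> f (h i) (h j) = c))"
proof -
  obtain g where g: "bij_betw g C {..<card C}" using ex_bij_betw_finite_nat[OF assms] by (auto simp: lessThan_atLeast0)
  obtain N :: nat where N: "partn_lst {..<N} (replicate (card C) k) 2" using ramsey_full by blast
  have "\<exists>c h. strict_mono_on {..<k} h \<and> h ` {..<k} \<subseteq> {..<N} \<and> (\<forall>i j. i < j \<longrightarrow> j < k \<longrightarrow> f (h i) (h j) = c)"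
    if f: "\<And>i j. i < j \<Longrightarrow> j < N \<Longrightarrow> f i j \<in> C" for f
  proof -
    define f' where "f' e = g (f (Min e) (Max e))" for e
    have f'_pair: "f' {i, j} = g (f i j)" if "i < j" for i j using that by (simp add: f'_def)
    have "f' \<in> nsets {..<N} 2 \<rightarrow> {..<card C}"
      using f g by (auto simp: ordered_nsets_2_eq f'_pair bij_betw_def)
    from partn_lstE[OF N this] obtain t H where t: "t < card C" "H \<in> nsets {..<N} (replicate (card C) k ! t)"
      "f' ` nsets H 2 \<subseteq> {t}" by auto
    then have H: "H \<subseteq> {..<N}" "finite H" "card H = k" by (auto simp: nsets_def)
    define h where "h = (\<lambda>i. sorted_list_of_set H ! i)"
    have h1: "strict_mono_on {..<k} h"
      using H strict_sorted_list_of_set[of H]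
      by (auto simp: strict_mono_on_def h_def sorted_wrt_iff_nth_less)
    have h2: "h i \<in> H" if "i < k" for i
      using that H by (metis h_def nth_mem set_sorted_list_of_set length_sorted_list_of_set)
    have "f (h i) (h j) = inv_into C g t" if "i < j" "j < k" for i j
    proof -
      have lt: "h i < h j" using h1 that by (auto simp: strict_mono_on_def)
      have inH: "h i \<in> H" "h j \<in> H" using h2 that by auto
      then have "{h i, h j} \<in> nsets H 2" using lt by auto
      then have "g (f (h i) (h j)) = t" using t(3) by (metis f'_pair[OF lt] image_subset_iff singletonD)
      moreover have "f (h i) (h j) \<in> C" using f lt inH H by auto
      ultimately show ?thesis using g by (metis bij_betw_def inv_into_f_f)
    qed
    then show ?thesis using h1 h2 H by blast
  qed
  then show ?thesis by blast
qed

text \<open>The colour of a pair of positions is the whole 4 by 4 table of entries, each rounded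
  down to a multiple of 1 / (l + 1). Equal colours then mean that all sixteen entries agree up to
  that error.\<close>

lemma homogeneous_array:
  fixes k l :: nat
  shows "\<exists>N::nat. \<forall>m. (\<forall>a b i j. a < (4::nat) \<longrightarrow> b < (4::nat) \<longrightarrow> i < j \<longrightarrow> j < N \<longrightarrow> m a b i j \<in> {0..1::real}) \<longrightarrow>
       (\<exists>h c. strict_mono_on {..<k} h \<and> h ` {..<k} \<subseteq> {..<N} \<and> (\<forall>a<4. \<forall>b<4. c a b \<in> {0..1} \<and>
          (\<forall>i j. i < j \<longrightarrow> j < k \<longrightarrow> \<bar>m a b (h i) (h j) - c a b\<bar> \<le> 1 / (Suc l))))"
proof -
  define C where "C = PiE ({..<4::nat} \<times> {..<4::nat}) (\<lambda>_. {0..int (Suc l)})"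
  have "finite C" unfolding C_def by (intro finite_PiE) auto
  from finite_colour_ramsey[OF this, of k] obtain N :: nat where
    N: "\<forall>f. (\<forall>i j. i < j \<longrightarrow> j < N \<longrightarrow> f i j \<in> C) \<longrightarrow>
       (\<exists>c h. strict_mono_on {..<k} h \<and> h ` {..<k} \<subseteq> {..<N} \<and> (\<forall>i j. i < j \<longrightarrow> j < k \<longrightarrow> f (h i) (h j) = c))"
    by (elim exE)
  have "\<exists>h c. strict_mono_on {..<k} h \<and> h ` {..<k} \<subseteq> {..<N} \<and> (\<forall>a<4. \<forall>b<4. c a b \<in> {0..1} \<and>
          (\<forall>i j. i < j \<longrightarrow> j < k \<longrightarrow> \<bar>m a b (h i) (h j) - c a b\<bar> \<le> 1 / (Suc l)))"
    if m: "\<And>a b i j. a < (4::nat) \<Longrightarrow> b < (4::nat) \<Longrightarrow> i < j \<Longrightarrow> j < N \<Longrightarrow> m a b i j \<in> {0..1::real}" for m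
  proof -
    define f where "f i j = (\<lambda>(a, b)\<in>{..<4::nat} \<times> {..<4::nat}. \<lfloor>Suc l * m a b i j\<rfloor>)" for i j
    have "f i j \<in> C" if ij: "i < j" "j < N" for i j
    proof -
      have "\<lfloor>Suc l * m a b i j\<rfloor> \<in> {0..int (Suc l)}" if "a < 4" "b < 4" for a b
      proof -
        have "real (Suc l) * m a b i j \<le> real (Suc l) * 1"
          using m[OF that ij] by (intro mult_left_mono) auto
        then have "\<lfloor>Suc l * m a b i j\<rfloor> \<le> \<lfloor>real (Suc l)\<rfloor>" by (intro floor_mono) simp
        then have "\<lfloor>Suc l * m a b i j\<rfloor> \<le> int (Suc l)" by simp
        then show ?thesis using m[OF that ij] by simp
      qed
      then show ?thesis unfolding f_def C_def by (auto simp: PiE_def)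
    qed
    with N[rule_format, of f] obtain c h where h: "strict_mono_on {..<k} h" "h ` {..<k} \<subseteq> {..<N}"
      "\<And>i j. i < j \<Longrightarrow> j < k \<Longrightarrow> f (h i) (h j) = c" by blast
    show ?thesis
    \<comment> \<open>With fewer than two positions there is no first pair from which the constants
      could be read.\<close>
    proof (cases "k < 2")
      case True
      then have "\<not> (i < j \<and> j < k)" for i j by linarith
      then show ?thesis using h(1,2)
        by (intro exI[of _ h] exI[of _ "\<lambda>_ _. 0"] conjI) simp_all
    next
      case False
      define c' where "c' a b = m a b (h 0) (h 1)" for a b
      have lt: "h i < h j \<and> h j < N" if "i < j" "j < k" for i j
        using h that by (auto simp: strict_mono_on_def)
      have "c' a b \<in> {0..1}" if "a < 4" "b < 4" for a b
        unfolding c'_def using lt[of 0 1] m[OF that, of "h 0" "h 1"] False by auto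
      moreover have "\<bar>m a b (h i) (h j) - c' a b\<bar> \<le> 1 / (Suc l)" if "a < 4" "b < 4" "i < j" "j < k" for a b i j
      proof -
        have "f (h i) (h j) (a, b) = f (h 0) (h 1) (a, b)" using h(3)[of i j] h(3)[of 0 1] that False by simp
        then have "\<lfloor>Suc l * m a b (h i) (h j)\<rfloor> = \<lfloor>Suc l * m a b (h 0) (h 1)\<rfloor>"
          using that by (simp add: f_def)
        then have "\<bar>Suc l * m a b (h i) (h j) - Suc l * m a b (h 0) (h 1)\<bar> \<le> 1" by linarith
        then have "Suc l * \<bar>m a b (h i) (h j) - c' a b\<bar> \<le> 1"
          unfolding c'_def by (metis abs_mult abs_of_nat right_diff_distrib)
        then show ?thesis by (simp add: field_simps)
      qed
      ultimately show ?thesis using h(1,2) by blast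
    qed
  qed
  then show ?thesis by blast
qed

text \<open>Condition (iv).\<close>

definition rigid :: "ugraph \<Rightarrow> real \<Rightarrow> bool" where
  "rigid F p \<longleftrightarrow> (\<forall>u \<in> {p, conjugate F p}. \<forall>v \<in> {p, conjugate F p}. \<forall>s \<in> {0..1}.
     (\<forall>j \<in> {1..num_verts F - 1}. Q F j u v s = real (num_verts F choose j) * beta F p) \<longrightarrow> u = v \<and> v = s)"

lemma rigidD:
  assumes "rigid F p" "u \<in> {p, conjugate F p}" "v \<in> {p, conjugate F p}" "s \<in> {0..1}"
    and "\<And>j. j \<in> {1..num_verts F - 1} \<Longrightarrow> Q F j u v s = real (num_verts F choose j) * beta F p"
  shows "u = v" and "v = s"
  using assms unfolding rigid_def by blast+

text \<open>\<open>m a b i j\<close> is the density between the \<open>i\<close>-th member of group \<open>a\<close> and the \<open>j\<close>-th member of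
  group \<open>b\<close>; there are four groups of \<open>N\<close> members each.\<close>

definition array_near :: "ugraph \<Rightarrow> real \<Rightarrow> nat \<Rightarrow> real \<Rightarrow> (nat \<Rightarrow> nat \<Rightarrow> nat \<Rightarrow> nat \<Rightarrow> real) \<Rightarrow> bool" where
  "array_near F p N \<delta> m \<longleftrightarrow>
     (\<forall>a<4. \<forall>b<4. \<forall>i<N. \<forall>j<N. m a b i j \<in> {0..1} \<and> m a b i j = m b a j i) \<and>
     (\<forall>g \<iota>. g ` verts F \<subseteq> {..<4} \<longrightarrow> \<iota> ` verts F \<subseteq> {..<N} \<longrightarrow> inj_on \<iota> (verts F) \<longrightarrow>
        \<bar>sym_pat F (\<lambda>s t. m (g s) (g t) (\<iota> s) (\<iota> t)) - beta F p\<bar> \<le> \<delta>)"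

text \<open>Otherwise there is a bad array for every \<open>N\<close> and \<open>\<delta>\<close>. Ramsey's theorem makes it homogeneous up to
  an error tending to 0, and a limit of such arrays contradicts (iv).\<close>

lemma rigid_arrays:
  assumes F: "simple_graph F" and V: "verts F = {1..k}" and k: "k > 1" and p: "0 < p" "p < 1"
    and rigid: "rigid F p" and \<epsilon>: "0 < \<epsilon>"
  shows "\<exists>(N::nat) \<delta>. 0 < \<delta> \<and> (\<forall>m. \<not> (array_near F p N \<delta> m \<and>
     (\<forall>i j. i < j \<longrightarrow> j < N \<longrightarrow> \<epsilon> \<le> \<bar>m 0 1 i j - p\<bar>) \<and>
     (\<forall>i j. i < j \<longrightarrow> j < N \<longrightarrow> \<epsilon> \<le> \<bar>m 2 3 i j - conjugate F p\<bar>)))"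
proof (rule ccontr)
  define p' where "p' = conjugate F p"
  have fin: "finite (verts F)" and nv: "num_verts F = k" by (auto simp: V num_verts_def)
  assume "\<not> ?thesis"
  then have ex: "\<exists>m. array_near F p N \<delta> m \<and> (\<forall>i j. i < j \<longrightarrow> j < N \<longrightarrow> \<epsilon> \<le> \<bar>m 0 1 i j - p\<bar>) \<and>
       (\<forall>i j. i < j \<longrightarrow> j < N \<longrightarrow> \<epsilon> \<le> \<bar>m 2 3 i j - p'\<bar>)" if "0 < \<delta>" for N :: nat and \<delta> :: real
    using that unfolding p'_def by blast
  define hom where "hom N l m h c \<longleftrightarrow> strict_mono_on {..<k} h \<and> h ` {..<k} \<subseteq> {..<N} \<and>
      (\<forall>a<4. \<forall>b<4. c a b \<in> {0..1} \<and>
        (\<forall>i j. i < j \<longrightarrow> j < k \<longrightarrow> \<bar>m a b (h i) (h j) - c a b\<bar> \<le> 1 / (Suc l)))"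
    for N l :: nat and m h and c :: "nat \<Rightarrow> nat \<Rightarrow> real"
  define rng where "rng N m \<longleftrightarrow>
      (\<forall>a b i j. a < (4::nat) \<longrightarrow> b < (4::nat) \<longrightarrow> i < j \<longrightarrow> j < N \<longrightarrow> m a b i j \<in> {0..1::real})" for N :: nat and m
  define bad where "bad N l m \<longleftrightarrow> array_near F p N (1 / Suc l) m \<and>
      (\<forall>i j. i < j \<longrightarrow> j < N \<longrightarrow> \<epsilon> \<le> \<bar>m 0 1 i j - p\<bar>) \<and>
      (\<forall>i j. i < j \<longrightarrow> j < N \<longrightarrow> \<epsilon> \<le> \<bar>m 2 3 i j - p'\<bar>)" for N l :: nat and m
  have "\<exists>N. \<forall>m. rng N m \<longrightarrow> (\<exists>h c. hom N l m h c)" for l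
    unfolding hom_def rng_def by (rule homogeneous_array)
  moreover have "\<exists>m. bad N l m" for N l unfolding bad_def by (rule ex) simp
  moreover have "rng N m" if "bad N l m" for N l m
    unfolding rng_def
  proof (intro allI impI)
    fix a b i j :: nat assume "a < 4" "b < 4" "i < j" "j < N"
    moreover from this have "i < N" by simp
    ultimately show "m a b i j \<in> {0..1}" using that unfolding bad_def array_near_def by blast
  qed
  \<comment> \<open>At each precision \<open>l\<close>, the size \<open>N\<close> is taken from the
    Ramsey statement first and a bad array of that size afterwards. Hence every chosen array
    contains a nearly homogeneous part of the fixed length \<open>k\<close>.\<close>
  ultimately have "\<forall>l. \<exists>N m h c. hom N l m h c \<and> bad N l m" by metis
  then obtain N m h c where hom: "\<And>l. hom (N l) l (m l) (h l) (c l)" and bad: "\<And>l. bad (N l) l (m l)"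
    by metis
  have h: "strict_mono_on {..<k} (h l)" "h l ` {..<k} \<subseteq> {..<N l}" for l
    using hom[of l] by (auto simp: hom_def)
  have c: "c l a b \<in> {0..1}" if "a < 4" "b < 4" for l a b
    using hom[of l] that unfolding hom_def by blast
  have mc: "\<bar>m l a b (h l i) (h l j) - c l a b\<bar> \<le> 1 / (Suc l)" 
    if "a < 4" "b < 4" "i < j" "j < k" for l a b i j
    using hom[of l] that unfolding hom_def by blast
  have m: "array_near F p (N l) (1 / Suc l) (m l)" for l using bad[of l] by (simp add: bad_def)
  have m01: "\<epsilon> \<le> \<bar>m l 0 1 i j - p\<bar>" and m23: "\<epsilon> \<le> \<bar>m l 2 3 i j - p'\<bar>" if "i < j" "j < N l" for l i j
    using bad[of l] that unfolding bad_def by blast+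
  have "finite ({..<4::nat} \<times> {..<4::nat})" by simp
  moreover have "(\<lambda>(a, b). c l a b) ab \<in> {0..1}" if "ab \<in> {..<4} \<times> {..<4}" for l ab
    using c that by (cases ab) simp
  ultimately obtain r w where r: "strict_mono r" and
    w': "\<forall>ab\<in>{..<4} \<times> {..<4}. w ab \<in> {0..1} \<and> (\<lambda>n. (\<lambda>(a, b). c (r n) a b) ab) \<longlonglongrightarrow> w ab"
    using common_convergent_subsequence[of "{..<4} \<times> {..<4}" "\<lambda>l (a, b). c l a b"] by blast
  have w: "w (a, b) \<in> {0..1} \<and> (\<lambda>n. c (r n) a b) \<longlonglongrightarrow> w (a, b)" if "a < 4" "b < 4" for a b
    using w'[rule_format, of "(a, b)"] that by simp
  have r_lim: "(\<lambda>n. 1 / real (Suc (r n))) \<longlonglongrightarrow> 0"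
    using LIMSEQ_subseq_LIMSEQ[OF LIMSEQ_inverse_real_of_nat r] by (simp add: o_def divide_inverse)
  have m_lim: "(\<lambda>n. m (r n) a b (h (r n) i) (h (r n) j)) \<longlonglongrightarrow> w (a, b)"
    if "a < 4" "b < 4" "i < j" "j < k" for a b i j
  proof -
    have "(\<lambda>n. m (r n) a b (h (r n) i) (h (r n) j) - c (r n) a b) \<longlonglongrightarrow> 0"
      by (rule Lim_null_comparison[OF _ r_lim]) (use mc[OF that] in auto)
    from tendsto_add[OF this conjunct2[OF w[OF that(1,2)]]] show ?thesis by simp
  qed
  have hlt: "h l i < h l j \<and> h l j < N l" if "i < j" "j < k" for l i j
    using h[of l] that by (auto simp: strict_mono_on_def)
  \<comment> \<open>The vertices 1..j go to group \<open>a\<close>, the later ones to group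
    \<open>b\<close>, at increasing positions. An increasing pair of vertices then meets the groups
    in the order (a, a), (a, b) or (b, b), so the possibly different limit \<open>w (b, a)\<close>
    never enters.\<close>
  have w_eq: "sym_pat F (two_type {1..j} (w (a, a)) (w (b, b)) (w (a, b))) = beta F p"
    if ab: "a < 4" "b < 4" for a b j
  proof -
    define g where "g t = (if t \<le> j then a else b)" for t
    \<comment> \<open>Vertices are numbered from 1, the positions of \<open>h\<close> from
      0.\<close>
    define \<iota> where "\<iota> l t = h l (t - 1)" for l t
    define D where "D n s t = m (r n) (g s) (g t) (\<iota> (r n) s) (\<iota> (r n) t)" for n s t
    have \<iota>: "\<iota> l ` verts F \<subseteq> {..<N l}" for l
    proof (intro image_subsetI)
      fix t assume "t \<in> verts F"
      then have "t - 1 \<in> {..<k}" by (auto simp: V)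
      then show "\<iota> l t \<in> {..<N l}" using h(2)[of l] unfolding \<iota>_def by blast
    qed
    have "inj_on (\<iota> l) (verts F)" for l
    proof (intro linorder_inj_onI)
      fix s t assume "s < t" "s \<in> verts F" "t \<in> verts F"
      then have "s - 1 < t - 1" "t - 1 < k" by (auto simp: V)
      from hlt[OF this, of l] show "\<iota> l s \<noteq> \<iota> l t" by (simp add: \<iota>_def)
    qed (auto simp: V)
    moreover have "g ` verts F \<subseteq> {..<4}" using ab by (auto simp: g_def)
    ultimately have near: "\<bar>sym_pat F (D n) - beta F p\<bar> \<le> 1 / Suc (r n)" for n
      using m[of "r n"] \<iota>[of "r n"] unfolding array_near_def D_def[abs_def] by blast
    have "(\<lambda>n. D n s t) \<longlonglongrightarrow> two_type {1..j} (w (a, a)) (w (b, b)) (w (a, b)) s t"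
      if st: "s \<in> verts F" "t \<in> verts F" "s \<noteq> t" for s t
    proof -
      have *: "(\<lambda>n. D n s t) \<longlonglongrightarrow> two_type {1..j} (w (a, a)) (w (b, b)) (w (a, b)) s t"
        if "s \<in> verts F" "t \<in> verts F" "s < t" for s t
      proof -
        have "s - 1 < t - 1" "t - 1 < k" using that by (auto simp: V)
        then have "(\<lambda>n. D n s t) \<longlonglongrightarrow> w (g s, g t)"
          unfolding D_def \<iota>_def using ab by (intro m_lim) (auto simp: g_def)
        moreover have "w (g s, g t) = two_type {1..j} (w (a, a)) (w (b, b)) (w (a, b)) s t"
          using that by (auto simp: V g_def two_type_def)
        ultimately show ?thesis by simp
      qed
      have sym: "D n s t = D n t s" for n
      proof -
        have "\<iota> (r n) s < N (r n)" "\<iota> (r n) t < N (r n)" using \<iota>[of "r n"] st by auto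
        moreover have "g s < 4" "g t < 4" using ab by (auto simp: g_def)
        ultimately show ?thesis using m[of "r n"] unfolding D_def array_near_def by blast
      qed
      show ?thesis
      proof (cases "s < t")
        case True then show ?thesis using * st by simp
      next
        case False
        then have "t < s" using st by simp
        with *[of t s] st have "(\<lambda>n. D n t s) \<longlonglongrightarrow> two_type {1..j} (w (a, a)) (w (b, b)) (w (a, b)) t s" by simp
        moreover have "two_type {1..j} (w (a, a)) (w (b, b)) (w (a, b)) t s = two_type {1..j} (w (a, a)) (w (b, b)) (w (a, b)) s t"
          by (auto simp: two_type_def)
        ultimately show ?thesis by (simp add: sym)
      qed
    qed
    from tendsto_sym_pat[OF fin this]
    have "(\<lambda>n. sym_pat F (D n)) \<longlonglongrightarrow> sym_pat F (two_type {1..j} (w (a, a)) (w (b, b)) (w (a, b)))" .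
    moreover have "(\<lambda>n. sym_pat F (D n)) \<longlonglongrightarrow> beta F p"
    proof -
      have "(\<lambda>n. sym_pat F (D n) - beta F p) \<longlonglongrightarrow> 0"
        by (rule Lim_null_comparison[OF _ r_lim]) (use near in auto)
      from tendsto_add[OF this tendsto_const[of "beta F p"]] show ?thesis by simp
    qed
    ultimately show ?thesis using LIMSEQ_unique by blast
  qed
  have Qw: "Q F j (w (a, a)) (w (b, b)) (w (a, b)) = real (k choose j) * beta F p"
    if "a < 4" "b < 4" "j \<le> k" for a b j
    using sym_pat_two_type[OF F, of "{1..j}" "w (a, a)" "w (b, b)" "w (a, b)"] w_eq[of a b j] that
    by (simp add: V nv)
  \<comment> \<open>With j = k all vertices lie in one group, and the equation only says that
    \<open>w (a, a)\<close> has the same \<open>beta\<close> as \<open>p\<close>.\<close>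
  have in_p: "w (a, a) \<in> {p, p'}" if "a < 4" for a
    using Qw[OF that that, of k] w[OF that that] Q_trivial(1)[OF F] nv k beta_conjugate(3)[OF F _ p, of "w (a, a)"]
    by (simp add: p'_def)
  have eq: "w (a, a) = w (b, b) \<and> w (b, b) = w (a, b)" if "a < 4" "b < 4" for a b
  proof -
    have *: "Q F j (w (a, a)) (w (b, b)) (w (a, b)) = real (num_verts F choose j) * beta F p"
      if "j \<in> {1..num_verts F - 1}" for j
      using Qw[OF \<open>a < 4\<close> \<open>b < 4\<close>, of j] that by (auto simp: nv)
    show ?thesis
      using rigidD[OF rigid in_p[OF that(1), unfolded p'_def] in_p[OF that(2), unfolded p'_def]
        conjunct1[OF w[OF that]] *] by blast
  qed
  \<comment> \<open>Comparing groups 0 and 2 links the two witnesses: both limits are the same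
    element of {p, p'}, yet one stays away from p and the other from p'.\<close>
  have "w (0, 1) = w (0, 0)" "w (2, 3) = w (2, 2)" "w (0, 0) = w (2, 2)"
    using eq[of 0 1] eq[of 2 3] eq[of 0 2] by auto
  then have "w (0, 1) = w (2, 3)" "w (0, 1) \<in> {p, p'}" using in_p[of 0] by auto
  moreover have "\<epsilon> \<le> \<bar>w (0, 1) - p\<bar>"
    using hlt[of 0 1] k m01
    by (intro tendsto_lowerbound[OF tendsto_rabs[OF tendsto_diff[OF m_lim[of 0 1 0 1] tendsto_const]]]) auto
  moreover have "\<epsilon> \<le> \<bar>w (2, 3) - p'\<bar>"
    using hlt[of 0 1] k m23
    by (intro tendsto_lowerbound[OF tendsto_rabs[OF tendsto_diff[OF m_lim[of 2 3 0 1] tendsto_const]]]) auto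
  ultimately show False using \<epsilon> by auto
qed

section \<open>Graphons\<close>

abbreviation unit_leb :: "real measure" where "unit_leb \<equiv> restrict_space lborel {0..1}"

lemma space_unit_leb [simp]: "space unit_leb = {0..1}"
  by (simp add: space_restrict_space)

lemma prob_space_unit_leb: "prob_space unit_leb"
  by (rule prob_spaceI) (simp add: emeasure_restrict_space space_restrict_space)

lemmas sigma_finite_unit_leb = prob_space_imp_sigma_finite[OF prob_space_unit_leb]

lemma product_prob_space_unit_leb: "product_prob_space (\<lambda>_ :: nat. unit_leb)"
  using prob_space_unit_leb
  by (auto simp: product_prob_space_def product_sigma_finite_def product_prob_space_axioms_def
      prob_space_imp_sigma_finite)

section \<open>Measure of sets of tuples with prescribed relations\<close>

lemma borel_measurable_nn_integral_fun_upd: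
  assumes "g \<in> borel_measurable (PiM (insert i I) (\<lambda>_. unit_leb))"
  shows "(\<lambda>x. \<integral>\<^sup>+y. g (x(i := y)) \<partial>unit_leb) \<in> borel_measurable (PiM I (\<lambda>_. unit_leb))"
proof -
  have "(\<lambda>(x, y). g (x(i := y))) \<in> borel_measurable (PiM I (\<lambda>_. unit_leb) \<Otimes>\<^sub>M unit_leb)"
    using measurable_comp[OF measurable_add_dim assms] by (simp add: o_def case_prod_unfold)
  then show ?thesis by (rule sigma_finite_measure.borel_measurable_nn_integral[OF sigma_finite_unit_leb])
qed

lemma measurable_id_unit_leb: "(\<lambda>x. x) \<in> measurable unit_leb borel"
  by (rule measurable_restrict_space1) simp

definition rel_tuples :: "(nat \<Rightarrow> nat \<Rightarrow> (real \<times> real) set) \<Rightarrow> nat set \<Rightarrow> (nat \<Rightarrow> real) set" where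
  "rel_tuples R J = {z \<in> space (PiM J (\<lambda>_. unit_leb)). \<forall>i\<in>J. \<forall>j\<in>J. (z i, z j) \<in> R i j}"

lemma sets_rel_tuples:
  assumes "finite J" and R: "\<And>i j. R i j \<in> sets (borel \<Otimes>\<^sub>M borel)"
  shows "rel_tuples R J \<in> sets (PiM J (\<lambda>_. unit_leb))"
proof -
  let ?P = "PiM J (\<lambda>_. unit_leb)"
  have "{z \<in> space ?P. (z i, z j) \<in> R i j} \<in> sets ?P" if "i \<in> J" "j \<in> J" for i j
  proof -
    have "(\<lambda>z. z i) \<in> measurable ?P borel" if "i \<in> J" for i
      using measurable_comp[OF measurable_component_singleton[OF that] measurable_id_unit_leb]
      by (simp add: o_def)
    then have "(\<lambda>z. (z i, z j)) \<in> measurable ?P (borel \<Otimes>\<^sub>M borel)"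
      using that by (intro measurable_Pair) auto
    from measurable_sets[OF this R[of i j]] show ?thesis
      by (simp add: vimage_def Int_def conj_commute)
  qed
  then show ?thesis unfolding rel_tuples_def
    using assms(1) by (cases "J = {}") (auto intro!: sets.sets_Collect_finite_All')
qed

text \<open>If \<open>h\<close> is the measure of a section of the original set in direction \<open>i0\<close>, then the measure of the new
  set is the integral of \<open>h\<^sup>2\<close>, which vanishes only if the integral of \<open>h\<close> does.\<close>

lemma emeasure_rel_tuples_double:
  assumes J: "finite J" "i0 \<in> J" "i1 \<notin> J"
    and R: "\<And>i j. R i j \<in> sets (borel \<Otimes>\<^sub>M borel)"
    and tw: "\<And>j. R i1 j = R i0 j" "\<And>j. R j i1 = R j i0" and free: "R i0 i0 = UNIV"
    and pos: "emeasure (PiM J (\<lambda>_. unit_leb)) (rel_tuples R J) \<noteq> 0"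
  shows "emeasure (PiM (insert i1 J) (\<lambda>_. unit_leb)) (rel_tuples R (insert i1 J)) \<noteq> 0"
proof
  interpret unit_leb: product_prob_space "\<lambda>_ :: nat. unit_leb" by (rule product_prob_space_unit_leb)
  define K where "K = J - {i0}"
  have K: "finite K" "i0 \<notin> K" "i1 \<notin> K" "J = insert i0 K" "i1 \<noteq> i0" using J by (auto simp: K_def)
  let ?P = "\<lambda>I. PiM I (\<lambda>_ :: nat. unit_leb)"
  define f :: "(nat \<Rightarrow> real) \<Rightarrow> ennreal" where "f = indicator (rel_tuples R (insert i0 K))"
  define g :: "(nat \<Rightarrow> real) \<Rightarrow> ennreal" where "g = indicator (rel_tuples R (insert i1 (insert i0 K)))"
  have f_meas: "f \<in> borel_measurable (?P (insert i0 K))" and g_meas: "g \<in> borel_measurable (?P (insert i1 (insert i0 K)))"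
    unfolding f_def g_def using K R by (auto intro!: borel_measurable_indicator sets_rel_tuples)
  define h where "h w = (\<integral>\<^sup>+a. f (w(i0 := a)) \<partial>unit_leb)" for w
  \<comment> \<open>Once the other coordinates are fixed, the twins \<open>i0\<close> and
    \<open>i1\<close> obey the same constraints and none links them, because \<open>R i0 i1\<close>
    and \<open>R i1 i0\<close> reduce to \<open>R i0 i0\<close>. So the indicator
    factorizes.\<close>
  have fg: "g (w(i0 := a, i1 := b)) = f (w(i0 := a)) * f (w(i0 := b))"
    if "w \<in> space (?P K)" "a \<in> {0..1}" "b \<in> {0..1}" for w a b
  proof -
    have 1: "w(i0 := a, i1 := b) \<in> space (?P (insert i1 (insert i0 K)))"
      "w(i0 := a) \<in> space (?P (insert i0 K))" "w(i0 := b) \<in> space (?P (insert i0 K))"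
      using that by (auto simp: space_PiM PiE_def extensional_def)
    have ne: "x \<noteq> i0 \<and> x \<noteq> i1" if "x \<in> K" for x using that K by auto
    have eq: "w(i0 := a, i1 := b) \<in> rel_tuples R (insert i1 (insert i0 K)) \<longleftrightarrow>
          w(i0 := a) \<in> rel_tuples R (insert i0 K) \<and> w(i0 := b) \<in> rel_tuples R (insert i0 K)"
      using 1 ne K(5) by (auto simp: rel_tuples_def tw free)
    show ?thesis unfolding f_def g_def by (auto simp: eq indicator_def)
  qed
  have f_upd: "(\<lambda>a. f (w(i0 := a))) \<in> borel_measurable unit_leb" if "w \<in> space (?P K)" for w
    using measurable_comp[OF measurable_component_update f_meas, of w] that K(2)
    by (simp add: o_def fun_upd_def)
  assume "emeasure (?P (insert i1 J)) (rel_tuples R (insert i1 J)) = 0"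
  then have "0 = (\<integral>\<^sup>+z. g z \<partial>?P (insert i1 (insert i0 K)))"
    unfolding g_def K(4) using K R by (simp add: sets_rel_tuples)
  also have "\<dots> = (\<integral>\<^sup>+x. (\<integral>\<^sup>+b. g (x(i1 := b)) \<partial>unit_leb) \<partial>?P (insert i0 K))"
    using K g_meas by (intro unit_leb.product_nn_integral_insert) auto
  also have "\<dots> = (\<integral>\<^sup>+w. (\<integral>\<^sup>+a. (\<integral>\<^sup>+b. g (w(i0 := a, i1 := b)) \<partial>unit_leb) \<partial>unit_leb) \<partial>?P K)"
    using K borel_measurable_nn_integral_fun_upd[OF g_meas] by (intro unit_leb.product_nn_integral_insert) auto
  also have "\<dots> = (\<integral>\<^sup>+w. h w * h w \<partial>?P K)"
  proof (intro nn_integral_cong)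
    fix w assume w: "w \<in> space (?P K)"
    have "(\<integral>\<^sup>+a. (\<integral>\<^sup>+b. g (w(i0 := a, i1 := b)) \<partial>unit_leb) \<partial>unit_leb) =
      (\<integral>\<^sup>+a. (\<integral>\<^sup>+b. f (w(i0 := a)) * f (w(i0 := b)) \<partial>unit_leb) \<partial>unit_leb)"
      using fg[OF w] by (intro nn_integral_cong) auto
    also have "\<dots> = h w * h w"
      unfolding h_def using f_upd[OF w] by (simp add: nn_integral_cmult nn_integral_multc)
    finally show "(\<integral>\<^sup>+a. (\<integral>\<^sup>+b. g (w(i0 := a, i1 := b)) \<partial>unit_leb) \<partial>unit_leb) = h w * h w" .
  qed
  finally have 0: "(\<integral>\<^sup>+w. h w * h w \<partial>?P K) = 0" by simp
  have h_meas: "h \<in> borel_measurable (?P K)"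
    unfolding h_def by (rule borel_measurable_nn_integral_fun_upd[OF f_meas])
  have "AE w in ?P K. h w * h w = 0"
    using 0 h_meas by (subst (asm) nn_integral_0_iff_AE) auto
  then have "AE w in ?P K. h w = 0" by eventually_elim simp
  then have "(\<integral>\<^sup>+w. h w \<partial>?P K) = 0"
    using h_meas by (subst nn_integral_0_iff_AE) auto
  also have "(\<integral>\<^sup>+w. h w \<partial>?P K) = (\<integral>\<^sup>+z. f z \<partial>?P (insert i0 K))"
    unfolding h_def using K f_meas by (intro unit_leb.product_nn_integral_insert[symmetric]) auto
  also have "\<dots> = emeasure (?P J) (rel_tuples R J)"
    unfolding f_def K(4) using K R by (simp add: sets_rel_tuples)
  finally show False using pos by simp
qed


lemma emeasure_unit_square:
  assumes S: "S \<in> sets (borel \<Otimes>\<^sub>M borel)" "S \<subseteq> {0..1} \<times> {0..1}"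
  shows "(\<integral>\<^sup>+a. (\<integral>\<^sup>+b. indicator S (a, b) \<partial>unit_leb) \<partial>unit_leb) = emeasure lborel S"
proof -
  have "(\<integral>\<^sup>+a. (\<integral>\<^sup>+b. indicator S (a, b) \<partial>unit_leb) \<partial>unit_leb) =
     (\<integral>\<^sup>+a. (\<integral>\<^sup>+b. indicator S (a, b) * indicator {0..1} b \<partial>lborel) * indicator {0..1} a \<partial>lborel)"
    by (simp add: nn_integral_restrict_space)
  also have "\<dots> = (\<integral>\<^sup>+a. (\<integral>\<^sup>+b. indicator S (a, b) \<partial>lborel) \<partial>lborel)"
  proof (intro nn_integral_cong)
    fix a :: real
    have "indicator S (a, b) * indicator {0..1} b = (indicator S (a, b) :: ennreal)" for b
      using S(2) by (auto simp: indicator_def)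
    moreover have "(\<integral>\<^sup>+b. indicator S (a, b) \<partial>lborel) = 0" if "a \<notin> {0..1}"
    proof -
      have "indicator S (a, b) = (0 :: ennreal)" for b using S(2) that by (auto simp: indicator_def)
      then show ?thesis by simp
    qed
    ultimately show "(\<integral>\<^sup>+b. indicator S (a, b) * indicator {0..1} b \<partial>lborel) * indicator {0..1} a =
       (\<integral>\<^sup>+b. (indicator S (a, b) :: ennreal) \<partial>lborel)"
      by (cases "a \<in> {0..1}") auto
  qed
  also have "\<dots> = emeasure (lborel \<Otimes>\<^sub>M lborel) S"
    using S(1) by (intro lborel.emeasure_pair_measure[symmetric])
      (simp cong: sets_pair_measure_cong)
  finally show ?thesis by (simp add: lborel_prod)
qed

text \<open>The coordinate \<open>i\<close> belongs to the group \<open>i mod 4\<close>.\<close>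

definition crossR :: "(real \<times> real) set \<Rightarrow> (real \<times> real) set \<Rightarrow> nat \<Rightarrow> nat \<Rightarrow> (real \<times> real) set" where
  "crossR S S' i j = (if i mod 4 = 0 \<and> j mod 4 = 1 then S else if i mod 4 = 2 \<and> j mod 4 = 3 then S' else UNIV)"

lemma sets_crossR:
  assumes "S \<in> sets (borel \<Otimes>\<^sub>M borel)" "S' \<in> sets (borel \<Otimes>\<^sub>M borel)"
  shows "crossR S S' i j \<in> sets (borel \<Otimes>\<^sub>M borel)"
proof -
  have "UNIV \<in> sets (borel \<Otimes>\<^sub>M borel :: (real \<times> real) measure)"
    using sets.top[of "borel \<Otimes>\<^sub>M borel :: (real \<times> real) measure"] by (simp add: space_pair_measure)
  then show ?thesis using assms by (simp add: crossR_def)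
qed

text \<open>For the first four coordinates the measure is the product of the measures of
  \<open>S\<close> and \<open>S'\<close>. Each further coordinate \<open>4 + n\<close> is a twin of
  \<open>n mod 4\<close>, its representative among the first four, and doubling preserves
  positivity.\<close>

lemma emeasure_rel_tuples_crossR:
  assumes S: "S \<in> sets (borel \<Otimes>\<^sub>M borel)" "S \<subseteq> {0..1} \<times> {0..1}" "emeasure lborel S \<noteq> 0"
    and S': "S' \<in> sets (borel \<Otimes>\<^sub>M borel)" "S' \<subseteq> {0..1} \<times> {0..1}" "emeasure lborel S' \<noteq> 0"
  shows "emeasure (PiM {..<4 + n} (\<lambda>_. unit_leb)) (rel_tuples (crossR S S') {..<4 + n}) \<noteq> 0"
proof (induction n)
  case 0
  interpret unit_leb: product_prob_space "\<lambda>_ :: nat. unit_leb" by (rule product_prob_space_unit_leb)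
  let ?P = "\<lambda>I. PiM I (\<lambda>_ :: nat. unit_leb)"
  define H :: "real \<Rightarrow> ennreal" where "H c = (\<integral>\<^sup>+d. indicator S' (c, d) \<partial>unit_leb)" for c
  have comp: "(\<lambda>z. z i) \<in> measurable (?P I) borel" if "i \<in> I" for i I
    using measurable_comp[OF measurable_component_singleton[OF that] measurable_id_unit_leb]
    by (simp add: o_def)
  have ind: "(\<lambda>z. indicator T (z i, z j) :: ennreal) \<in> borel_measurable (?P I)"
    if "i \<in> I" "j \<in> I" "T \<in> sets (borel \<Otimes>\<^sub>M borel)" for i j I T
    using that measurable_comp[OF measurable_Pair[OF comp[of i I] comp[of j I]] borel_measurable_indicator[of T]]
    by (simp add: o_def)
  have H_meas: "H \<in> borel_measurable borel"
  proof -
    have "(\<lambda>p. (fst p, snd p)) \<in> measurable (borel \<Otimes>\<^sub>M unit_leb) (borel \<Otimes>\<^sub>M borel)"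
      by (intro measurable_Pair measurable_fst measurable_compose[OF measurable_snd measurable_id_unit_leb])
    from measurable_comp[OF this borel_measurable_indicator[OF S'(1)]]
    have "(\<lambda>(c, d). indicator S' (c, d) :: ennreal) \<in> borel_measurable (borel \<Otimes>\<^sub>M unit_leb)"
      by (simp add: o_def case_prod_unfold)
    then show ?thesis unfolding H_def by (rule sigma_finite_measure.borel_measurable_nn_integral[OF sigma_finite_unit_leb])
  qed
  have H_comp: "(\<lambda>z. H (z i)) \<in> borel_measurable (?P I)" if "i \<in> I" for i I
    using measurable_comp[OF comp[OF that] H_meas] by (simp add: o_def)
  have eq: "{..<4 + 0 :: nat} = insert 3 (insert 2 (insert 1 (insert 0 {})))" by auto
  have "emeasure (?P {..<4 + 0}) (rel_tuples (crossR S S') {..<4 + 0}) =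
      (\<integral>\<^sup>+z. indicator (rel_tuples (crossR S S') {..<4 + 0}) z \<partial>?P {..<4 + 0})"
    using S S' by (subst nn_integral_indicator) (auto intro!: sets_rel_tuples sets_crossR)
  also have "\<dots> = (\<integral>\<^sup>+z. indicator S (z 0, z 1) * indicator S' (z 2, z 3) \<partial>?P {..<4 + 0})"
    unfolding eq by (intro nn_integral_cong) (auto simp: rel_tuples_def crossR_def indicator_def)
  also have "\<dots> = (\<integral>\<^sup>+x. (\<integral>\<^sup>+d. indicator S (x 0, x 1) * indicator S' (x 2, d) \<partial>unit_leb) \<partial>?P (insert 2 (insert 1 (insert 0 {}))))"
    unfolding eq
    by (subst unit_leb.product_nn_integral_insert) (auto intro!: borel_measurable_times_ennreal ind S S')
  also have "\<dots> = (\<integral>\<^sup>+x. indicator S (x 0, x 1) * H (x 2) \<partial>?P (insert 2 (insert 1 (insert 0 {}))))"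
    unfolding H_def
  proof (intro nn_integral_cong nn_integral_cmult)
    fix c :: real
    show "(\<lambda>d. indicator S' (c, d) :: ennreal) \<in> borel_measurable unit_leb"
      using measurable_comp[OF measurable_Pair[OF measurable_const measurable_id_unit_leb] borel_measurable_indicator[OF S'(1)]]
      by (simp add: o_def)
  qed
  also have "\<dots> = (\<integral>\<^sup>+x. (\<integral>\<^sup>+c. indicator S (x 0, x 1) * H c \<partial>unit_leb) \<partial>?P (insert 1 (insert 0 {})))"
    by (subst unit_leb.product_nn_integral_insert) (auto intro!: borel_measurable_times_ennreal ind S H_comp)
  also have "\<dots> = (\<integral>\<^sup>+x. indicator S (x 0, x 1) * emeasure lborel S' \<partial>?P (insert 1 (insert 0 {})))"
  proof (intro nn_integral_cong)
    have "H \<in> borel_measurable unit_leb"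
      using measurable_comp[OF measurable_id_unit_leb H_meas] by (simp add: o_def)
    then show "(\<integral>\<^sup>+c. indicator S (x 0, x 1) * H c \<partial>unit_leb) = indicator S (x 0, x 1) * emeasure lborel S'" for x :: "nat \<Rightarrow> real"
      using emeasure_unit_square[OF S'(1,2)] by (simp add: nn_integral_cmult flip: H_def)
  qed
  also have "\<dots> = (\<integral>\<^sup>+x. indicator S (x 0, x 1) \<partial>?P (insert 1 (insert 0 {}))) * emeasure lborel S'"
    by (intro nn_integral_multc ind S) auto
  also have "(\<integral>\<^sup>+x. indicator S (x 0, x 1) \<partial>?P (insert 1 (insert 0 {}))) =
     (\<integral>\<^sup>+x. (\<integral>\<^sup>+b. indicator S (x 0, b) \<partial>unit_leb) \<partial>?P (insert 0 {}))"
    by (subst unit_leb.product_nn_integral_insert) (auto intro!: ind S)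
  also have "\<dots> = (\<integral>\<^sup>+x. (\<integral>\<^sup>+a. (\<integral>\<^sup>+b. indicator S (a, b) \<partial>unit_leb) \<partial>unit_leb) \<partial>?P {})"
  proof (subst unit_leb.product_nn_integral_insert)
    have "(\<lambda>z. (\<lambda>x. \<integral>\<^sup>+y. (\<lambda>x. indicator S (x 0, x 1)) (x(1 := y)) \<partial>unit_leb) z) \<in> borel_measurable (?P (insert 0 {}))"
      using S by (intro borel_measurable_nn_integral_fun_upd ind) auto
    then show "(\<lambda>z. \<integral>\<^sup>+b. indicator S (z 0, b) \<partial>unit_leb) \<in> borel_measurable (?P (insert 0 {}))" by simp
  qed auto
  also have "\<dots> = emeasure lborel S"
    using prob_space.emeasure_space_1[OF prob_space_PiM[of "{} :: nat set" "\<lambda>_. unit_leb"]]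
    by (simp add: emeasure_unit_square[OF S(1,2)])
  finally show ?case using S S' by simp
next
  case (Suc n)
  have "n mod 4 < 4" by simp
  have "emeasure (PiM (insert (4 + n) {..<4 + n}) (\<lambda>_. unit_leb)) (rel_tuples (crossR S S') (insert (4 + n) {..<4 + n})) \<noteq> 0"
    using Suc
    by (intro emeasure_rel_tuples_double[of _ "n mod 4"])
      (auto simp: sets_crossR[OF S(1) S'(1)], auto simp: crossR_def)
  moreover have "insert (4 + n) {..<4 + n} = {..<4 + Suc n}" by auto
  ultimately show ?case by simp
qed

text \<open>Distinct coordinates of a sample from a larger cube are again independent and uniform,
  so exceptional null sets pull back to null sets. Injectivity of \<open>\<kappa>\<close> is what
  makes the coordinates distinct.\<close>

lemma AE_cube_reindex:
  assumes "AE x in cube I. P x" and \<kappa>: "inj_on \<kappa> I" "\<kappa> ` I \<subseteq> J"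
  shows "AE z in PiM J (\<lambda>_. unit_leb). P (\<lambda>i\<in>I. z (\<kappa> i))"
proof -
  have "distr (PiM J (\<lambda>_. unit_leb)) (PiM I (\<lambda>_. unit_leb)) (\<lambda>z. \<lambda>i\<in>I. z (\<kappa> i)) = cube I"
    unfolding cube_def using \<kappa> by (intro distr_PiM_reindex prob_space_unit_leb) auto
  then have "AE x in distr (PiM J (\<lambda>_. unit_leb)) (PiM I (\<lambda>_. unit_leb)) (\<lambda>z. \<lambda>i\<in>I. z (\<kappa> i)). P x"
    using assms(1) by (simp only:)
  then show ?thesis
    using \<kappa>(2) by (elim AE_distrD[rotated]) (intro measurable_restrict measurable_component_singleton, auto)
qed

section \<open>From (iv) to (ii)\<close>

lemma graphon_level_set:
  assumes W: "graphon W" and not: "\<not> (AE (x, y) in lebesgue_on ({0..1} \<times> {0..1}). W x y = q)"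
  shows "\<exists>\<epsilon> S. 0 < \<epsilon> \<and> S \<in> sets (borel \<Otimes>\<^sub>M borel) \<and> S \<subseteq> {0..1} \<times> {0..1} \<and> emeasure lborel S \<noteq> 0 \<and>
    (\<forall>x y. (x, y) \<in> S \<longrightarrow> \<epsilon> \<le> \<bar>W x y - q\<bar>)"
proof -
  let ?U = "{0..1::real} \<times> {0..1::real}"
  let ?L = "lebesgue_on ?U"
  have U: "?U \<in> sets lebesgue" by (simp add: borel_closed closed_Times sets_completionI_sets)
  \<comment> \<open>A nonzero deviation from \<open>q\<close> is at least 1 / (n + 1) for some
    \<open>n\<close>, so by countable additivity one of these sets has positive measure.\<close>
  define T where "T n = {z \<in> space ?L. 1 / Suc n \<le> \<bar>(\<lambda>(x, y). W x y) z - q\<bar>}" for n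
  have meas: "(\<lambda>(x, y). W x y) \<in> borel_measurable ?L" using W by (simp add: graphon_def)
  have T: "T n \<in> sets ?L" for n
    unfolding T_def using meas by measurable
  have "\<exists>n. emeasure ?L (T n) \<noteq> 0"
  proof (rule ccontr)
    assume "\<not> ?thesis"
    then have "T n \<in> null_sets ?L" for n using T by (simp add: null_setsI)
    then have "(\<Union>n. T n) \<in> null_sets ?L" by (intro null_sets_UN)
    then have "AE z in ?L. (\<lambda>(x, y). W x y) z = q"
    proof (rule AE_I')
      show "{z \<in> space ?L. (\<lambda>(x, y). W x y) z \<noteq> q} \<subseteq> (\<Union>n. T n)"
      proof
        fix z assume z: "z \<in> {z \<in> space ?L. (\<lambda>(x, y). W x y) z \<noteq> q}"
        then have "0 < \<bar>(\<lambda>(x, y). W x y) z - q\<bar>" by simp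
        then obtain n where "inverse (Suc n) < \<bar>(\<lambda>(x, y). W x y) z - q\<bar>" using reals_Archimedean by blast
        then show "z \<in> (\<Union>n. T n)" using z by (auto simp: T_def inverse_eq_divide intro!: exI[of _ n])
      qed
    qed
    then show False using not by (simp add: case_prod_unfold)
  qed
  then obtain n where n: "emeasure ?L (T n) \<noteq> 0" by blast
  have TU: "T n \<subseteq> ?U" by (auto simp: T_def)
  have Tl: "T n \<in> sets lebesgue" using T[of n] U sets_restrict_space_iff[of ?U lebesgue] by simp
  \<comment> \<open>The level set is only Lebesgue measurable, while the cube is built from Borel
    sets. Its main part is a Borel subset of the same measure.\<close>
  define S where "S = main_part lborel (T n)"
  have S_meas: "S \<in> sets lborel" unfolding S_def using Tl by (rule main_part_sets)
  have "S \<union> null_part lborel (T n) = T n" unfolding S_def using Tl by (rule main_part_null_part_Un)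
  then have ST: "S \<subseteq> T n" by blast
  have "emeasure lborel S = emeasure lebesgue (T n)" unfolding S_def using Tl by (rule emeasure_completion[symmetric])
  also have "\<dots> = emeasure ?L (T n)" using TU U by (simp add: emeasure_restrict_space)
  finally have "emeasure lborel S \<noteq> 0" using n by simp
  moreover have "S \<in> sets (borel \<Otimes>\<^sub>M borel)" using S_meas by (simp only: borel_prod sets_lborel)
  moreover have "1 / Suc n \<le> \<bar>W x y - q\<bar>" if "(x, y) \<in> S" for x y
    using ST that by (auto simp: T_def)
  ultimately show ?thesis using ST TU by (intro exI[of _ "1 / Suc n"] exI[of _ S]) auto
qed

text \<open>The blow-up tuples have positive measure, so one of them avoids every exceptional null
  set. The values of \<open>W\<close> at its points form an array excluded by
  \<open>rigid_arrays\<close>.\<close>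

lemma rigid_imp_graphon_ae:
  assumes F: "simple_graph F" and V: "verts F = {1..k}" and k: "k > 1" and p: "0 < p" "p < 1"
    and rigid: "rigid F p" and W: "graphon W" and ae: "AE x in cube {1..k}. Psi_sym F W x = beta F p"
  shows "(AE (x, y) in lebesgue_on ({0..1} \<times> {0..1}). W x y = p) \<or>
        (AE (x, y) in lebesgue_on ({0..1} \<times> {0..1}). W x y = conjugate F p)"
proof (rule ccontr)
  assume "\<not> ?thesis"
  then have not: "\<not> (AE (x, y) in lebesgue_on ({0..1} \<times> {0..1}). W x y = p)"
    "\<not> (AE (x, y) in lebesgue_on ({0..1} \<times> {0..1}). W x y = conjugate F p)" by auto
  have fin: "finite (verts F)" by (simp add: V)
  obtain \<epsilon>1 S where S: "0 < \<epsilon>1" "S \<in> sets (borel \<Otimes>\<^sub>M borel)" "S \<subseteq> {0..1} \<times> {0..1}" "emeasure lborel S \<noteq> 0"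
    "\<And>x y. (x, y) \<in> S \<Longrightarrow> \<epsilon>1 \<le> \<bar>W x y - p\<bar>" using graphon_level_set[OF W not(1)] by blast
  obtain \<epsilon>2 S' where S': "0 < \<epsilon>2" "S' \<in> sets (borel \<Otimes>\<^sub>M borel)" "S' \<subseteq> {0..1} \<times> {0..1}" "emeasure lborel S' \<noteq> 0"
    "\<And>x y. (x, y) \<in> S' \<Longrightarrow> \<epsilon>2 \<le> \<bar>W x y - conjugate F p\<bar>" using graphon_level_set[OF W not(2)] by blast
  define \<epsilon> where "\<epsilon> = min \<epsilon>1 \<epsilon>2"
  have "0 < \<epsilon>" using S(1) S'(1) by (simp add: \<epsilon>_def)
  from rigid_arrays[OF F V k p rigid this] obtain N :: nat and \<delta> where "0 < \<delta>" and
    core: "\<And>m. \<not> (array_near F p N \<delta> m \<and>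
     (\<forall>i j. i < j \<longrightarrow> j < N \<longrightarrow> \<epsilon> \<le> \<bar>m 0 1 i j - p\<bar>) \<and>
     (\<forall>i j. i < j \<longrightarrow> j < N \<longrightarrow> \<epsilon> \<le> \<bar>m 2 3 i j - conjugate F p\<bar>))" by blast
  \<comment> \<open>Large enough for all indices \<open>4 * i + a\<close> with i < N and a < 4, and
    of the form \<open>4 + n\<close> handled by \<open>emeasure_rel_tuples_crossR\<close>.\<close>
  define J where "J = {..<4 + 4 * N}"
  let ?P = "PiM J (\<lambda>_. unit_leb)"
  define E where "E = rel_tuples (crossR S S') J"
  \<comment> \<open>One null set has to be avoided for every injective placement of the vertices of
    \<open>F\<close> among the coordinates; there are finitely many.\<close>
  define K where "K = {\<kappa> \<in> {1..k} \<rightarrow>\<^sub>E J. inj_on \<kappa> {1..k}}"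
  have E: "emeasure ?P E \<noteq> 0" unfolding E_def J_def using S S' by (intro emeasure_rel_tuples_crossR) auto
  have E_sets: "E \<in> sets ?P" unfolding E_def using S S' by (intro sets_rel_tuples sets_crossR) (auto simp: J_def)
  have finK: "finite K" unfolding K_def J_def by (intro finite_subset[OF _ finite_PiE[of "{1..k}" "\<lambda>_. {..<4 + 4 * N}"]]) auto
  have "AE z in ?P. Psi_sym F W (\<lambda>i\<in>{1..k}. z (\<kappa> i)) = beta F p" if "\<kappa> \<in> K" for \<kappa>
    using that by (intro AE_cube_reindex[OF ae]) (auto simp: K_def)
  then have ae': "AE z in ?P. \<forall>\<kappa>\<in>K. Psi_sym F W (\<lambda>i\<in>{1..k}. z (\<kappa> i)) = beta F p"
    by (intro AE_finite_allI finK) auto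
  have "\<exists>z\<in>E. \<forall>\<kappa>\<in>K. Psi_sym F W (\<lambda>i\<in>{1..k}. z (\<kappa> i)) = beta F p"
  proof (rule ccontr)
    assume "\<not> ?thesis"
    then have "AE z in ?P. z \<notin> E" using ae' by (auto elim!: eventually_mono)
    then have "E \<in> null_sets ?P" using E_sets by (simp add: AE_iff_null_sets)
    then show False using E by auto
  qed
  then obtain z where z: "z \<in> E" "\<And>\<kappa>. \<kappa> \<in> K \<Longrightarrow> Psi_sym F W (\<lambda>i\<in>{1..k}. z (\<kappa> i)) = beta F p" by blast
  have zJ: "z i \<in> {0..1}" if "i \<in> J" for i
    using z(1) that by (auto simp: E_def rel_tuples_def space_PiM PiE_def Pi_def)
  define m where "m a b i j = W (z (4 * i + a)) (z (4 * j + b))" for a b i j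
  have inJ: "4 * i + a \<in> J" if "i < N" "a < 4" for i a using that by (simp add: J_def)
  have "array_near F p N \<delta> m"
    unfolding array_near_def
  proof (intro conjI allI impI)
    fix a b i j :: nat assume "a < 4" "b < 4" "i < N" "j < N"
    then have "z (4 * i + a) \<in> {0..1}" "z (4 * j + b) \<in> {0..1}" using inJ zJ by auto
    then show "m a b i j \<in> {0..1}" "m a b i j = m b a j i"
      using W unfolding m_def graphon_def by blast+
  next
    fix g \<iota> :: "nat \<Rightarrow> nat"
    assume g: "g ` verts F \<subseteq> {..<4}" and \<iota>: "\<iota> ` verts F \<subseteq> {..<N}" "inj_on \<iota> (verts F)"
    \<comment> \<open>Member \<open>\<iota> t\<close> of group \<open>g t\<close> is this
      coordinate. Since the residue is below 4, the quotient recovers \<open>\<iota> t\<close>, so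
      injectivity of \<open>\<iota>\<close> suffices.\<close>
    define \<kappa> where "\<kappa> = (\<lambda>t\<in>{1..k}. 4 * \<iota> t + g t)"
    have "\<kappa> \<in> K"
    proof -
      have "s = t" if "s \<in> {1..k}" "t \<in> {1..k}" "4 * \<iota> s + g s = 4 * \<iota> t + g t" for s t
      proof -
        have "g s \<in> {..<4}" "g t \<in> {..<4}" using g that(1,2) V by blast+
        then have "g s < 4" "g t < 4" by simp_all
        then have "\<iota> s = \<iota> t" using that(3) by linarith
        then show ?thesis using \<iota>(2) that V by (auto dest: inj_onD)
      qed
      then have "inj_on \<kappa> {1..k}" unfolding \<kappa>_def by (intro inj_onI) simp
      moreover have "\<kappa> \<in> {1..k} \<rightarrow>\<^sub>E J"
      proof
        fix t assume t: "t \<in> {1..k}"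
        then have "g t \<in> {..<4}" "\<iota> t \<in> {..<N}" using g \<iota>(1) V by blast+
        then show "\<kappa> t \<in> J" using inJ t by (simp add: \<kappa>_def)
      qed (simp only: \<kappa>_def restrict_apply if_False)
      ultimately show ?thesis by (simp add: K_def)
    qed
    from z(2)[OF this] have "sym_pat F (\<lambda>s t. W ((\<lambda>i\<in>{1..k}. z (\<kappa> i)) s) ((\<lambda>i\<in>{1..k}. z (\<kappa> i)) t)) = beta F p"
      by (simp only: Psi_sym_eq_sym_pat[OF fin])
    also have "sym_pat F (\<lambda>s t. W ((\<lambda>i\<in>{1..k}. z (\<kappa> i)) s) ((\<lambda>i\<in>{1..k}. z (\<kappa> i)) t)) =
       sym_pat F (\<lambda>s t. m (g s) (g t) (\<iota> s) (\<iota> t))"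
      by (intro sym_pat_cong) (simp add: m_def \<kappa>_def V)
    finally show "\<bar>sym_pat F (\<lambda>s t. m (g s) (g t) (\<iota> s) (\<iota> t)) - beta F p\<bar> \<le> \<delta>"
      using \<open>0 < \<delta>\<close> by simp
  qed
  moreover have rel: "(z i, z j) \<in> crossR S S' i j" if "i \<in> J" "j \<in> J" for i j
    using z(1) that by (simp add: E_def rel_tuples_def)
  have "\<epsilon> \<le> \<bar>m 0 1 i j - p\<bar>" if "i < j" "j < N" for i j
  proof -
    have "(z (4 * i + 0), z (4 * j + 1)) \<in> S"
      using rel[OF inJ[of i 0] inJ[of j 1]] that by (simp add: crossR_def)
    from S(5)[OF this] show ?thesis by (simp add: m_def \<epsilon>_def)
  qed
  moreover have "\<epsilon> \<le> \<bar>m 2 3 i j - conjugate F p\<bar>" if "i < j" "j < N" for i j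
  proof -
    have "(z (4 * i + 2), z (4 * j + 3)) \<in> S'"
    proof -
      have "(4 * i + 2) mod 4 = 2" "(4 * j + 3) mod 4 = 3" by presburger+
      then have "crossR S S' (4 * i + 2) (4 * j + 3) = S'" unfolding crossR_def by (simp only: if_True if_False simp_thms) simp
      then show ?thesis using rel[OF inJ[of i 2] inJ[of j 3]] that by simp
    qed
    from S'(5)[OF this] show ?thesis by (simp add: m_def \<epsilon>_def)
  qed
  ultimately show False using core[of m] by blast
qed

section \<open>Step graphons: (ii) and (iii) each imply (iv), and (iv) implies (iii)\<close>

lemma graphonD:
  assumes "graphon W" "x \<in> {0..1}" "y \<in> {0..1}"
  shows "W x y \<in> {0..1}" and "W x y = W y x"
  using assms unfolding graphon_def by blast+

definition step_graphon :: "real \<Rightarrow> real \<Rightarrow> real \<Rightarrow> real \<Rightarrow> real \<Rightarrow> real" where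
  "step_graphon u v s x y =
     (if x < 1/2 \<and> y < 1/2 then u else if \<not> x < 1/2 \<and> \<not> y < 1/2 then v else s)"

lemma graphon_step_graphon:
  assumes "u \<in> {0..1}" "v \<in> {0..1}" "s \<in> {0..1}"
  shows "graphon (step_graphon u v s)"
proof -
  have "(\<lambda>(x, y). step_graphon u v s x y) \<in> borel_measurable (borel \<Otimes>\<^sub>M borel)"
    unfolding step_graphon_def by measurable
  then have "(\<lambda>(x, y). step_graphon u v s x y) \<in> borel_measurable lborel"
    by (simp only: borel_prod measurable_lborel1 measurable_lborel2)
  then have "(\<lambda>(x, y). step_graphon u v s x y) \<in> borel_measurable lebesgue"
    by (rule measurable_completion)
  then have "(\<lambda>(x, y). step_graphon u v s x y) \<in> borel_measurable (lebesgue_on ({0..1} \<times> {0..1}))"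
    by (rule measurable_restrict_space1)
  moreover have "step_graphon u v s x y \<in> {0..1} \<and> step_graphon u v s x y = step_graphon u v s y x" for x y
    using assms by (auto simp: step_graphon_def)
  ultimately show ?thesis unfolding graphon_def by blast
qed

text \<open>The equations of (iv) cover the sizes 1..k-1 of \<open>A\<close>, and the assumptions on
  \<open>u\<close> and \<open>v\<close> cover the sizes 0 and k. So every distribution of the
  vertices over the two types gives the same value.\<close>

lemma sym_pat_two_type_eq_beta:
  assumes F: "simple_graph F"
    and uv: "beta F u = beta F p" "beta F v = beta F p"
    and Q: "\<And>j. j \<in> {1..num_verts F - 1} \<Longrightarrow> Q F j u v s = real (num_verts F choose j) * beta F p"
    and A: "A \<subseteq> verts F"
  shows "sym_pat F (two_type A u v s) = beta F p"
proof -
  have "card A \<le> num_verts F"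
    using F A unfolding simple_graph_def num_verts_def by (intro card_mono) auto
  then consider "card A = 0" | "card A = num_verts F" | "card A \<in> {1..num_verts F - 1}" by fastforce
  then have "Q F (card A) u v s = real (num_verts F choose card A) * beta F p"
    by cases (simp_all only: Q_trivial[OF F] uv Q binomial_n_0 binomial_n_n of_nat_1 mult_1)
  moreover have "num_verts F choose card A \<noteq> 0" using \<open>card A \<le> num_verts F\<close> by simp
  ultimately show ?thesis using sym_pat_two_type[OF F A, of u v s] by simp
qed

text \<open>The points below 1/2 play the role of \<open>A\<close>. The identity holds at every
  point and not just almost everywhere, so one graphon tests both (ii) and (iii).\<close>

lemma Psi_sym_step_graphon:
  assumes F: "simple_graph F"
    and uv: "beta F u = beta F p" "beta F v = beta F p"
    and Q: "\<And>j. j \<in> {1..num_verts F - 1} \<Longrightarrow> Q F j u v s = real (num_verts F choose j) * beta F p"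
  shows "Psi_sym F (step_graphon u v s) x = beta F p"
proof -
  have fin: "finite (verts F)" using F by (simp add: simple_graph_def)
  have "Psi_sym F (step_graphon u v s) x = sym_pat F (two_type {i \<in> verts F. x i < 1/2} u v s)"
    unfolding Psi_sym_eq_sym_pat[OF fin]
    by (intro sym_pat_cong) (simp add: step_graphon_def two_type_def)
  also have "\<dots> = beta F p" using assms by (intro sym_pat_two_type_eq_beta) auto
  finally show ?thesis .
qed

text \<open>A box of positive area meets every set of full measure; this reads off the three values
  of a step graphon.\<close>

lemma AE_unit_square_box:
  fixes a b c d :: real
  assumes ae: "AE (x, y) in lebesgue_on ({0..1} \<times> {0..1}). P x y"
    and box: "0 \<le> a" "a < b" "b \<le> 1" "0 \<le> c" "c < d" "d \<le> 1"
  shows "\<exists>x\<in>{a<..<b}. \<exists>y\<in>{c<..<d}. P x y"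
proof (rule ccontr)
  let ?U = "{0..1::real} \<times> {0..1::real}"
  assume neg: "\<not> ?thesis"
  have U: "?U \<in> sets lebesgue" by (simp add: borel_closed closed_Times sets_completionI_sets)
  have "AE z in lebesgue_on ?U. case z of (x, y) \<Rightarrow> P x y" using ae by simp
  then have ae': "AE z in lebesgue. z \<in> ?U \<longrightarrow> (case z of (x, y) \<Rightarrow> P x y)"
    using U by (subst (asm) AE_restrict_space_iff) auto
  then have "AE z in lebesgue. z \<notin> {a<..<b} \<times> {c<..<d}"
  proof (rule eventually_mono)
    fix z :: "real \<times> real" assume "z \<in> ?U \<longrightarrow> (case z of (x, y) \<Rightarrow> P x y)"
    then show "z \<notin> {a<..<b} \<times> {c<..<d}" using neg box by (cases z) auto
  qed
  moreover have meas: "{a<..<b} \<times> {c<..<d} \<in> sets lborel" by (simp add: borel_open open_Times)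
  ultimately have "{a<..<b} \<times> {c<..<d} \<in> null_sets lebesgue"
    by (simp add: AE_iff_null_sets sets_completionI_sets)
  then have "emeasure lborel ({a<..<b} \<times> {c<..<d}) = 0" using meas by auto
  moreover have "emeasure lborel ({a<..<b} \<times> {c<..<d}) = emeasure lborel {a<..<b} * emeasure lborel {c<..<d}"
    by (subst lborel_prod[symmetric], rule lborel.emeasure_pair_measure_Times) auto
  ultimately show False using box by simp
qed

lemma step_graphon_ae_const:
  assumes "AE (x, y) in lebesgue_on ({0..1} \<times> {0..1}). step_graphon u v s x y = q"
  shows "u = q" and "v = q" and "s = q"
  using AE_unit_square_box[OF assms, of 0 "1/2" 0 "1/2"] AE_unit_square_box[OF assms, of "1/2" 1 "1/2" 1]
    AE_unit_square_box[OF assms, of 0 "1/2" "1/2" 1]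
  by (auto simp: step_graphon_def)

lemma step_graphon_const:
  assumes "\<forall>x\<in>{0..1}. \<forall>y\<in>{0..1}. step_graphon u v s x y = q"
  shows "u = q" and "v = q" and "s = q"
  using assms[rule_format, of 0 0] assms[rule_format, of 1 1] assms[rule_format, of 0 1]
  by (auto simp: step_graphon_def)

text \<open>The half common to the implications from (ii) and from (iii): either condition supplies
  \<open>const\<close>.\<close>

lemma graphon_const_imp_rigid:
  assumes F: "simple_graph F" and k: "num_verts F > 1" and p: "0 < p" "p < 1"
    and const: "\<And>u v s. graphon (step_graphon u v s) \<Longrightarrow> (\<And>x. Psi_sym F (step_graphon u v s) x = beta F p) \<Longrightarrow> u = v \<and> v = s"
  shows "rigid F p"
  unfolding rigid_def
proof (intro ballI impI)
  fix u v s
  assume uv: "u \<in> {p, conjugate F p}" "v \<in> {p, conjugate F p}" and s: "s \<in> {0..1}"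
    and Q: "\<forall>j\<in>{1..num_verts F - 1}. Q F j u v s = real (num_verts F choose j) * beta F p"
  have "u \<in> {0..1}" "v \<in> {0..1}" "beta F u = beta F p" "beta F v = beta F p"
    using uv p beta_conjugate(1,2)[OF F k p] by auto
  then show "u = v \<and> v = s"
    using s Q by (intro const graphon_step_graphon Psi_sym_step_graphon F) auto
qed

text \<open>Here the diagonal is available: repeating x for j vertices and y for the others gives
  exactly the equations of (iv) for the triple \<open>W x x\<close>, \<open>W y y\<close>,
  \<open>W x y\<close>. Neither Ramsey's theorem nor a limit enters.\<close>

lemma rigid_imp_graphon_const:
  assumes F: "simple_graph F" and V: "verts F = {1..k}" and k: "k > 1" and p: "0 < p" "p < 1"
    and rigid: "rigid F p" and W: "graphon W" and Psi: "\<forall>x \<in> {1..k} \<rightarrow> {0..1}. Psi_sym F W x = beta F p"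
  shows "(\<forall>x\<in>{0..1}. \<forall>y\<in>{0..1}. W x y = p) \<or> (\<forall>x\<in>{0..1}. \<forall>y\<in>{0..1}. W x y = conjugate F p)"
proof -
  have fin: "finite (verts F)" and nv: "num_verts F = k" by (auto simp: V num_verts_def)
  have Qeq: "Q F j (W x x) (W y y) (W x y) = real (num_verts F choose j) * beta F p"
    if "x \<in> {0..1}" "y \<in> {0..1}" "j \<le> num_verts F" for x y j
  proof -
    have "sym_pat F (two_type {1..j} (W x x) (W y y) (W x y)) = Psi_sym F W (\<lambda>i. if i \<in> {1..j} then x else y)"
      unfolding Psi_sym_eq_sym_pat[OF fin]
      using graphonD(2)[OF W that(2,1)] by (intro sym_pat_cong) (auto simp: two_type_def)
    also have "\<dots> = beta F p" using Psi that by auto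
    finally show ?thesis
      using sym_pat_two_type[OF F, of "{1..j}" "W x x" "W y y" "W x y"] that V nv by simp
  qed
  have diag: "W x x \<in> {p, conjugate F p}" if x: "x \<in> {0..1}" for x
    using Qeq[OF x x order_refl] Q_trivial(1)[OF F, of "W x x"] graphonD(1)[OF W x x] nv k
    by (intro beta_conjugate(3)[OF F _ p]) auto
  have eq: "W x x = W y y \<and> W y y = W x y" if "x \<in> {0..1}" "y \<in> {0..1}" for x y
  proof -
    have "W x y \<in> {0..1}" by (rule graphonD(1)[OF W that])
    moreover have "Q F j (W x x) (W y y) (W x y) = real (num_verts F choose j) * beta F p"
      if "j \<in> {1..num_verts F - 1}" for j
      using that by (intro Qeq \<open>x \<in> {0..1}\<close> \<open>y \<in> {0..1}\<close>) auto
    ultimately show ?thesis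
      by (intro conjI rigidD[OF rigid diag[OF that(1)] diag[OF that(2)]])
  qed
  define q where "q = W 0 0"
  have "W x y = q" if "x \<in> {0..1}" "y \<in> {0..1}" for x y
  proof -
    have "W x y = W y y" using eq[OF that] by (elim conjE) (erule sym)
    also have "W y y = q" unfolding q_def by (rule conjunct1[OF eq[OF that(2)]]) simp
    finally show ?thesis .
  qed
  moreover have "q \<in> {p, conjugate F p}" unfolding q_def by (rule diag) simp
  ultimately show ?thesis by blast
qed

section \<open>The counting lemma\<close>

text \<open>A linear function of weights in [0, 1] is maximized by weights 0 and 1, namely 1 where
  the coefficient is positive.\<close>

lemma ex_subset_sum_ge:
  fixes h r :: "'a \<Rightarrow> real"
  assumes "finite A" and h: "\<And>x. x \<in> A \<Longrightarrow> h x \<in> {0..1}"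
  shows "\<exists>X\<subseteq>A. (\<Sum>x\<in>A. h x * r x) \<le> (\<Sum>x\<in>X. r x)"
proof (intro exI conjI)
  show "{x \<in> A. 0 < r x} \<subseteq> A" by auto
  have "h x * r x \<le> (if 0 < r x then r x else 0)" if "x \<in> A" for x
  proof (cases "0 < r x")
    case True
    then show ?thesis using h[OF that] mult_right_mono[of "h x" 1 "r x"] by simp
  next
    case False
    then show ?thesis using h[OF that] mult_nonneg_nonpos[of "h x" "r x"] by simp
  qed
  then have "(\<Sum>x\<in>A. h x * r x) \<le> (\<Sum>x\<in>A. if 0 < r x then r x else 0)" by (intro sum_mono)
  also have "\<dots> = (\<Sum>x\<in>{x \<in> A. 0 < r x}. r x)" by (simp only: sum.inter_filter[OF assms(1)])
  finally show "(\<Sum>x\<in>A. h x * r x) \<le> (\<Sum>x\<in>{x \<in> A. 0 < r x}. r x)" .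
qed

text \<open>The weights are rounded to sets one variable at a time, the expression being linear in
  each. So bounds on rectangles control all products of weight functions.\<close>

lemma bilinear_le_cut:
  fixes D :: "'a \<Rightarrow> 'b \<Rightarrow> real"
  assumes "finite A" "finite B"
    and h1: "\<And>x. x \<in> A \<Longrightarrow> h1 x \<in> {0..1}" and h2: "\<And>y. y \<in> B \<Longrightarrow> h2 y \<in> {0..1}"
    and cut: "\<And>X Y. X \<subseteq> A \<Longrightarrow> Y \<subseteq> B \<Longrightarrow> (\<Sum>x\<in>X. \<Sum>y\<in>Y. D x y) \<le> c"
  shows "(\<Sum>x\<in>A. \<Sum>y\<in>B. h1 x * h2 y * D x y) \<le> c"
proof -
  from ex_subset_sum_ge[where h = h1 and r = "\<lambda>x. \<Sum>y\<in>B. h2 y * D x y", OF assms(1) h1]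
  obtain X where X: "X \<subseteq> A" "(\<Sum>x\<in>A. h1 x * (\<Sum>y\<in>B. h2 y * D x y)) \<le> (\<Sum>x\<in>X. \<Sum>y\<in>B. h2 y * D x y)"
    by blast
  from ex_subset_sum_ge[where h = h2 and r = "\<lambda>y. \<Sum>x\<in>X. D x y", OF assms(2) h2]
  obtain Y where Y: "Y \<subseteq> B" "(\<Sum>y\<in>B. h2 y * (\<Sum>x\<in>X. D x y)) \<le> (\<Sum>y\<in>Y. \<Sum>x\<in>X. D x y)"
    by blast
  have "(\<Sum>x\<in>A. \<Sum>y\<in>B. h1 x * h2 y * D x y) = (\<Sum>x\<in>A. h1 x * (\<Sum>y\<in>B. h2 y * D x y))"
    by (simp add: sum_distrib_left mult.assoc)
  also note X(2)
  also have "(\<Sum>x\<in>X. \<Sum>y\<in>B. h2 y * D x y) = (\<Sum>y\<in>B. h2 y * (\<Sum>x\<in>X. D x y))"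
    by (subst sum.swap) (simp add: sum_distrib_left)
  also note Y(2)
  also have "(\<Sum>y\<in>Y. \<Sum>x\<in>X. D x y) = (\<Sum>x\<in>X. \<Sum>y\<in>Y. D x y)" by (rule sum.swap)
  also have "\<dots> \<le> c" by (rule cut[OF X(1) Y(1)])
  finally show ?thesis .
qed

lemma abs_bilinear_le_cut:
  fixes D :: "'a \<Rightarrow> 'b \<Rightarrow> real"
  assumes "finite A" "finite B"
    and h1: "\<And>x. x \<in> A \<Longrightarrow> h1 x \<in> {0..1}" and h2: "\<And>y. y \<in> B \<Longrightarrow> h2 y \<in> {0..1}"
    and cut: "\<And>X Y. X \<subseteq> A \<Longrightarrow> Y \<subseteq> B \<Longrightarrow> \<bar>\<Sum>x\<in>X. \<Sum>y\<in>Y. D x y\<bar> \<le> c"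
  shows "\<bar>\<Sum>x\<in>A. \<Sum>y\<in>B. h1 x * h2 y * D x y\<bar> \<le> c"
proof -
  have 1: "(\<Sum>x\<in>X. \<Sum>y\<in>Y. D x y) \<le> c" and 2: "(\<Sum>x\<in>X. \<Sum>y\<in>Y. - D x y) \<le> c"
    if "X \<subseteq> A" "Y \<subseteq> B" for X Y
    using cut[OF that] by (simp_all only: sum_negf abs_le_iff)
  have "(\<Sum>x\<in>A. \<Sum>y\<in>B. h1 x * h2 y * D x y) \<le> c"
    by (rule bilinear_le_cut[where ?h1.0 = h1 and ?h2.0 = h2, OF assms(1,2) h1 h2 1])
  moreover have "(\<Sum>x\<in>A. \<Sum>y\<in>B. h1 x * h2 y * - D x y) \<le> c"
    by (rule bilinear_le_cut[where ?h1.0 = h1 and ?h2.0 = h2, OF assms(1,2) h1 h2 2])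
  ultimately show ?thesis by (simp only: mult_minus_right sum_negf abs_le_iff simp_thms)
qed

lemma sum_PiE_insert:
  assumes "i \<notin> S"
  shows "(\<Sum>x\<in>PiE (insert i S) A. f x) = (\<Sum>z\<in>PiE S A. \<Sum>a\<in>A i. f (z(i := a)))"
proof -
  have "(\<Sum>x\<in>PiE (insert i S) A. f x) = (\<Sum>(a, z)\<in>A i \<times> PiE S A. f (z(i := a)))"
    unfolding PiE_insert_eq sum.reindex[OF inj_combinator[OF assms]]
    by (simp only: o_def case_prod_unfold)
  also have "\<dots> = (\<Sum>a\<in>A i. \<Sum>z\<in>PiE S A. f (z(i := a)))" by (rule sum.cartesian_product[symmetric])
  also have "\<dots> = (\<Sum>z\<in>PiE S A. \<Sum>a\<in>A i. f (z(i := a)))" by (rule sum.swap)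
  finally show ?thesis .
qed

lemma card_PiE_le_prod:
  assumes "finite I" "\<And>i. i \<in> I \<Longrightarrow> real (card (A i)) \<le> c i"
  shows "real (card (PiE I A)) \<le> (\<Prod>i\<in>I. c i)"
proof -
  have "(\<Prod>i\<in>I. real (card (A i))) \<le> (\<Prod>i\<in>I. c i)" using assms(2) by (intro prod_mono) auto
  then show ?thesis by (simp only: card_PiE[OF assms(1)] of_nat_prod)
qed

text \<open>With all coordinates except \<open>i\<close> and \<open>j\<close> fixed, no remaining
  factor depends on both of them. The inner sum is therefore a rectangle sum of \<open>D\<close>
  with product weights, bounded by the cut assumption.\<close>

lemma count_single_edge:
  fixes g :: "nat \<times> nat \<Rightarrow> 'a \<Rightarrow> 'a \<Rightarrow> real"
  assumes I: "finite I" "(i, j) \<in> pairs I" and A: "\<And>l. l \<in> I \<Longrightarrow> finite (A l)"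
    and c: "\<And>l. l \<in> I \<Longrightarrow> real (card (A l)) \<le> c l" and \<delta>: "0 \<le> \<delta>"
    and g: "\<And>e x y. g e x y \<in> {0..1}"
    and cut: "\<And>X Y. X \<subseteq> A i \<Longrightarrow> Y \<subseteq> A j \<Longrightarrow> \<bar>\<Sum>x\<in>X. \<Sum>y\<in>Y. D x y\<bar> \<le> \<delta> * c i * c j"
  shows "\<bar>\<Sum>x\<in>PiE I A. D (x i) (x j) * (\<Prod>e\<in>pairs I - {(i, j)}. g e (x (fst e)) (x (snd e)))\<bar> \<le> \<delta> * (\<Prod>l\<in>I. c l)"
proof -
  have ij: "i \<in> I" "j \<in> I" "i < j" using I by (auto simp: pairs_def)
  define K where "K = I - {i, j}"
  have K: "finite K" "I = insert i (insert j K)" "i \<notin> insert j K" "j \<notin> K" using I ij by (auto simp: K_def)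
  define P where "P = pairs I - {(i, j)}"
  have finP: "finite P" using I by (simp add: P_def)
  let ?G = "\<lambda>x. \<Prod>e\<in>P. g e (x (fst e)) (x (snd e))"
  have *: "\<bar>\<Sum>b\<in>A j. \<Sum>a\<in>A i. D a b * ?G (z(j := b, i := a))\<bar> \<le> \<delta> * c i * c j" for z
  proof -
    \<comment> \<open>The factors that touch \<open>i\<close>. They do not touch \<open>j\<close>:
      the pair (i, j) has been removed, and (j, i) is not in \<open>pairs I\<close> because i <
      j.\<close>
    define P1 where "P1 = {e \<in> P. fst e = i \<or> snd e = i}"
    define h1 where "h1 a = (\<Prod>e\<in>P1. g e ((z(i := a)) (fst e)) ((z(i := a)) (snd e)))" for a
    define h2 where "h2 b = (\<Prod>e\<in>P - P1. g e ((z(j := b)) (fst e)) ((z(j := b)) (snd e)))" for b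
    have G: "?G (z(j := b, i := a)) = h1 a * h2 b" for a b
    proof -
      have "?G (z(j := b, i := a)) =
        (\<Prod>e\<in>P - P1. g e ((z(j := b, i := a)) (fst e)) ((z(j := b, i := a)) (snd e))) *
        (\<Prod>e\<in>P1. g e ((z(j := b, i := a)) (fst e)) ((z(j := b, i := a)) (snd e)))"
        using finP by (intro prod.subset_diff) (auto simp: P1_def)
      also have "(\<Prod>e\<in>P - P1. g e ((z(j := b, i := a)) (fst e)) ((z(j := b, i := a)) (snd e))) = h2 b"
        unfolding h2_def by (intro prod.cong) (auto simp: P1_def)
      also have "(\<Prod>e\<in>P1. g e ((z(j := b, i := a)) (fst e)) ((z(j := b, i := a)) (snd e))) = h1 a"
        unfolding h1_def
      proof (intro prod.cong refl)
        fix e assume "e \<in> P1"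
        then have "fst e \<noteq> j" "snd e \<noteq> j" using ij by (auto simp: P1_def P_def pairs_def)
        then show "g e ((z(j := b, i := a)) (fst e)) ((z(j := b, i := a)) (snd e)) =
          g e ((z(i := a)) (fst e)) ((z(i := a)) (snd e))" by simp
      qed
      finally show ?thesis by (simp only: mult.commute[of "h1 a"])
    qed
    have "h1 a \<in> {0..1}" "h2 b \<in> {0..1}" for a b
      using g unfolding h1_def h2_def by (auto intro!: prod_nonneg prod_le_1)
    then have "\<bar>\<Sum>a\<in>A i. \<Sum>b\<in>A j. h1 a * h2 b * D a b\<bar> \<le> \<delta> * c i * c j"
      using A ij cut by (intro abs_bilinear_le_cut) auto
    also have "(\<Sum>a\<in>A i. \<Sum>b\<in>A j. h1 a * h2 b * D a b) = (\<Sum>b\<in>A j. \<Sum>a\<in>A i. D a b * ?G (z(j := b, i := a)))"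
      unfolding G by (subst sum.swap) (simp add: mult_ac)
    finally show ?thesis .
  qed
  have eq: "(\<Sum>x\<in>PiE I A. D (x i) (x j) * ?G x) =
      (\<Sum>z\<in>PiE K A. \<Sum>b\<in>A j. \<Sum>a\<in>A i. D a b * ?G (z(j := b, i := a)))"
    unfolding K(2) sum_PiE_insert[OF K(3)] sum_PiE_insert[OF K(4)] using ij by simp
  have "\<bar>\<Sum>x\<in>PiE I A. D (x i) (x j) * ?G x\<bar> \<le> (\<Sum>z\<in>PiE K A. \<bar>\<Sum>b\<in>A j. \<Sum>a\<in>A i. D a b * ?G (z(j := b, i := a))\<bar>)"
    unfolding eq by (rule sum_abs)
  also have "\<dots> \<le> (\<Sum>z\<in>PiE K A. \<delta> * c i * c j)" by (intro sum_mono *)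
  also have "\<dots> = (\<delta> * c i * c j) * real (card (PiE K A))" by simp
  also have "\<dots> \<le> (\<delta> * c i * c j) * (\<Prod>l\<in>K. c l)"
  proof (intro mult_left_mono card_PiE_le_prod K)
    show "0 \<le> \<delta> * c i * c j" using \<delta> c[of i] c[of j] ij by (metis mult_nonneg_nonneg of_nat_0_le_iff order_trans)
  qed (use c K in auto)
  also have "\<dots> = \<delta> * (\<Prod>l\<in>I. c l)" using K by simp
  finally show ?thesis unfolding P_def .
qed

text \<open>Telescoping: the factors \<open>g e\<close> are exchanged for \<open>g' e\<close> one edge \<open>e \<in> S\<close> at a time.\<close>

lemma counting_lemma_aux:
  fixes g g' :: "nat \<times> nat \<Rightarrow> 'a \<Rightarrow> 'a \<Rightarrow> real"
  assumes I: "finite I" and A: "\<And>l. l \<in> I \<Longrightarrow> finite (A l)"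
    and c: "\<And>l. l \<in> I \<Longrightarrow> real (card (A l)) \<le> c l" and \<delta>: "0 \<le> \<delta>"
    and S: "finite S" "S \<subseteq> pairs I"
    and g: "\<And>e x y. g e x y \<in> {0..1}" and g': "\<And>e x y. g' e x y \<in> {0..1}"
    and eq: "\<And>e. e \<in> pairs I - S \<Longrightarrow> g e = g' e"
    and cut: "\<And>i j X Y. (i, j) \<in> S \<Longrightarrow> X \<subseteq> A i \<Longrightarrow> Y \<subseteq> A j \<Longrightarrow>
       \<bar>\<Sum>x\<in>X. \<Sum>y\<in>Y. g (i, j) x y - g' (i, j) x y\<bar> \<le> \<delta> * c i * c j"
  shows "\<bar>(\<Sum>x\<in>PiE I A. \<Prod>e\<in>pairs I. g e (x (fst e)) (x (snd e))) -
     (\<Sum>x\<in>PiE I A. \<Prod>e\<in>pairs I. g' e (x (fst e)) (x (snd e)))\<bar> \<le> real (card S) * \<delta> * (\<Prod>l\<in>I. c l)"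
  using S g eq cut
proof (induction S arbitrary: g rule: finite_induct)
  case empty
  then have "(\<Prod>e\<in>pairs I. g e (x (fst e)) (x (snd e))) = (\<Prod>e\<in>pairs I. g' e (x (fst e)) (x (snd e)))" for x
    by (intro prod.cong) auto
  then show ?case by simp
next
  case (insert e0 S)
  obtain i j where e0: "e0 = (i, j)" by (cases e0)
  define f where "f = g(e0 := g' e0)"
  let ?T = "\<lambda>g. \<Sum>x\<in>PiE I A. \<Prod>e\<in>pairs I. g e (x (fst e)) (x (snd e))"
  have e0I: "e0 \<in> pairs I" using insert by auto
  have "\<bar>?T f - ?T g'\<bar> \<le> real (card S) * \<delta> * (\<Prod>l\<in>I. c l)"
  proof (rule insert.IH)
    show "S \<subseteq> pairs I" using insert by auto
    show "f e x y \<in> {0..1}" for e x y using insert.prems(2) g' by (simp only: f_def fun_upd_apply) (cases "e = e0"; simp)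
    show "f e = g' e" if "e \<in> pairs I - S" for e using insert.prems(3) that by (auto simp: f_def)
    show "\<bar>\<Sum>x\<in>X. \<Sum>y\<in>Y. f (i, j) x y - g' (i, j) x y\<bar> \<le> \<delta> * c i * c j"
      if "(i, j) \<in> S" "X \<subseteq> A i" "Y \<subseteq> A j" for i j X Y
      using insert.prems(4)[of i j X Y] that insert.hyps(2) by (auto simp: f_def)
  qed
  moreover have "\<bar>?T g - ?T f\<bar> \<le> \<delta> * (\<Prod>l\<in>I. c l)"
  proof -
    have eq: "?T g - ?T f = (\<Sum>x\<in>PiE I A. (g (i, j) (x i) (x j) - g' (i, j) (x i) (x j)) *
        (\<Prod>e\<in>pairs I - {(i, j)}. g e (x (fst e)) (x (snd e))))"
      unfolding sum_subtractf[symmetric]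
    proof (intro sum.cong refl)
      fix x
      have "(\<Prod>e\<in>pairs I. g e (x (fst e)) (x (snd e))) =
          g (i, j) (x i) (x j) * (\<Prod>e\<in>pairs I - {(i, j)}. g e (x (fst e)) (x (snd e)))"
        using e0I I by (subst prod.remove[of _ "(i, j)"]) (auto simp: e0)
      moreover have "(\<Prod>e\<in>pairs I. f e (x (fst e)) (x (snd e))) =
          g' (i, j) (x i) (x j) * (\<Prod>e\<in>pairs I - {(i, j)}. f e (x (fst e)) (x (snd e)))"
        using e0I I by (subst prod.remove[of _ "(i, j)"]) (auto simp: e0 f_def)
      moreover have "(\<Prod>e\<in>pairs I - {(i, j)}. f e (x (fst e)) (x (snd e))) =
          (\<Prod>e\<in>pairs I - {(i, j)}. g e (x (fst e)) (x (snd e)))"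
        by (intro prod.cong) (auto simp: e0 f_def)
      ultimately show "(\<Prod>e\<in>pairs I. g e (x (fst e)) (x (snd e))) - (\<Prod>e\<in>pairs I. f e (x (fst e)) (x (snd e))) =
         (g (i, j) (x i) (x j) - g' (i, j) (x i) (x j)) * (\<Prod>e\<in>pairs I - {(i, j)}. g e (x (fst e)) (x (snd e)))"
        by (simp add: left_diff_distrib)
    qed
    show ?thesis unfolding eq
    proof (rule count_single_edge[where D = "\<lambda>x y. g (i, j) x y - g' (i, j) x y", OF I _ A c \<delta> insert.prems(2)])
      show "(i, j) \<in> pairs I" using e0I by (simp only: e0)
      show "\<bar>\<Sum>x\<in>X. \<Sum>y\<in>Y. g (i, j) x y - g' (i, j) x y\<bar> \<le> \<delta> * c i * c j"
        if "X \<subseteq> A i" "Y \<subseteq> A j" for X Y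
        by (rule insert.prems(4)[OF _ that]) (simp only: e0 insertI1)
    qed
  qed
  ultimately have "\<bar>?T g - ?T g'\<bar> \<le> real (card S) * \<delta> * (\<Prod>l\<in>I. c l) + \<delta> * (\<Prod>l\<in>I. c l)" by linarith
  also have "\<dots> = real (card (insert e0 S)) * \<delta> * (\<Prod>l\<in>I. c l)" 
    using insert.hyps by (simp add: algebra_simps)
  finally show ?case .
qed

lemma card_pairs_le: "finite I \<Longrightarrow> card (pairs I) \<le> (card I)\<^sup>2"
  using card_mono[of "I \<times> I" "pairs I"] by (auto simp: pairs_def card_cartesian_product power2_eq_square)

text \<open>The scale \<open>c\<close> is separate from the cardinalities of the sets: it is the
  order of the whole graph when closeness is measured by \<open>cut_close\<close>, and the size of
  the sets themselves for regular pairs.\<close>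

lemma counting_lemma:
  fixes g g' :: "nat \<times> nat \<Rightarrow> 'a \<Rightarrow> 'a \<Rightarrow> real"
  assumes I: "finite I" and A: "\<And>l. l \<in> I \<Longrightarrow> finite (A l)"
    and c: "\<And>l. l \<in> I \<Longrightarrow> real (card (A l)) \<le> c l" and \<delta>: "0 \<le> \<delta>"
    and g: "\<And>e x y. g e x y \<in> {0..1}" and g': "\<And>e x y. g' e x y \<in> {0..1}"
    and cut: "\<And>i j X Y. (i, j) \<in> pairs I \<Longrightarrow> X \<subseteq> A i \<Longrightarrow> Y \<subseteq> A j \<Longrightarrow>
       \<bar>\<Sum>x\<in>X. \<Sum>y\<in>Y. g (i, j) x y - g' (i, j) x y\<bar> \<le> \<delta> * c i * c j"
  shows "\<bar>(\<Sum>x\<in>PiE I A. \<Prod>e\<in>pairs I. g e (x (fst e)) (x (snd e))) -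
     (\<Sum>x\<in>PiE I A. \<Prod>e\<in>pairs I. g' e (x (fst e)) (x (snd e)))\<bar> \<le> (real (card I))\<^sup>2 * \<delta> * (\<Prod>l\<in>I. c l)"
proof -
  have "0 \<le> \<delta> * (\<Prod>l\<in>I. c l)"
    using \<delta> c by (intro mult_nonneg_nonneg prod_nonneg) (auto intro: order_trans[OF of_nat_0_le_iff])
  then have "real (card (pairs I)) * (\<delta> * (\<Prod>l\<in>I. c l)) \<le> (real (card I))\<^sup>2 * (\<delta> * (\<Prod>l\<in>I. c l))"
    using card_pairs_le[OF I] by (intro mult_right_mono) (simp_all flip: of_nat_power)
  moreover have "\<bar>(\<Sum>x\<in>PiE I A. \<Prod>e\<in>pairs I. g e (x (fst e)) (x (snd e))) -
     (\<Sum>x\<in>PiE I A. \<Prod>e\<in>pairs I. g' e (x (fst e)) (x (snd e)))\<bar> \<le> real (card (pairs I)) * \<delta> * (\<Prod>l\<in>I. c l)"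
  proof (rule counting_lemma_aux)
    show "g e = g' e" if "e \<in> pairs I - pairs I" for e using that by blast
  qed (use I A c \<delta> g g' cut in \<open>blast intro: finite_pairs\<close>)+
  ultimately show ?thesis by (simp only: mult.assoc)
qed

section \<open>Embedding counts as sums of products, and graphs close to a weight function\<close>

definition adj :: "ugraph \<Rightarrow> nat \<Rightarrow> nat \<Rightarrow> real" where
  "adj G x y = (if {x, y} \<in> edges G then 1 else 0)"

text \<open>The value 0 at x = y on non-edges of \<open>F\<close> encodes injectivity; on edges
  \<open>adj\<close> already vanishes there when \<open>G\<close> is simple. \<open>hom_fac\<close>
  uses the same device.\<close>

definition ind_fac :: "ugraph \<Rightarrow> ugraph \<Rightarrow> nat \<times> nat \<Rightarrow> nat \<Rightarrow> nat \<Rightarrow> real" where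
  "ind_fac F G e x y = (if {fst e, snd e} \<in> edges F then adj G x y else if x = y then 0 else 1 - adj G x y)"

definition hom_fac :: "ugraph \<Rightarrow> ugraph \<Rightarrow> nat \<times> nat \<Rightarrow> nat \<Rightarrow> nat \<Rightarrow> real" where
  "hom_fac H G e x y = (if {fst e, snd e} \<in> edges H then adj G x y else if x = y then 0 else 1)"

lemma fac_bounds: "adj G x y \<in> {0..1}" "ind_fac F G e x y \<in> {0..1}" "hom_fac F G e x y \<in> {0..1}"
  by (auto simp: adj_def ind_fac_def hom_fac_def)

lemma adj_sym: "adj G x y = adj G y x"
  by (simp add: adj_def insert_commute)

lemma card_filter_eq_sum:
  "finite S \<Longrightarrow> real (card {x \<in> S. P x}) = (\<Sum>x\<in>S. if P x then 1 else 0)"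
  by (simp add: sum.inter_filter[symmetric])

lemma prod_zero_one:
  "finite E \<Longrightarrow> (\<Prod>e\<in>E. if c e then 1 else 0 :: real) = (if \<forall>e\<in>E. c e then 1 else 0)"
  by (induction E rule: finite_induct) auto

lemma edge_imp_neq: "simple_graph G \<Longrightarrow> {x, y} \<in> edges G \<Longrightarrow> x \<noteq> y"
  by (auto simp: simple_graph_def nsets_def)

text \<open>All factors are 0 or 1, so each product indicates that the conditions hold on increasing
  pairs; the other pairs follow by symmetry.\<close>

lemma ind_embs_into_eq_sum:
  assumes G: "simple_graph G" and F: "finite (verts F)" and U: "finite U"
  shows "real (ind_embs_into F G U) =
    (\<Sum>x\<in>PiE (verts F) (\<lambda>_. U). \<Prod>e\<in>pairs (verts F). ind_fac F G e (x (fst e)) (x (snd e)))"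
proof -
  let ?V = "verts F"
  define c where "c x e \<longleftrightarrow> ({fst e, snd e} \<in> edges F \<longrightarrow> {x (fst e), x (snd e)} \<in> edges G) \<and>
     ({fst e, snd e} \<notin> edges F \<longrightarrow> x (fst e) \<noteq> x (snd e) \<and> {x (fst e), x (snd e)} \<notin> edges G)" for x e
  have fac: "ind_fac F G e (x (fst e)) (x (snd e)) = (if c x e then 1 else 0)" for x e
    by (auto simp: ind_fac_def adj_def c_def)
  have iff: "(inj_on x ?V \<and> (\<forall>i\<in>?V. \<forall>j\<in>?V. i \<noteq> j \<longrightarrow> ({i, j} \<in> edges F \<longleftrightarrow> {x i, x j} \<in> edges G))) \<longleftrightarrow>
      (\<forall>e\<in>pairs ?V. c x e)" (is "?L \<longleftrightarrow> ?R") for x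
  proof
    assume L: ?L
    show ?R
    proof
      fix e assume "e \<in> pairs ?V"
      then have "fst e \<in> ?V" "snd e \<in> ?V" "fst e \<noteq> snd e" by (auto simp: pairs_def)
      then show "c x e" using L unfolding c_def by (auto dest: inj_onD)
    qed
  next
    assume R: ?R
    have R': "x i \<noteq> x j \<and> ({i, j} \<in> edges F \<longleftrightarrow> {x i, x j} \<in> edges G)" if "i \<in> ?V" "j \<in> ?V" "i < j" for i j
    proof -
      have "c x (i, j)" using R that by (auto simp: pairs_def)
      then show ?thesis using edge_imp_neq[OF G, of "x i" "x j"] unfolding c_def by auto
    qed
    have "inj_on x ?V" using R' by (intro linorder_inj_onI) auto
    moreover have "{i, j} \<in> edges F \<longleftrightarrow> {x i, x j} \<in> edges G" if "i \<in> ?V" "j \<in> ?V" "i \<noteq> j" for i j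
    proof (cases "i < j")
      case True then show ?thesis using R' that by blast
    next
      case False
      then have "j < i" using that by simp
      then show ?thesis using R'[of j i] that by (simp add: insert_commute)
    qed
    ultimately show ?L by blast
  qed
  have fin: "finite (PiE ?V (\<lambda>_. U))" using F U by (intro finite_PiE) auto
  show ?thesis
    unfolding ind_embs_into_def iff card_filter_eq_sum[OF fin] fac prod_zero_one[OF finite_pairs[OF F]] ..
qed

lemma inj_homs_eq_sum:
  assumes G: "simple_graph G" and H: "simple_graph H"
  shows "real (inj_homs H G) =
    (\<Sum>x\<in>PiE (verts H) (\<lambda>_. verts G). \<Prod>e\<in>pairs (verts H). hom_fac H G e (x (fst e)) (x (snd e)))"
proof -
  let ?V = "verts H"
  have F: "finite ?V" "finite (verts G)" using G H by (auto simp: simple_graph_def)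
  define c where "c x e \<longleftrightarrow> ({fst e, snd e} \<in> edges H \<longrightarrow> {x (fst e), x (snd e)} \<in> edges G) \<and>
     ({fst e, snd e} \<notin> edges H \<longrightarrow> x (fst e) \<noteq> x (snd e))" for x e
  have fac: "hom_fac H G e (x (fst e)) (x (snd e)) = (if c x e then 1 else 0)" for x e
    by (auto simp: hom_fac_def adj_def c_def)
  have iff: "(inj_on x ?V \<and> (\<forall>i\<in>?V. \<forall>j\<in>?V. {i, j} \<in> edges H \<longrightarrow> {x i, x j} \<in> edges G)) \<longleftrightarrow>
      (\<forall>e\<in>pairs ?V. c x e)" (is "?L \<longleftrightarrow> ?R") for x
  proof
    assume L: ?L
    show ?R
    proof
      fix e assume "e \<in> pairs ?V"
      then have "fst e \<in> ?V" "snd e \<in> ?V" "fst e \<noteq> snd e" by (auto simp: pairs_def)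
      then show "c x e" using L unfolding c_def by (auto dest: inj_onD)
    qed
  next
    assume R: ?R
    have R': "x i \<noteq> x j \<and> ({i, j} \<in> edges H \<longrightarrow> {x i, x j} \<in> edges G)" if "i \<in> ?V" "j \<in> ?V" "i < j" for i j
    proof -
      have "c x (i, j)" using R that by (auto simp: pairs_def)
      then show ?thesis using edge_imp_neq[OF G, of "x i" "x j"] unfolding c_def by auto
    qed
    have "inj_on x ?V" using R' by (intro linorder_inj_onI) auto
    moreover have "{x i, x j} \<in> edges G" if "i \<in> ?V" "j \<in> ?V" "{i, j} \<in> edges H" for i j
    proof (cases i j rule: linorder_cases)
      case less then show ?thesis using R' that by blast
    next
      case equal then show ?thesis using edge_imp_neq[OF H that(3)] by simp
    next
      case greater
      then show ?thesis using R'[of j i] that by (simp add: insert_commute)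
    qed
    ultimately show ?L by blast
  qed
  have fin: "finite (PiE ?V (\<lambda>_. verts G))" using F by (intro finite_PiE) auto
  show ?thesis
    unfolding inj_homs_def iff card_filter_eq_sum[OF fin] fac prod_zero_one[OF finite_pairs[OF F(1)]] ..
qed

text \<open>Distance in cut norm between \<open>G\<close> and the weighted graph \<open>W\<close>,
  relative to the square of the order.\<close>

definition cut_close :: "ugraph \<Rightarrow> (nat \<Rightarrow> nat \<Rightarrow> real) \<Rightarrow> real \<Rightarrow> bool" where
  "cut_close G W \<delta> \<longleftrightarrow> (\<forall>X Y. X \<subseteq> verts G \<longrightarrow> Y \<subseteq> verts G \<longrightarrow>
     \<bar>\<Sum>x\<in>X. \<Sum>y\<in>Y. adj G x y - W x y\<bar> \<le> \<delta> * (real (num_verts G))\<^sup>2)"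

lemma cut_closeD:
  assumes "cut_close G W \<delta>" "X \<subseteq> verts G" "Y \<subseteq> verts G"
  shows "\<bar>\<Sum>x\<in>X. \<Sum>y\<in>Y. adj G x y - W x y\<bar> \<le> \<delta> * (real (num_verts G))\<^sup>2"
  using assms unfolding cut_close_def by blast

lemma sum_diag_le:
  fixes b :: "nat \<Rightarrow> nat \<Rightarrow> real"
  assumes "finite X" "finite Y" "\<And>x y. \<bar>b x y\<bar> \<le> 1"
  shows "\<bar>\<Sum>x\<in>X. \<Sum>y\<in>Y. if x = y then b x y else 0\<bar> \<le> card X"
proof -
  have "\<bar>\<Sum>x\<in>X. \<Sum>y\<in>Y. if x = y then b x y else 0\<bar> \<le> (\<Sum>x\<in>X. \<bar>\<Sum>y\<in>Y. if x = y then b x y else 0\<bar>)"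
    by (rule sum_abs)
  also have "\<dots> \<le> (\<Sum>x\<in>X. 1)"
  proof (intro sum_mono)
    fix x
    have "(\<Sum>y\<in>Y. if x = y then b x y else 0) = (if x \<in> Y then b x x else 0)"
      using assms(2) by (rule sum.delta')
    then show "\<bar>\<Sum>y\<in>Y. if x = y then b x y else 0\<bar> \<le> 1" using assms(3)[of x x] by simp
  qed
  finally show ?thesis by simp
qed

text \<open>Apart from the diagonal the deviation is, up to sign, that of \<open>adj\<close> from
  \<open>W\<close>, or 0. The diagonal contributes at most the order n of the graph; the assumption
  1 \<le> \<delta> * n absorbs this into a second \<delta> * n^2.\<close>

lemma cut_fac:
  assumes G: "simple_graph G" and cc: "cut_close G W \<delta>" and \<delta>: "1 \<le> \<delta> * num_verts G"
    and X: "X \<subseteq> verts G" and Y: "Y \<subseteq> verts G"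
  defines "N \<equiv> real (num_verts G)"
  shows "\<bar>\<Sum>x\<in>X. \<Sum>y\<in>Y. ind_fac F G e x y - (if {fst e, snd e} \<in> edges F then W x y else 1 - W x y)\<bar> \<le> 2 * \<delta> * N * N"
    and "\<bar>\<Sum>x\<in>X. \<Sum>y\<in>Y. hom_fac F G e x y - (if {fst e, snd e} \<in> edges F then W x y else 1)\<bar> \<le> 2 * \<delta> * N * N"
proof -
  have fin: "finite X" "finite Y" "finite (verts G)" using G X Y finite_subset unfolding simple_graph_def by blast+
  have "real (card X) \<le> N" unfolding N_def num_verts_def using X fin by (simp add: card_mono)
  also have "\<dots> = 1 * N" by simp
  also have "\<dots> \<le> \<delta> * N * N" using \<delta> unfolding N_def by (intro mult_right_mono) auto
  finally have cX: "real (card X) \<le> \<delta> * N * N" .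
  have d: "\<bar>\<Sum>x\<in>X. \<Sum>y\<in>Y. if x = y then b x y else 0\<bar> \<le> \<delta> * N * N" if "\<And>x y. \<bar>b x y\<bar> \<le> (1::real)" for b
    using sum_diag_le[where b = b, OF fin(1,2) that] cX by linarith
  have D: "\<bar>\<Sum>x\<in>X. \<Sum>y\<in>Y. adj G x y - W x y\<bar> \<le> \<delta> * N * N"
    using cut_closeD[OF cc X Y] by (simp add: N_def power2_eq_square mult.assoc)
  then have nn: "0 \<le> \<delta> * N * N" by linarith
  show "\<bar>\<Sum>x\<in>X. \<Sum>y\<in>Y. ind_fac F G e x y - (if {fst e, snd e} \<in> edges F then W x y else 1 - W x y)\<bar> \<le> 2 * \<delta> * N * N"
  proof (cases "{fst e, snd e} \<in> edges F")
    case True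
    then show ?thesis using D nn by (simp add: ind_fac_def)
  next
    case False
    have "ind_fac F G e x y - (1 - W x y) = - (adj G x y - W x y) + (if x = y then adj G x y - 1 else 0)" for x y
      using False by (simp add: ind_fac_def)
    then have "(\<Sum>x\<in>X. \<Sum>y\<in>Y. ind_fac F G e x y - (1 - W x y)) =
       - (\<Sum>x\<in>X. \<Sum>y\<in>Y. adj G x y - W x y) + (\<Sum>x\<in>X. \<Sum>y\<in>Y. if x = y then adj G x y - 1 else 0)"
      by (simp only: sum.distrib sum_negf)
    moreover have "\<bar>\<Sum>x\<in>X. \<Sum>y\<in>Y. if x = y then adj G x y - 1 else 0\<bar> \<le> \<delta> * N * N"
      by (rule d) (simp add: adj_def)
    ultimately show ?thesis using D False by simp
  qed
  show "\<bar>\<Sum>x\<in>X. \<Sum>y\<in>Y. hom_fac F G e x y - (if {fst e, snd e} \<in> edges F then W x y else 1)\<bar> \<le> 2 * \<delta> * N * N"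
  proof (cases "{fst e, snd e} \<in> edges F")
    case True
    then show ?thesis using D nn by (simp add: hom_fac_def)
  next
    case False
    have "hom_fac F G e x y - 1 = (if x = y then - 1 else 0)" for x y
      using False by (simp add: hom_fac_def)
    then have "(\<Sum>x\<in>X. \<Sum>y\<in>Y. hom_fac F G e x y - 1) = (\<Sum>x\<in>X. \<Sum>y\<in>Y. if x = y then - 1 else 0)"
      by simp
    moreover have "\<bar>\<Sum>x\<in>X. \<Sum>y\<in>Y. if x = y then - 1 else (0::real)\<bar> \<le> \<delta> * N * N"
      by (rule d) simp
    ultimately show ?thesis using nn False by simp
  qed
qed

lemma ind_embs_into_approx:
  assumes G: "simple_graph G" and F: "finite (verts F)" and cc: "cut_close G W \<delta>" and \<delta>: "1 \<le> \<delta> * num_verts G" "0 \<le> \<delta>"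
    and W: "\<And>x y. W x y \<in> {0..1}" and U: "U \<subseteq> verts G"
  shows "\<bar>real (ind_embs_into F G U) - (\<Sum>x\<in>PiE (verts F) (\<lambda>_. U). pat F (\<lambda>i j. W (x i) (x j)))\<bar> \<le>
     (real (num_verts F))\<^sup>2 * (2 * \<delta>) * real (num_verts G) ^ num_verts F"
proof -
  have finU: "finite U" "finite (verts G)" using G U finite_subset unfolding simple_graph_def by blast+
  have "\<bar>(\<Sum>x\<in>PiE (verts F) (\<lambda>_. U). \<Prod>e\<in>pairs (verts F). ind_fac F G e (x (fst e)) (x (snd e))) -
     (\<Sum>x\<in>PiE (verts F) (\<lambda>_. U). \<Prod>e\<in>pairs (verts F).
       (\<lambda>e x y. if {fst e, snd e} \<in> edges F then W x y else 1 - W x y) e (x (fst e)) (x (snd e)))\<bar>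
     \<le> (real (card (verts F)))\<^sup>2 * (2 * \<delta>) * (\<Prod>l\<in>verts F. real (num_verts G))"
  proof (rule counting_lemma)
    show "real (card U) \<le> real (num_verts G)" for l :: nat
      unfolding num_verts_def using finU U by (simp add: card_mono)
    show "\<bar>\<Sum>x\<in>X. \<Sum>y\<in>Y. ind_fac F G (i, j) x y -
        (\<lambda>e x y. if {fst e, snd e} \<in> edges F then W x y else 1 - W x y) (i, j) x y\<bar>
       \<le> 2 * \<delta> * real (num_verts G) * real (num_verts G)" if "X \<subseteq> U" "Y \<subseteq> U" for X Y i j
      using cut_fac(1)[OF G cc \<delta>(1), of X Y F "(i, j)"] that U by blast
  qed (use F finU \<delta> W fac_bounds in auto)
  then show ?thesis
    by (simp add: ind_embs_into_eq_sum[OF G F finU(1)] pat_def case_prod_unfold num_verts_def)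
qed

lemma inj_homs_approx:
  assumes G: "simple_graph G" and H: "simple_graph H" and cc: "cut_close G W \<delta>" and \<delta>: "1 \<le> \<delta> * num_verts G" "0 \<le> \<delta>"
    and W: "\<And>x y. W x y \<in> {0..1}"
  shows "\<bar>real (inj_homs H G) - (\<Sum>x\<in>PiE (verts H) (\<lambda>_. verts G).
        \<Prod>e\<in>pairs (verts H). if {fst e, snd e} \<in> edges H then W (x (fst e)) (x (snd e)) else 1)\<bar> \<le>
     (real (num_verts H))\<^sup>2 * (2 * \<delta>) * real (num_verts G) ^ num_verts H"
proof -
  have fin: "finite (verts G)" "finite (verts H)" using G H unfolding simple_graph_def by blast+
  have "\<bar>(\<Sum>x\<in>PiE (verts H) (\<lambda>_. verts G). \<Prod>e\<in>pairs (verts H). hom_fac H G e (x (fst e)) (x (snd e))) -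
     (\<Sum>x\<in>PiE (verts H) (\<lambda>_. verts G). \<Prod>e\<in>pairs (verts H).
       (\<lambda>e x y. if {fst e, snd e} \<in> edges H then W x y else 1) e (x (fst e)) (x (snd e)))\<bar>
     \<le> (real (card (verts H)))\<^sup>2 * (2 * \<delta>) * (\<Prod>l\<in>verts H. real (num_verts G))"
  proof (rule counting_lemma)
    show "\<bar>\<Sum>x\<in>X. \<Sum>y\<in>Y. hom_fac H G (i, j) x y -
        (\<lambda>e x y. if {fst e, snd e} \<in> edges H then W x y else 1) (i, j) x y\<bar>
       \<le> 2 * \<delta> * real (num_verts G) * real (num_verts G)" if "X \<subseteq> verts G" "Y \<subseteq> verts G" for X Y i j
      using cut_fac(2)[OF G cc \<delta>(1), of X Y H "(i, j)"] that by blast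
  qed (use fin \<delta> W fac_bounds in \<open>auto simp: num_verts_def\<close>)
  then show ?thesis
    by (simp add: inj_homs_eq_sum[OF G H] num_verts_def)
qed

lemma prod_hom_const:
  assumes H: "simple_graph H"
  shows "(\<Prod>e\<in>pairs (verts H). if {fst e, snd e} \<in> edges H then q else 1) = (q :: real) ^ num_edges H"
proof -
  have fin: "finite (nsets (verts H) 2)" and sub: "edges H \<subseteq> nsets (verts H) 2"
    using H by (auto simp: simple_graph_def finite_imp_finite_nsets)
  have "(\<Prod>e\<in>pairs (verts H). if {fst e, snd e} \<in> edges H then q else 1) =
     (\<Prod>(i, j)\<in>pairs (verts H). (\<lambda>e. if e \<in> edges H then q else 1) {i, j})"
    by (simp add: case_prod_unfold)
  also have "\<dots> = (\<Prod>e\<in>nsets (verts H) 2. if e \<in> edges H then q else 1)" by (rule prod_pairs_eq_prod_nsets)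
  also have "\<dots> = (\<Prod>e\<in>edges H. q)"
    using prod.inter_restrict[OF fin, of "\<lambda>_. q" "edges H"] sub by (simp add: Int_absorb1)
  finally show ?thesis by (simp add: num_edges_def)
qed

lemma cut_close_const_inj_homs:
  assumes G: "simple_graph G" and H: "simple_graph H" and cc: "cut_close G (\<lambda>_ _. q) \<delta>"
    and \<delta>: "1 \<le> \<delta> * num_verts G" "0 \<le> \<delta>" and q: "q \<in> {0..1}"
  shows "\<bar>real (inj_homs H G) - q ^ num_edges H * real (num_verts G) ^ num_verts H\<bar> \<le>
     (real (num_verts H))\<^sup>2 * (2 * \<delta>) * real (num_verts G) ^ num_verts H"
proof -
  have "finite (verts H)" using H by (simp add: simple_graph_def)
  then show ?thesis
    using inj_homs_approx[OF G H cc \<delta> q]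
    by (simp add: prod_hom_const[OF H] card_funcsetE num_verts_def mult.commute)
qed

section \<open>Regular tuples of vertex sets\<close>

text \<open>The reference density \<open>d\<close> is a parameter, not necessarily the density of
  the pair, so one \<open>d\<close> can serve for all large subsets. \<open>reg_dens\<close> passes
  to the true density at the price of a factor 2.\<close>

definition reg :: "('a \<Rightarrow> 'a \<Rightarrow> real) \<Rightarrow> real \<Rightarrow> real \<Rightarrow> 'a set \<Rightarrow> 'a set \<Rightarrow> bool" where
  "reg a \<delta> d A B \<longleftrightarrow> (\<forall>X Y. X \<subseteq> A \<longrightarrow> Y \<subseteq> B \<longrightarrow>
     \<bar>\<Sum>x\<in>X. \<Sum>y\<in>Y. a x y - d\<bar> \<le> \<delta> * (real (card A) * real (card B)))"

definition dens :: "('a \<Rightarrow> 'a \<Rightarrow> real) \<Rightarrow> 'a set \<Rightarrow> 'a set \<Rightarrow> real" where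
  "dens a A B = (\<Sum>x\<in>A. \<Sum>y\<in>B. a x y) / (real (card A) * real (card B))"

lemma regD:
  assumes "reg a \<delta> d A B" "X \<subseteq> A" "Y \<subseteq> B"
  shows "\<bar>\<Sum>x\<in>X. \<Sum>y\<in>Y. a x y - d\<bar> \<le> \<delta> * (real (card A) * real (card B))"
  using assms unfolding reg_def by blast

lemma sum_dev: "(\<Sum>x\<in>X. \<Sum>y\<in>Y. a x y - d) = (\<Sum>x\<in>X. \<Sum>y\<in>Y. a x y) - d * (real (card X) * real (card Y))"
  by (simp add: sum_subtractf)

lemma sum_eq_dens:
  assumes "finite A" "finite B" "A \<noteq> {}" "B \<noteq> {}"
  shows "(\<Sum>x\<in>A. \<Sum>y\<in>B. a x y - d) = (dens a A B - d) * (real (card A) * real (card B))"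
  unfolding sum_dev dens_def using assms by (simp add: field_simps)

lemma dens_bounds:
  assumes a: "\<And>x y. a x y \<in> {0..1}" and "finite A" "finite B"
  shows "dens a A B \<in> {0..1}"
proof -
  have "(\<Sum>x\<in>A. \<Sum>y\<in>B. a x y) \<le> (\<Sum>x\<in>A. \<Sum>y\<in>B. 1)" using a by (intro sum_mono) auto
  then have "(\<Sum>x\<in>A. \<Sum>y\<in>B. a x y) \<le> real (card A) * real (card B)" by simp
  moreover have "0 \<le> (\<Sum>x\<in>A. \<Sum>y\<in>B. a x y)" using a by (intro sum_nonneg) auto
  ultimately show ?thesis
    unfolding dens_def by (cases "real (card A) * real (card B) = 0") (auto simp: divide_simps)
qed

text \<open>Restricting to an \<alpha> fraction on each side shrinks the normalization by at most
  \<alpha>^2 while the absolute bound stays.\<close>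

lemma reg_subset:
  fixes \<alpha> :: real
  assumes r: "reg a \<delta> d A B" and sub: "A' \<subseteq> A" "B' \<subseteq> B" and \<alpha>: "0 < \<alpha>" "0 \<le> \<delta>"
    and c: "\<alpha> * card A \<le> card A'" "\<alpha> * card B \<le> card B'"
  shows "reg a (\<delta> / \<alpha>\<^sup>2) d A' B'"
proof -
  have "(\<alpha> * card A) * (\<alpha> * card B) \<le> real (card A') * real (card B')"
    using c \<alpha> by (intro mult_mono) auto
  then have "\<delta> / \<alpha>\<^sup>2 * ((\<alpha> * card A) * (\<alpha> * card B)) \<le> \<delta> / \<alpha>\<^sup>2 * (real (card A') * real (card B'))"
    using \<alpha> by (intro mult_left_mono) auto
  moreover have "\<delta> / \<alpha>\<^sup>2 * ((\<alpha> * card A) * (\<alpha> * card B)) = \<delta> * (real (card A) * real (card B))"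
    using \<alpha> by (simp add: power2_eq_square)
  ultimately have le: "\<delta> * (real (card A) * real (card B)) \<le> \<delta> / \<alpha>\<^sup>2 * (real (card A') * real (card B'))" by simp
  show ?thesis unfolding reg_def
  proof (intro allI impI)
    fix X Y assume "X \<subseteq> A'" "Y \<subseteq> B'"
    then have "\<bar>\<Sum>x\<in>X. \<Sum>y\<in>Y. a x y - d\<bar> \<le> \<delta> * (real (card A) * real (card B))"
      using sub by (intro regD[OF r]) auto
    then show "\<bar>\<Sum>x\<in>X. \<Sum>y\<in>Y. a x y - d\<bar> \<le> \<delta> / \<alpha>\<^sup>2 * (real (card A') * real (card B'))" using le by (rule order_trans)
  qed
qed

lemma reg_dens_near:
  assumes r: "reg a \<delta> d A B" and fin: "finite A" "finite B" "A \<noteq> {}" "B \<noteq> {}"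
  shows "\<bar>dens a A B - d\<bar> \<le> \<delta>"
proof -
  have pos: "0 < real (card A) * real (card B)" using fin by (simp add: card_gt_0_iff)
  have "\<bar>(dens a A B - d) * (real (card A) * real (card B))\<bar> \<le> \<delta> * (real (card A) * real (card B))"
    using regD[OF r order_refl order_refl] unfolding sum_eq_dens[OF fin] .
  then have "\<bar>dens a A B - d\<bar> * (real (card A) * real (card B)) \<le> \<delta> * (real (card A) * real (card B))"
    using pos by (simp only: abs_mult abs_of_pos)
  then show ?thesis using pos by (simp only: mult_le_cancel_right_pos)
qed

lemma reg_dens:
  assumes r: "reg a \<delta> d A B" and fin: "finite A" "finite B" "A \<noteq> {}" "B \<noteq> {}"
  shows "reg a (2 * \<delta>) (dens a A B) A B"
  unfolding reg_def
proof (intro allI impI)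
  fix X Y assume XY: "X \<subseteq> A" "Y \<subseteq> B"
  let ?N = "real (card A) * real (card B)"
  have near: "\<bar>dens a A B - d\<bar> \<le> \<delta>" by (rule reg_dens_near[OF assms])
  have "real (card X) * real (card Y) \<le> ?N"
    using XY fin by (intro mult_mono) (auto intro: card_mono)
  then have "\<bar>dens a A B - d\<bar> * (real (card X) * real (card Y)) \<le> \<delta> * ?N"
    using near by (intro mult_mono[OF near]) auto
  moreover have "(\<Sum>x\<in>X. \<Sum>y\<in>Y. a x y - dens a A B) = (\<Sum>x\<in>X. \<Sum>y\<in>Y. a x y - d) - (dens a A B - d) * (real (card X) * real (card Y))"
    by (simp only: sum_dev left_diff_distrib)
  moreover have "\<bar>(dens a A B - d) * (real (card X) * real (card Y))\<bar> = \<bar>dens a A B - d\<bar> * (real (card X) * real (card Y))"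
    by (simp add: abs_mult)
  ultimately show "\<bar>\<Sum>x\<in>X. \<Sum>y\<in>Y. a x y - dens a A B\<bar> \<le> 2 * \<delta> * ?N"
    using regD[OF r XY] by linarith
qed

text \<open>The excess per pair is at most 1, so a total excess above \<eta> * |A| * |B| forces |X|
  * |Y| to be that large, hence each side to be an \<eta> fraction. Averaging over at most |A| * |B|
  pairs gives the gain in density.\<close>

lemma density_increment_aux:
  assumes a: "\<And>x y. a x y \<in> {0..1::real}" and fin: "finite A" "finite B"
    and sub: "X \<subseteq> A" "Y \<subseteq> B" and \<eta>: "0 < \<eta>" and d: "0 \<le> d"
    and big: "\<eta> * (real (card A) * real (card B)) < (\<Sum>x\<in>X. \<Sum>y\<in>Y. a x y - d)"
  shows "X \<noteq> {} \<and> Y \<noteq> {} \<and> \<eta> * card A \<le> card X \<and> \<eta> * card B \<le> card Y \<and> d + \<eta> \<le> dens a X Y"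
proof -
  have finXY: "finite X" "finite Y" using fin sub finite_subset by auto
  have cXY: "card X \<le> card A" "card Y \<le> card B" using fin sub by (auto intro: card_mono)
  have nn: "0 \<le> \<eta> * (real (card A) * real (card B))" using \<eta> by simp
  have ne: "X \<noteq> {}" "Y \<noteq> {}" using big nn by auto
  have eq: "(\<Sum>x\<in>X. \<Sum>y\<in>Y. a x y - d) = (dens a X Y - d) * (real (card X) * real (card Y))"
    using finXY ne by (intro sum_eq_dens)
  have "dens a X Y \<le> 1" using dens_bounds[OF a finXY] by simp
  then have "(dens a X Y - d) * (real (card X) * real (card Y)) \<le> 1 * (real (card X) * real (card Y))"
    using d by (intro mult_right_mono) auto
  then have 1: "\<eta> * (real (card A) * real (card B)) \<le> real (card X) * real (card Y)" using big eq by linarith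
  have pos: "0 < real (card X)" "0 < real (card Y)" using finXY ne by (auto simp: card_gt_0_iff)
  have posA: "0 < real (card A)" "0 < real (card B)" using pos cXY by linarith+
  have "\<eta> * (real (card A) * real (card B)) \<le> real (card X) * real (card B)"
    using 1 cXY by (meson mult_left_mono of_nat_0_le_iff of_nat_mono order_trans)
  then have 2: "\<eta> * card A \<le> card X" using posA by (simp flip: mult.assoc)
  have "\<eta> * (real (card A) * real (card B)) \<le> real (card A) * real (card Y)"
    using 1 cXY by (meson mult_right_mono of_nat_0_le_iff of_nat_mono order_trans)
  then have "(\<eta> * real (card B)) * real (card A) \<le> real (card Y) * real (card A)" by (simp only: mult_ac)
  then have 3: "\<eta> * card B \<le> card Y" using posA by simp
  have "\<eta> * (real (card X) * real (card Y)) \<le> \<eta> * (real (card A) * real (card B))"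
    using \<eta> cXY by (intro mult_left_mono mult_mono) auto
  then have "\<eta> * (real (card X) * real (card Y)) \<le> (dens a X Y - d) * (real (card X) * real (card Y))"
    using big eq by linarith
  then have "\<eta> \<le> dens a X Y - d" using pos by (simp only: mult_le_cancel_right_pos zero_less_mult_iff simp_thms)
  then show ?thesis using ne 2 3 by linarith
qed

text \<open>The deviations on the four rectangles cut out by \<open>X\<close> and \<open>Y\<close> sum to 0, so one of them is positive and
  at least a third of the deviation on \<open>X \<times> Y\<close>.\<close>

lemma density_increment:
  assumes a: "\<And>x y. a x y \<in> {0..1::real}" and fin: "finite A" "finite B" "A \<noteq> {}" "B \<noteq> {}"
    and \<delta>: "0 < \<delta>" and nreg: "\<not> reg a \<delta> (dens a A B) A B"
  shows "\<exists>X Y. X \<subseteq> A \<and> Y \<subseteq> B \<and> X \<noteq> {} \<and> Y \<noteq> {} \<and> \<delta>/3 * card A \<le> card X \<and> \<delta>/3 * card B \<le> card Y \<and>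
    dens a A B + \<delta>/3 \<le> dens a X Y"
proof -
  define d where "d = dens a A B"
  define N where "N = real (card A) * real (card B)"
  define D where "D X Y = (\<Sum>x\<in>X. \<Sum>y\<in>Y. a x y - d)" for X Y
  have d0: "0 \<le> d" using dens_bounds[OF a fin(1,2)] by (simp add: d_def)
  have N0: "0 \<le> \<delta>/3 * N" using \<delta> by (simp add: N_def)
  obtain X Y where XY: "X \<subseteq> A" "Y \<subseteq> B" "\<delta> * N < \<bar>D X Y\<bar>"
    using nreg unfolding reg_def d_def[symmetric] N_def[symmetric] D_def by (meson not_le)
  have split1: "D A' B' = D X B' + D (A' - X) B'" if "X \<subseteq> A'" "finite A'" for A' B' X
    unfolding D_def using that by (simp add: sum.subset_diff[of X A'] add.commute)
  have split2: "D A' B' = D A' Y + D A' (B' - Y)" if "Y \<subseteq> B'" "finite B'" for A' B' Y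
    unfolding D_def sum.distrib[symmetric] using that by (intro sum.cong refl) (simp add: sum.subset_diff[of Y B'] add.commute)
  have "D A B = 0" unfolding D_def sum_eq_dens[OF fin] by (simp add: d_def)
  then have "D X Y + D X (B - Y) + D (A - X) Y + D (A - X) (B - Y) = 0"
    using split1[OF XY(1) fin(1), of B] split2[OF XY(2) fin(2), of X] split2[OF XY(2) fin(2), of "A - X"] by linarith
  then have "\<delta>/3 * N < D X Y \<or> \<delta>/3 * N < D X (B - Y) \<or> \<delta>/3 * N < D (A - X) Y \<or> \<delta>/3 * N < D (A - X) (B - Y)"
    using XY(3) N0 by (auto simp: abs_if split: if_splits)
  then have "\<exists>X Y. X \<subseteq> A \<and> Y \<subseteq> B \<and> \<delta>/3 * N < D X Y" using XY by (meson Diff_subset)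
  then obtain X Y where XY: "X \<subseteq> A" "Y \<subseteq> B" "\<delta>/3 * N < D X Y" by blast
  have "X \<noteq> {} \<and> Y \<noteq> {} \<and> \<delta>/3 * card A \<le> card X \<and> \<delta>/3 * card B \<le> card Y \<and> d + \<delta>/3 \<le> dens a X Y"
    using XY(3) \<delta> unfolding N_def D_def by (intro density_increment_aux[OF a fin(1,2) XY(1,2) _ d0]) auto
  then show ?thesis using XY by (auto simp: d_def)
qed

text \<open>Every failure of regularity raises the density by \<delta>/3 on subsets that keep a
  \<delta>/3 fraction. Densities are at most 1, so the process stops after boundedly many rounds,
  without ever lowering the density.\<close>

lemma regular_pair_up:
  assumes \<delta>: "0 < \<delta>" "\<delta> \<le> 1"
  shows "\<exists>c::real. 0 < c \<and> c \<le> 1 \<and> (\<forall>(a :: 'a \<Rightarrow> 'a \<Rightarrow> real) A B. (\<forall>x y. a x y \<in> {0..1}) \<longrightarrow> finite A \<longrightarrow> finite B \<longrightarrow> A \<noteq> {} \<longrightarrow> B \<noteq> {} \<longrightarrow>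
    (\<exists>A' B'. A' \<subseteq> A \<and> B' \<subseteq> B \<and> A' \<noteq> {} \<and> B' \<noteq> {} \<and> c * card A \<le> card A' \<and> c * card B \<le> card B' \<and>
       dens a A B \<le> dens a A' B' \<and> reg a \<delta> (dens a A' B') A' B'))"
proof -
  have step: "\<exists>A' B'. A' \<subseteq> A \<and> B' \<subseteq> B \<and> A' \<noteq> {} \<and> B' \<noteq> {} \<and> (\<delta>/3)^m * card A \<le> card A' \<and> (\<delta>/3)^m * card B \<le> card B' \<and>
       dens a A B \<le> dens a A' B' \<and> reg a \<delta> (dens a A' B') A' B'"
    if "\<And>x y. a x y \<in> {0..1}" "finite A" "finite B" "A \<noteq> {}" "B \<noteq> {}" "1 - m * (\<delta>/3) \<le> dens a A B"
    for m and a :: "'a \<Rightarrow> 'a \<Rightarrow> real" and A B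
    using that(2-)
  proof (induction m arbitrary: A B)
    case 0
    have "reg a \<delta> (dens a A B) A B"
    proof (rule ccontr)
      assume "\<not> ?thesis"
      from density_increment[OF that(1) 0(1-4) \<delta>(1) this] obtain X Y where
        XY: "X \<subseteq> A" "Y \<subseteq> B" "dens a A B + \<delta>/3 \<le> dens a X Y" by blast
      have "finite X" "finite Y" using 0 XY finite_subset by auto
      then have "dens a X Y \<le> 1" using dens_bounds[OF that(1), of X Y] by simp
      then show False using 0 XY \<delta> by simp
    qed
    then show ?case using 0 by (intro exI[of _ A] exI[of _ B]) auto
  next
    case (Suc m)
    have le1: "(\<delta>/3) ^ Suc m \<le> 1" using \<delta> by (intro power_le_one) auto
    show ?case
    proof (cases "reg a \<delta> (dens a A B) A B")
      case True
      have "(\<delta>/3) ^ Suc m * card C \<le> card C" for C :: "'a set"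
        using le1 \<delta> by (intro mult_left_le_one_le) auto
      then show ?thesis using True Suc.prems by (intro exI[of _ A] exI[of _ B]) auto
    next
      case False
      from density_increment[OF that(1) Suc.prems(1-4) \<delta>(1) this] obtain X Y where
        XY: "X \<subseteq> A" "Y \<subseteq> B" "X \<noteq> {}" "Y \<noteq> {}" "\<delta>/3 * card A \<le> card X" "\<delta>/3 * card B \<le> card Y"
          "dens a A B + \<delta>/3 \<le> dens a X Y" by blast
      have fin: "finite X" "finite Y" using Suc.prems XY finite_subset by auto
      have "1 - m * (\<delta>/3) \<le> dens a X Y" using XY(7) Suc.prems(5) by (simp add: algebra_simps add_divide_distrib)
      from Suc.IH[OF fin XY(3,4) this] obtain A' B' where
        AB: "A' \<subseteq> X" "B' \<subseteq> Y" "A' \<noteq> {}" "B' \<noteq> {}" "(\<delta>/3)^m * card X \<le> card A'" "(\<delta>/3)^m * card Y \<le> card B'"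
          "dens a X Y \<le> dens a A' B'" "reg a \<delta> (dens a A' B') A' B'" by blast
      have "(\<delta>/3) ^ Suc m * card A \<le> card A'"
      proof -
        have "(\<delta>/3) ^ m * (\<delta>/3 * card A) \<le> (\<delta>/3) ^ m * card X" using XY(5) \<delta> by (intro mult_left_mono) auto
        then show ?thesis using AB(5) by (simp add: mult_ac)
      qed
      moreover have "(\<delta>/3) ^ Suc m * card B \<le> card B'"
      proof -
        have "(\<delta>/3) ^ m * (\<delta>/3 * card B) \<le> (\<delta>/3) ^ m * card Y" using XY(6) \<delta> by (intro mult_left_mono) auto
        then show ?thesis using AB(6) by (simp add: mult_ac)
      qed
      moreover have "dens a A B \<le> dens a A' B'" using XY(7) AB(7) \<delta> by linarith
      ultimately show ?thesis using AB XY(1,2) by (meson order_trans)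
    qed
  qed
  \<comment> \<open>With this many rounds \<open>1 - m * (\<delta>/3)\<close> is at most 0, so
    \<open>step\<close> applies to every initial density.\<close>
  define m where "m = nat \<lceil>3 / \<delta>\<rceil>"
  have "3 / \<delta> \<le> m" unfolding m_def by linarith
  then have m: "1 \<le> m * (\<delta>/3)" using \<delta> by (simp add: field_simps)
  show ?thesis
  proof (intro exI[of _ "(\<delta>/3)^m"] conjI allI impI)
    show "0 < (\<delta>/3)^m" "(\<delta>/3)^m \<le> 1" using \<delta> by (auto intro: power_le_one)
    fix a :: "'a \<Rightarrow> 'a \<Rightarrow> real" and A B :: "'a set"
    assume *: "\<forall>x y. a x y \<in> {0..1}" "finite A" "finite B" "A \<noteq> {}" "B \<noteq> {}"
    have "0 \<le> dens a A B" using dens_bounds[of a A B] * by simp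
    then show "\<exists>A' B'. A' \<subseteq> A \<and> B' \<subseteq> B \<and> A' \<noteq> {} \<and> B' \<noteq> {} \<and> (\<delta>/3)^m * card A \<le> card A' \<and> (\<delta>/3)^m * card B \<le> card B' \<and>
       dens a A B \<le> dens a A' B' \<and> reg a \<delta> (dens a A' B') A' B'"
      using m * by (intro step) auto
  qed
qed

lemma dens_complement:
  fixes a :: "'a \<Rightarrow> 'a \<Rightarrow> real"
  assumes "finite A" "finite B" "A \<noteq> {}" "B \<noteq> {}"
  shows "dens (\<lambda>x y. 1 - a x y) A B = 1 - dens a A B"
proof -
  have "real (card A) * real (card B) \<noteq> 0" using assms by simp
  then show ?thesis unfolding dens_def by (simp add: sum_subtractf diff_divide_distrib)
qed

lemma reg_complement:
  fixes a :: "'a \<Rightarrow> 'a \<Rightarrow> real"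
  shows "reg (\<lambda>x y. 1 - a x y) \<delta> (1 - d) A B \<longleftrightarrow> reg a \<delta> d A B"
proof -
  have "(\<Sum>x\<in>X. \<Sum>y\<in>Y. 1 - a x y - (1 - d)) = - (\<Sum>x\<in>X. \<Sum>y\<in>Y. a x y - d)" for X Y
    by (simp flip: sum_negf)
  then show ?thesis unfolding reg_def by (simp only: abs_minus_cancel)
qed

text \<open>A pair can be made regular without its density coming closer to \<open>t\<close>: from
  above, the density is increased; from below, the same is done to the complement. This preserves
  the evidence that a graph is far from constant density \<open>t\<close>.\<close>

lemma regular_pair:
  assumes \<delta>: "0 < \<delta>" "\<delta> \<le> 1"
  shows "\<exists>c::real. 0 < c \<and> c \<le> 1 \<and> (\<forall>(a :: 'a \<Rightarrow> 'a \<Rightarrow> real) A B t. (\<forall>x y. a x y \<in> {0..1}) \<longrightarrow> finite A \<longrightarrow> finite B \<longrightarrow> A \<noteq> {} \<longrightarrow> B \<noteq> {} \<longrightarrow>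
    (\<exists>A' B'. A' \<subseteq> A \<and> B' \<subseteq> B \<and> A' \<noteq> {} \<and> B' \<noteq> {} \<and> c * card A \<le> card A' \<and> c * card B \<le> card B' \<and>
       \<bar>dens a A B - t\<bar> \<le> \<bar>dens a A' B' - t\<bar> \<and> reg a \<delta> (dens a A' B') A' B'))"
proof -
  from regular_pair_up[OF \<delta>] obtain c :: real where c: "0 < c" "c \<le> 1" and
    up': "\<forall>(a :: 'a \<Rightarrow> 'a \<Rightarrow> real) A B. (\<forall>x y. a x y \<in> {0..1}) \<longrightarrow> finite A \<longrightarrow> finite B \<longrightarrow> A \<noteq> {} \<longrightarrow> B \<noteq> {} \<longrightarrow>
    (\<exists>A' B'. A' \<subseteq> A \<and> B' \<subseteq> B \<and> A' \<noteq> {} \<and> B' \<noteq> {} \<and> c * card A \<le> card A' \<and> c * card B \<le> card B' \<and>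
       dens a A B \<le> dens a A' B' \<and> reg a \<delta> (dens a A' B') A' B')" by (elim exE conjE) (rule that)
  have up: "\<exists>A' B'. A' \<subseteq> A \<and> B' \<subseteq> B \<and> A' \<noteq> {} \<and> B' \<noteq> {} \<and> c * card A \<le> card A' \<and> c * card B \<le> card B' \<and>
       dens a A B \<le> dens a A' B' \<and> reg a \<delta> (dens a A' B') A' B'"
    if "\<forall>x y. a x y \<in> {0..1}" "finite A" "finite B" "A \<noteq> {}" "B \<noteq> {}" for a :: "'a \<Rightarrow> 'a \<Rightarrow> real" and A B
    using up'[THEN spec, THEN spec, THEN spec, THEN mp, THEN mp, THEN mp, THEN mp, THEN mp, OF that] .
  show ?thesis
  proof (intro exI[of _ c] conjI allI impI c)
    fix a :: "'a \<Rightarrow> 'a \<Rightarrow> real" and A B :: "'a set" and t :: real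
    assume a: "\<forall>x y. a x y \<in> {0..1}" and fin: "finite A" "finite B" and ne: "A \<noteq> {}" "B \<noteq> {}"
    show "\<exists>A' B'. A' \<subseteq> A \<and> B' \<subseteq> B \<and> A' \<noteq> {} \<and> B' \<noteq> {} \<and> c * card A \<le> card A' \<and> c * card B \<le> card B' \<and>
       \<bar>dens a A B - t\<bar> \<le> \<bar>dens a A' B' - t\<bar> \<and> reg a \<delta> (dens a A' B') A' B'"
    proof (cases "t \<le> dens a A B")
      case True
      from up[OF a fin ne] obtain A' B' where "A' \<subseteq> A" "B' \<subseteq> B" "A' \<noteq> {}" "B' \<noteq> {}" "c * card A \<le> card A'" "c * card B \<le> card B'"
        "dens a A B \<le> dens a A' B'" "reg a \<delta> (dens a A' B') A' B'" by blast
      moreover have "\<bar>dens a A B - t\<bar> \<le> \<bar>dens a A' B' - t\<bar>" using True calculation(7) by simp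
      ultimately show ?thesis by blast
    next
      case False
      define b where "b x y = 1 - a x y" for x y
      have b: "\<forall>x y. b x y \<in> {0..1}" using a by (auto simp: b_def)
      from up[OF b fin ne] obtain A' B' where 1: "A' \<subseteq> A" "B' \<subseteq> B" "A' \<noteq> {}" "B' \<noteq> {}" "c * card A \<le> card A'" "c * card B \<le> card B'"
        "dens b A B \<le> dens b A' B'" "reg b \<delta> (dens b A' B') A' B'" by blast
      have fin': "finite A'" "finite B'" using 1 fin finite_subset by auto
      have d: "dens b A B = 1 - dens a A B" "dens b A' B' = 1 - dens a A' B'"
        unfolding b_def using fin fin' ne 1(3,4) by (auto intro: dens_complement)
      have "reg a \<delta> (dens a A' B') A' B'"
        using 1(8) unfolding d(2) b_def reg_complement .
      moreover have "\<bar>dens a A B - t\<bar> \<le> \<bar>dens a A' B' - t\<bar>" using False 1(7) d by simp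
      ultimately show ?thesis using 1 by blast
    qed
  qed
qed

text \<open>Pairs are treated one at a time. Shrinking two sets for a new pair weakens the
  regularity of the earlier pairs, so these are first arranged with a stricter parameter.\<close>

lemma regular_tuple:
  fixes I :: "'i set"
  assumes "finite Ps" "Ps \<subseteq> {(i, j). i \<in> I \<and> j \<in> I \<and> i \<noteq> j}" "0 < \<delta>" "\<delta> \<le> 1"
  shows "\<exists>c::real. 0 < c \<and> c \<le> 1 \<and> (\<forall>(a :: 'a \<Rightarrow> 'a \<Rightarrow> real) T. (\<forall>x y. a x y \<in> {0..1}) \<longrightarrow> (\<forall>i\<in>I. finite (T i) \<and> T i \<noteq> {}) \<longrightarrow>
    (\<exists>T'. (\<forall>i\<in>I. T' i \<subseteq> T i \<and> T' i \<noteq> {} \<and> c * card (T i) \<le> card (T' i)) \<and>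
       (\<forall>(i, j)\<in>Ps. \<exists>d. reg a \<delta> d (T' i) (T' j))))"
  using assms
proof (induction Ps arbitrary: \<delta> rule: finite_induct)
  case empty
  show ?case
  proof (intro exI[of _ 1] conjI allI impI)
    fix a :: "'a \<Rightarrow> 'a \<Rightarrow> real" and T :: "'i \<Rightarrow> 'a set"
    assume "\<forall>i\<in>I. finite (T i) \<and> T i \<noteq> {}"
    then show "\<exists>T'. (\<forall>i\<in>I. T' i \<subseteq> T i \<and> T' i \<noteq> {} \<and> 1 * real (card (T i)) \<le> card (T' i)) \<and>
       (\<forall>(i, j)\<in>{}. \<exists>d. reg a \<delta> d (T' i) (T' j))" by (intro exI[of _ T]) auto
  qed auto
next
  case (insert e Ps)
  obtain i j where e: "e = (i, j)" "i \<in> I" "j \<in> I" "i \<noteq> j" using insert.prems by (cases e) auto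
  from regular_pair[OF insert.prems(2,3)] obtain c1 :: real where c1: "0 < c1" "c1 \<le> 1" and
    pair': "\<forall>(a :: 'a \<Rightarrow> 'a \<Rightarrow> real) A B t. (\<forall>x y. a x y \<in> {0..1}) \<longrightarrow> finite A \<longrightarrow> finite B \<longrightarrow> A \<noteq> {} \<longrightarrow> B \<noteq> {} \<longrightarrow>
    (\<exists>A' B'. A' \<subseteq> A \<and> B' \<subseteq> B \<and> A' \<noteq> {} \<and> B' \<noteq> {} \<and> c1 * card A \<le> card A' \<and> c1 * card B \<le> card B' \<and>
       \<bar>dens a A B - t\<bar> \<le> \<bar>dens a A' B' - t\<bar> \<and> reg a \<delta> (dens a A' B') A' B')" by (elim exE conjE) (rule that)
  note pair = pair'[THEN spec, THEN spec, THEN spec, THEN spec[of _ 0], THEN mp, THEN mp, THEN mp, THEN mp, THEN mp]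
  \<comment> \<open>Chosen so that \<open>reg_subset\<close> with fraction \<open>c1\<close> turns
    \<open>\<delta>'\<close> back into \<open>\<delta>\<close>.\<close>
  define \<delta>' where "\<delta>' = \<delta> * c1\<^sup>2"
  have \<delta>': "0 < \<delta>'" "\<delta>' \<le> 1" using insert.prems c1 by (auto simp: \<delta>'_def intro!: mult_le_one power_le_one)
  have "Ps \<subseteq> {(i, j). i \<in> I \<and> j \<in> I \<and> i \<noteq> j}" using insert.prems by auto
  from insert.IH[OF this \<delta>'] obtain c2 :: real where c2: "0 < c2" "c2 \<le> 1" and
    IH': "\<forall>(a :: 'a \<Rightarrow> 'a \<Rightarrow> real) T. (\<forall>x y. a x y \<in> {0..1}) \<longrightarrow> (\<forall>i\<in>I. finite (T i) \<and> T i \<noteq> {}) \<longrightarrow>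
    (\<exists>T'. (\<forall>i\<in>I. T' i \<subseteq> T i \<and> T' i \<noteq> {} \<and> c2 * card (T i) \<le> card (T' i)) \<and>
       (\<forall>(i, j)\<in>Ps. \<exists>d. reg a \<delta>' d (T' i) (T' j)))" by (elim exE conjE) (rule that)
  note IH = IH'[THEN spec, THEN spec, THEN mp, THEN mp]
  show ?case
  proof (intro exI[of _ "c1 * c2"] conjI allI impI)
    show "0 < c1 * c2" "c1 * c2 \<le> 1" using c1 c2 by (auto intro: mult_le_one)
    fix a :: "'a \<Rightarrow> 'a \<Rightarrow> real" and T :: "'i \<Rightarrow> 'a set"
    assume a: "\<forall>x y. a x y \<in> {0..1}" and T: "\<forall>i\<in>I. finite (T i) \<and> T i \<noteq> {}"
    from IH[OF this] obtain T' where T': "\<forall>i\<in>I. T' i \<subseteq> T i \<and> T' i \<noteq> {} \<and> c2 * card (T i) \<le> card (T' i)"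
      and r: "\<forall>(i, j)\<in>Ps. \<exists>d. reg a \<delta>' d (T' i) (T' j)" by blast
    have finT': "finite (T' i)" if "i \<in> I" for i using T' T that finite_subset by blast
    have "T' i \<noteq> {}" "T' j \<noteq> {}" using T' e by auto
    from pair[OF a finT'[OF e(2)] finT'[OF e(3)] this] obtain A B where
      AB: "A \<subseteq> T' i" "B \<subseteq> T' j" "A \<noteq> {}" "B \<noteq> {}" "c1 * card (T' i) \<le> card A" "c1 * card (T' j) \<le> card B"
        "reg a \<delta> (dens a A B) A B" by blast
    define T2 where "T2 = T'(i := A, j := B)"
    have T2: "T2 l \<subseteq> T' l \<and> T2 l \<noteq> {} \<and> c1 * card (T' l) \<le> card (T2 l)" if "l \<in> I" for l
    proof -
      have "c1 * card (T' l) \<le> card (T' l)" using c1 by (intro mult_left_le_one_le) auto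
      then show ?thesis using AB T' that by (simp add: T2_def)
    qed
    show "\<exists>T'. (\<forall>i\<in>I. T' i \<subseteq> T i \<and> T' i \<noteq> {} \<and> c1 * c2 * card (T i) \<le> card (T' i)) \<and>
       (\<forall>(i, j)\<in>insert e Ps. \<exists>d. reg a \<delta> d (T' i) (T' j))"
    proof (intro exI[of _ T2] conjI ballI)
      fix l assume l: "l \<in> I"
      show "T2 l \<subseteq> T l" "T2 l \<noteq> {}" using T2[OF l] T' l by auto
      have "c1 * (c2 * card (T l)) \<le> c1 * card (T' l)" using T' l c1 by (intro mult_left_mono) auto
      then show "c1 * c2 * card (T l) \<le> card (T2 l)" using T2[OF l] by (simp add: mult.assoc)
    next
      fix q assume q: "q \<in> insert e Ps"
      show "case q of (i, j) \<Rightarrow> \<exists>d. reg a \<delta> d (T2 i) (T2 j)"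
      proof (cases "q = e")
        case True
        then show ?thesis using AB(7) e by (auto simp: T2_def)
      next
        case False
        then obtain k l where kl: "q = (k, l)" "(k, l) \<in> Ps" using q by (cases q) auto
        then have I: "k \<in> I" "l \<in> I" using insert.prems by auto
        from r kl obtain d where "reg a \<delta>' d (T' k) (T' l)" by blast
        then have "reg a (\<delta>' / c1\<^sup>2) d (T2 k) (T2 l)"
          using T2[OF I(1)] T2[OF I(2)] c1 \<delta>' by (intro reg_subset[of a \<delta>' d "T' k" "T' l"]) auto
        moreover have "\<delta>' / c1\<^sup>2 = \<delta>" using c1 by (simp add: \<delta>'_def)
        ultimately show ?thesis using kl by auto
      qed
    qed
  qed
qed

text \<open>The largest set chooses last: what the others took is at most a \<open>(card I - 1) / m\<close> fraction of it.\<close>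

lemma disjoint_subsets:
  fixes S :: "'i \<Rightarrow> 'a set"
  assumes "finite I" "\<And>i. i \<in> I \<Longrightarrow> finite (S i)" "card I \<le> m"
  shows "\<exists>T. (\<forall>i\<in>I. T i \<subseteq> S i \<and> card (T i) = card (S i) div m) \<and> disjoint_family_on T I"
  using assms
proof (induction I rule: finite_ranking_induct[where f = "\<lambda>i. card (S i)"])
  case empty
  show ?case by (auto simp: disjoint_family_on_def)
next
  case (insert x I)
  show ?case
  proof (cases "x \<in> I")
    case True
    then show ?thesis using insert by (simp add: insert_absorb)
  next
    case False
    then have c: "Suc (card I) \<le> m" using insert by simp
    obtain T where T: "\<And>i. i \<in> I \<Longrightarrow> T i \<subseteq> S i" "\<And>i. i \<in> I \<Longrightarrow> card (T i) = card (S i) div m" "disjoint_family_on T I"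
      using insert.IH insert.prems c by (meson Suc_leD insertI2)
    define U where "U = (\<Union>i\<in>I. T i)"
    have "card U \<le> (\<Sum>i\<in>I. card (T i))" unfolding U_def using insert.hyps by (intro card_UN_le)
    also have "\<dots> \<le> (\<Sum>i\<in>I. card (S x) div m)"
      using T(2) insert.hyps by (intro sum_mono) (auto intro: div_le_mono)
    also have "\<dots> = card I * (card (S x) div m)" by simp
    finally have "card U + card (S x) div m \<le> Suc (card I) * (card (S x) div m)" by simp
    also have "\<dots> \<le> m * (card (S x) div m)" using c by (rule mult_le_mono1)
    also have "\<dots> \<le> card (S x)" by simp
    finally have "card (S x) div m \<le> card (S x) - card U" by simp
    also have "\<dots> \<le> card (S x - U)"
    proof -
      have "finite (T i)" if "i \<in> I" for i
        using T(1)[OF that] insert.prems(1)[of i] that finite_subset by blast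
      then have "finite U" unfolding U_def using insert.hyps(1) by (intro finite_UN_I)
      then show ?thesis by (rule diff_card_le_card_Diff)
    qed
    finally obtain X where X: "X \<subseteq> S x - U" "card X = card (S x) div m"
      by (meson obtain_subset_with_card_n)
    have "disjoint_family_on (T(x := X)) (insert x I)"
      unfolding disjoint_family_on_def
    proof (intro ballI impI)
      fix i j assume ij: "i \<in> insert x I" "j \<in> insert x I" "i \<noteq> j"
      have *: "X \<inter> T l = {}" if "l \<in> I" for l using X that by (auto simp: U_def)
      show "(T(x := X)) i \<inter> (T(x := X)) j = {}"
        using ij * disjoint_family_onD[OF T(3), of i j] by (cases "i = x"; cases "j = x") auto
    qed
    moreover have "\<forall>i\<in>insert x I. (T(x := X)) i \<subseteq> S i \<and> card ((T(x := X)) i) = card (S i) div m"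
      using T(1,2) X False by auto
    ultimately show ?thesis by blast
  qed
qed

text \<open>Inclusion-exclusion over the set of indices that a tuple meets.\<close>

lemma polarization:
  fixes A :: "nat \<Rightarrow> 'a set" and h :: "(nat \<Rightarrow> 'a) \<Rightarrow> real"
  assumes V: "finite V" and A: "\<And>i. i \<in> V \<Longrightarrow> finite (A i)" and disj: "disjoint_family_on A V"
    and b: "\<And>T. T \<subseteq> V \<Longrightarrow> \<bar>\<Sum>x\<in>PiE V (\<lambda>_. \<Union>i\<in>T. A i). h x\<bar> \<le> b"
  shows "\<bar>\<Sum>\<sigma> | \<sigma> permutes V. \<Sum>x\<in>PiE V (\<lambda>i. A (\<sigma> i)). h x\<bar> \<le> 2 ^ card V * b"
proof -
  \<comment> \<open>\<open>c i\<close> names the block containing \<open>x i\<close>. By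
    disjointness of the blocks, \<open>g T\<close> is the full sum over the union of the blocks in
    \<open>T\<close>, and \<open>f T\<close> is the part that meets every one of them.\<close>
  define H where "H c = (\<Sum>x\<in>PiE V (\<lambda>i. A (c i)). h x)" for c
  define g where "g T = (\<Sum>c\<in>PiE V (\<lambda>_. T). H c)" for T
  define f where "f T = (\<Sum>c | c \<in> PiE V (\<lambda>_. T) \<and> c ` V = T. H c)" for T
  have gf: "g T = sum f (Pow T)" if "finite T" for T
  proof -
    have fin: "finite (PiE V (\<lambda>_. T))" using V that by (intro finite_PiE) auto
    have "g T = (\<Sum>S\<in>Pow T. \<Sum>c | c \<in> PiE V (\<lambda>_. T) \<and> c ` V = S. H c)"
      unfolding g_def using that by (intro sum.group[symmetric] fin) auto
    also have "\<dots> = sum f (Pow T)"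
      unfolding f_def by (intro sum.cong refl) (auto simp: PiE_def Pi_def)
    finally show ?thesis .
  qed
  have g_le: "\<bar>g T\<bar> \<le> b" if T: "T \<subseteq> V" for T
  proof -
    have finT: "finite T" using V T finite_subset by auto
    have "(\<Sum>x\<in>PiE V (\<lambda>_. \<Union>i\<in>T. A i). h x) = (\<Sum>x\<in>(\<Union>c\<in>PiE V (\<lambda>_. T). PiE V (\<lambda>i. A (c i))). h x)"
    proof (intro sum.cong refl equalityI subsetI)
      fix x assume x: "x \<in> PiE V (\<lambda>_. \<Union>i\<in>T. A i)"
      then have "\<forall>i\<in>V. \<exists>t\<in>T. x i \<in> A t" by (auto simp: PiE_def Pi_def)
      then obtain c where c: "\<And>i. i \<in> V \<Longrightarrow> c i \<in> T \<and> x i \<in> A (c i)" by metis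
      have "restrict c V \<in> PiE V (\<lambda>_. T)" using c by auto
      moreover have "x \<in> PiE V (\<lambda>i. A (restrict c V i))" using x c by (auto simp: PiE_def Pi_def)
      ultimately show "x \<in> (\<Union>c\<in>PiE V (\<lambda>_. T). PiE V (\<lambda>i. A (c i)))" by blast
    next
      fix x assume "x \<in> (\<Union>c\<in>PiE V (\<lambda>_. T). PiE V (\<lambda>i. A (c i)))"
      then obtain c where c: "c \<in> PiE V (\<lambda>_. T)" "x \<in> PiE V (\<lambda>i. A (c i))" by blast
      show "x \<in> PiE V (\<lambda>_. \<Union>i\<in>T. A i)"
      proof (rule PiE_I)
        fix i assume "i \<in> V"
        then show "x i \<in> (\<Union>i\<in>T. A i)" using PiE_mem[OF c(1)] PiE_mem[OF c(2)] by blast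
      qed (rule PiE_arb[OF c(2)])
    qed
    also have "\<dots> = (\<Sum>c\<in>PiE V (\<lambda>_. T). H c)"
      unfolding H_def
    proof (intro sum.UNION_disjoint ballI impI)
      show "finite (PiE V (\<lambda>_. T))" using V finT by (intro finite_PiE) auto
      show "finite (PiE V (\<lambda>i. A (c i)))" if "c \<in> PiE V (\<lambda>_. T)" for c
        using V A T that by (intro finite_PiE) (auto simp: PiE_def Pi_def)
      fix c c' assume c: "c \<in> PiE V (\<lambda>_. T)" "c' \<in> PiE V (\<lambda>_. T)" "c \<noteq> c'"
      then obtain i where i: "i \<in> V" "c i \<noteq> c' i" by (metis PiE_ext)
      have "A (c i) \<inter> A (c' i) = {}"
        using disj c i T unfolding disjoint_family_on_def PiE_def Pi_def by blast
      then show "PiE V (\<lambda>i. A (c i)) \<inter> PiE V (\<lambda>i. A (c' i)) = {}"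
        using i(1) by (auto simp: PiE_def Pi_def)
    qed
    finally show ?thesis using b[OF T] by (simp add: g_def)
  qed
  have "f V = (\<Sum>T\<in>Pow V. (-1) ^ (card V - card T) * g T)"
    using gf V by (rule inclusion_exclusion_mobius)
  then have "\<bar>f V\<bar> \<le> (\<Sum>T\<in>Pow V. \<bar>(-1) ^ (card V - card T) * g T\<bar>)" by (simp only: sum_abs)
  also have "\<dots> \<le> (\<Sum>T\<in>Pow V. b)" using g_le by (intro sum_mono) (auto simp: abs_mult power_abs)
  also have "\<dots> = 2 ^ card V * b" using V by (simp add: card_Pow)
  finally have "\<bar>f V\<bar> \<le> 2 ^ card V * b" .
  \<comment> \<open>Maps of the finite set \<open>V\<close> onto itself are permutations, up to
    their values outside \<open>V\<close>.\<close>
  moreover have "(\<Sum>\<sigma> | \<sigma> permutes V. H \<sigma>) = f V"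
    unfolding f_def
  proof (rule sum.reindex_bij_witness[of _ "\<lambda>c i. if i \<in> V then c i else i" "\<lambda>\<sigma>. restrict \<sigma> V"])
    fix \<sigma> assume "\<sigma> \<in> {\<sigma>. \<sigma> permutes V}"
    then have s: "\<sigma> permutes V" by simp
    show "(\<lambda>i. if i \<in> V then restrict \<sigma> V i else i) = \<sigma>"
      using s by (auto simp: permutes_def)
    have "restrict \<sigma> V ` V = V" using permutes_image[OF s] by simp
    moreover have "restrict \<sigma> V \<in> PiE V (\<lambda>_. V)" using permutes_in_image[OF s] by auto
    ultimately show "restrict \<sigma> V \<in> {c. c \<in> PiE V (\<lambda>_. V) \<and> c ` V = V}" by blast
    show "H (restrict \<sigma> V) = H \<sigma>" unfolding H_def by (intro sum.cong PiE_cong) auto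
  next
    fix c assume c: "c \<in> {c. c \<in> PiE V (\<lambda>_. V) \<and> c ` V = V}"
    show "restrict (\<lambda>i. if i \<in> V then c i else i) V = c"
      using c by (intro ext) (auto simp: PiE_def extensional_def)
    have "bij_betw c V V" using c V by (simp add: bij_betw_def finite_surj_inj)
    then have "bij_betw (\<lambda>i. if i \<in> V then c i else i) V V"
      by (rule bij_betw_cong[THEN iffD1, rotated]) auto
    then show "(\<lambda>i. if i \<in> V then c i else i) \<in> {\<sigma>. \<sigma> permutes V}"
      by (auto intro!: bij_imp_permutes)
  qed
  ultimately show ?thesis by (simp add: H_def)
qed

section \<open>From (iv) to (i)\<close>

text \<open>The counting lemma with one constant per pair of sets. Disjointness keeps x and y
  distinct, so the special diagonal values of \<open>ind_fac\<close> never occur.\<close>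

lemma regular_transversals:
  assumes G: "simple_graph G" and V: "finite (verts F)"
    and A: "\<And>i. i \<in> verts F \<Longrightarrow> finite (A i)" and disj: "disjoint_family_on A (verts F)"
    and D: "\<And>i j. D i j \<in> {0..1}" and \<delta>: "0 \<le> \<delta>"
    and r: "\<And>i j. i \<in> verts F \<Longrightarrow> j \<in> verts F \<Longrightarrow> i \<noteq> j \<Longrightarrow> reg (adj G) \<delta> (D i j) (A i) (A j)"
  shows "\<bar>(\<Sum>x\<in>PiE (verts F) A. \<Prod>e\<in>pairs (verts F). ind_fac F G e (x (fst e)) (x (snd e)))
     - pat F D * (\<Prod>i\<in>verts F. real (card (A i)))\<bar> \<le> (real (num_verts F))\<^sup>2 * \<delta> * (\<Prod>i\<in>verts F. real (card (A i)))"
proof -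
  define g' :: "nat \<times> nat \<Rightarrow> nat \<Rightarrow> nat \<Rightarrow> real" where
    "g' e x y = (if {fst e, snd e} \<in> edges F then D (fst e) (snd e) else 1 - D (fst e) (snd e))" for e x y
  have "\<bar>(\<Sum>x\<in>PiE (verts F) A. \<Prod>e\<in>pairs (verts F). ind_fac F G e (x (fst e)) (x (snd e))) -
     (\<Sum>x\<in>PiE (verts F) A. \<Prod>e\<in>pairs (verts F). g' e (x (fst e)) (x (snd e)))\<bar>
     \<le> (real (card (verts F)))\<^sup>2 * \<delta> * (\<Prod>l\<in>verts F. real (card (A l)))"
  proof (rule counting_lemma[OF V A order_refl \<delta> fac_bounds(2)])
    show "g' e x y \<in> {0..1}" for e x y using D[of "fst e" "snd e"] by (simp add: g'_def)
    fix i j X Y assume ij: "(i, j) \<in> pairs (verts F)" and X: "X \<subseteq> A i" and Y: "Y \<subseteq> A j"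
    then have ij': "i \<in> verts F" "j \<in> verts F" "i \<noteq> j" by (auto simp: pairs_def)
    have ne: "x \<noteq> y" if "x \<in> X" "y \<in> Y" for x y
      using disj ij' X Y that unfolding disjoint_family_on_def by blast
    have R: "\<bar>\<Sum>x\<in>X. \<Sum>y\<in>Y. adj G x y - D i j\<bar> \<le> \<delta> * (real (card (A i)) * real (card (A j)))"
      by (rule regD[OF r[OF ij'] X Y])
    have "(\<Sum>x\<in>X. \<Sum>y\<in>Y. ind_fac F G (i, j) x y - g' (i, j) x y) =
      (if {i, j} \<in> edges F then (\<Sum>x\<in>X. \<Sum>y\<in>Y. adj G x y - D i j) else - (\<Sum>x\<in>X. \<Sum>y\<in>Y. adj G x y - D i j))"
      unfolding sum_negf[symmetric] using ne by (auto simp: ind_fac_def g'_def intro!: sum.cong)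
    then show "\<bar>\<Sum>x\<in>X. \<Sum>y\<in>Y. ind_fac F G (i, j) x y - g' (i, j) x y\<bar> \<le> \<delta> * real (card (A i)) * real (card (A j))"
      using R by (simp add: mult.assoc split: if_splits)
  qed
  moreover have "(\<Sum>x\<in>PiE (verts F) A. \<Prod>e\<in>pairs (verts F). g' e (x (fst e)) (x (snd e))) =
     pat F D * (\<Prod>i\<in>verts F. real (card (A i)))"
    by (simp add: g'_def pat_def case_prod_unfold card_PiE[OF V])
  ultimately show ?thesis by (simp add: num_verts_def)
qed

text \<open>Applied to the blocks, the hereditary bound and \<open>polarization\<close> control the
  transversal counts summed over all permutations; regularity evaluates the same sum as
  \<open>fact k * sym_pat F D\<close> times the product P of the block sizes. Dividing by P, at
  least (\<kappa> * n)^k, yields the two error terms.\<close>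

lemma regular_transversals_sym_pat:
  fixes \<kappa> :: real
  assumes G: "simple_graph G" and V: "finite (verts F)"
    and A: "\<And>i. i \<in> verts F \<Longrightarrow> A i \<subseteq> verts G" and disj: "disjoint_family_on A (verts F)"
    and D: "\<And>i j. D i j \<in> {0..1}" and \<delta>: "0 \<le> \<delta>"
    and r: "\<And>i j. i \<in> verts F \<Longrightarrow> j \<in> verts F \<Longrightarrow> i \<noteq> j \<Longrightarrow> reg (adj G) \<delta> (D i j) (A i) (A j)"
    and hered: "\<And>U. U \<subseteq> verts G \<Longrightarrow>
      \<bar>real (ind_embs_into F G U) - \<beta> * real (card U) ^ num_verts F\<bar> \<le> \<delta>0 * real (num_verts G) ^ num_verts F"
    and \<kappa>: "0 < \<kappa>" "0 < num_verts G" "0 \<le> \<delta>0" and size: "\<And>i. i \<in> verts F \<Longrightarrow> \<kappa> * num_verts G \<le> card (A i)"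
  shows "\<bar>sym_pat F D - \<beta>\<bar> \<le> 2 ^ num_verts F * \<delta>0 / \<kappa> ^ num_verts F + (real (num_verts F))\<^sup>2 * \<delta>"
proof -
  let ?V = "verts F" and ?k = "num_verts F"
  define n where "n = real (num_verts G)"
  define P where "P = (\<Prod>i\<in>?V. real (card (A i)))"
  define h where "h x = (\<Prod>e\<in>pairs ?V. ind_fac F G e (x (fst e)) (x (snd e))) - \<beta>" for x
  define Sg where "Sg = {\<sigma>. \<sigma> permutes ?V}"
  have finG: "finite (verts G)" using G by (simp add: simple_graph_def)
  have finA: "finite (A i)" if "i \<in> ?V" for i using A[OF that] finG finite_subset by blast
  have Sg: "finite Sg" "card Sg = fact ?k" using V by (auto simp: Sg_def finite_permutations card_permutations num_verts_def)
  have hsum: "(\<Sum>x\<in>PiE ?V B. h x) = (\<Sum>x\<in>PiE ?V B. \<Prod>e\<in>pairs ?V. ind_fac F G e (x (fst e)) (x (snd e))) - \<beta> * (\<Prod>i\<in>?V. real (card (B i)))" for B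
    unfolding h_def by (simp add: sum_subtractf card_PiE[OF V] mult.commute)
  have pol: "\<bar>\<Sum>\<sigma>\<in>Sg. \<Sum>x\<in>PiE ?V (\<lambda>i. A (\<sigma> i)). h x\<bar> \<le> 2 ^ card ?V * (\<delta>0 * n ^ ?k)"
    unfolding Sg_def
  proof (rule polarization[OF V finA disj])
    fix T assume T: "T \<subseteq> ?V"
    define U where "U = (\<Union>i\<in>T. A i)"
    have U: "U \<subseteq> verts G" using A T by (auto simp: U_def)
    then have finU: "finite U" using finG finite_subset by blast
    have "(\<Sum>x\<in>PiE ?V (\<lambda>_. U). h x) = real (ind_embs_into F G U) - \<beta> * real (card U) ^ ?k"
      unfolding hsum ind_embs_into_eq_sum[OF G V finU] by (simp add: num_verts_def)
    then show "\<bar>\<Sum>x\<in>PiE ?V (\<lambda>_. \<Union>i\<in>T. A i). h x\<bar> \<le> \<delta>0 * n ^ ?k"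
      using hered[OF U] by (simp add: U_def n_def)
  qed
  have each: "\<bar>(\<Sum>x\<in>PiE ?V (\<lambda>i. A (\<sigma> i)). h x) - (pat F (\<lambda>i j. D (\<sigma> i) (\<sigma> j)) - \<beta>) * P\<bar> \<le> (real ?k)\<^sup>2 * \<delta> * P"
    if "\<sigma> \<in> Sg" for \<sigma>
  proof -
    have s: "\<sigma> permutes ?V" using that by (simp add: Sg_def)
    have inV: "\<sigma> i \<in> ?V" if "i \<in> ?V" for i using permutes_in_image[OF s] that by simp
    have ne: "\<sigma> i \<noteq> \<sigma> j" if "i \<noteq> j" for i j using permutes_inj[OF s] that by (auto dest: injD)
    have P: "(\<Prod>i\<in>?V. real (card (A (\<sigma> i)))) = P"
      unfolding P_def using prod.permute[OF s, of "\<lambda>i. real (card (A i))"] by (simp add: o_def)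
    have "disjoint_family_on (\<lambda>i. A (\<sigma> i)) ?V"
      using disj inV ne unfolding disjoint_family_on_def by blast
    then have "\<bar>(\<Sum>x\<in>PiE ?V (\<lambda>i. A (\<sigma> i)). \<Prod>e\<in>pairs ?V. ind_fac F G e (x (fst e)) (x (snd e)))
     - pat F (\<lambda>i j. D (\<sigma> i) (\<sigma> j)) * (\<Prod>i\<in>?V. real (card (A (\<sigma> i))))\<bar> \<le> (real ?k)\<^sup>2 * \<delta> * (\<Prod>i\<in>?V. real (card (A (\<sigma> i))))"
      using finA inV ne r by (intro regular_transversals G V D \<delta>) auto
    then show ?thesis unfolding hsum P by (simp add: left_diff_distrib)
  qed
  have eq: "(\<Sum>\<sigma>\<in>Sg. (pat F (\<lambda>i j. D (\<sigma> i) (\<sigma> j)) - \<beta>) * P) = fact ?k * (sym_pat F D - \<beta>) * P"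
  proof -
    have "(\<Sum>\<sigma>\<in>Sg. pat F (\<lambda>i j. D (\<sigma> i) (\<sigma> j)) - \<beta>) = fact ?k * (sym_pat F D - \<beta>)"
      using Sg by (simp add: sum_subtractf sym_pat_def Sg_def right_diff_distrib)
    then show ?thesis by (simp flip: sum_distrib_right)
  qed
  have P0: "(\<kappa> * n) ^ ?k \<le> P"
  proof -
    have "(\<Prod>i\<in>?V. \<kappa> * n) \<le> P"
      unfolding P_def using size \<kappa> by (intro prod_mono) (auto simp: n_def)
    then show ?thesis by (simp add: num_verts_def)
  qed
  have kn: "0 < (\<kappa> * n) ^ ?k" using \<kappa> by (simp add: n_def)
  then have Ppos: "0 < P" using P0 by linarith
  have "\<bar>(\<Sum>\<sigma>\<in>Sg. \<Sum>x\<in>PiE ?V (\<lambda>i. A (\<sigma> i)). h x) - (\<Sum>\<sigma>\<in>Sg. (pat F (\<lambda>i j. D (\<sigma> i) (\<sigma> j)) - \<beta>) * P)\<bar>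
      \<le> (\<Sum>\<sigma>\<in>Sg. (real ?k)\<^sup>2 * \<delta> * P)"
    unfolding sum_subtractf[symmetric] by (rule order_trans[OF sum_abs]) (intro sum_mono each)
  also have "\<dots> = fact ?k * ((real ?k)\<^sup>2 * \<delta> * P)" using Sg by simp
  finally have "\<bar>fact ?k * (sym_pat F D - \<beta>) * P\<bar> \<le> 2 ^ ?k * (\<delta>0 * n ^ ?k) + fact ?k * ((real ?k)\<^sup>2 * \<delta> * P)"
    using pol unfolding eq num_verts_def by linarith
  then have "fact ?k * (\<bar>sym_pat F D - \<beta>\<bar> * P) \<le> 2 ^ ?k * (\<delta>0 * n ^ ?k) + fact ?k * ((real ?k)\<^sup>2 * \<delta> * P)"
    using Ppos by (simp add: abs_mult mult.assoc)
  \<comment> \<open>The factorial, being at least 1, is inserted into this error term so that it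
    cancels from the whole inequality.\<close>
  also have "2 ^ ?k * (\<delta>0 * n ^ ?k) \<le> fact ?k * (2 ^ ?k * \<delta>0 / \<kappa> ^ ?k * P)"
  proof -
    have "2 ^ ?k * (\<delta>0 * n ^ ?k) = 2 ^ ?k * \<delta>0 / \<kappa> ^ ?k * (\<kappa> * n) ^ ?k"
      using \<kappa> by (simp add: power_mult_distrib)
    also have "\<dots> \<le> 2 ^ ?k * \<delta>0 / \<kappa> ^ ?k * P" using P0 \<kappa> by (intro mult_left_mono) auto
    also have "\<dots> = 1 * (2 ^ ?k * \<delta>0 / \<kappa> ^ ?k * P)" by simp
    also have "\<dots> \<le> fact ?k * (2 ^ ?k * \<delta>0 / \<kappa> ^ ?k * P)"
      using \<kappa> Ppos by (intro mult_right_mono fact_ge_1) auto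
    finally show ?thesis .
  qed
  finally have "fact ?k * (\<bar>sym_pat F D - \<beta>\<bar> * P) \<le> fact ?k * ((2 ^ ?k * \<delta>0 / \<kappa> ^ ?k + (real ?k)\<^sup>2 * \<delta>) * P)"
    by (simp add: distrib_left distrib_right)
  then show ?thesis using Ppos by simp
qed

text \<open>The bias per pair is at most 1 and there are at most n^2 pairs. So a total deviation
  above \<epsilon> * n^2 forces both sets to be large and their density to be off by
  \<epsilon>.\<close>

lemma not_cut_close:
  assumes G: "simple_graph G" and q: "q \<in> {0..1}" and \<epsilon>: "0 < \<epsilon>" and nc: "\<not> cut_close G (\<lambda>_ _. q) \<epsilon>"
  shows "\<exists>X Y. X \<subseteq> verts G \<and> Y \<subseteq> verts G \<and> X \<noteq> {} \<and> Y \<noteq> {} \<and> \<epsilon> * num_verts G \<le> card X \<and>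
    \<epsilon> * num_verts G \<le> card Y \<and> \<epsilon> \<le> \<bar>dens (adj G) X Y - q\<bar>"
proof -
  define n where "n = real (num_verts G)"
  have finG: "finite (verts G)" using G by (simp add: simple_graph_def)
  obtain X Y where XY: "X \<subseteq> verts G" "Y \<subseteq> verts G" "\<epsilon> * n\<^sup>2 < \<bar>\<Sum>x\<in>X. \<Sum>y\<in>Y. adj G x y - q\<bar>"
    using nc unfolding cut_close_def n_def by (meson not_le)
  have fin: "finite X" "finite Y" using XY finG finite_subset by auto
  have "0 \<le> \<epsilon> * n\<^sup>2" using \<epsilon> by simp
  then have ne: "X \<noteq> {}" "Y \<noteq> {}" using XY(3) by auto
  have cn: "real (card X) \<le> n" "real (card Y) \<le> n"
    using XY finG by (auto simp: n_def num_verts_def intro: card_mono)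
  have pos: "0 < real (card X)" "0 < real (card Y)" using fin ne by (auto simp: card_gt_0_iff)
  have npos: "0 < n" using pos cn by linarith
  define t where "t = \<bar>dens (adj G) X Y - q\<bar>"
  have t1: "t \<le> 1" using dens_bounds[of "adj G", OF fac_bounds(1) fin] q by (auto simp: t_def)
  have t0: "0 \<le> t" by (simp add: t_def)
  have big: "\<epsilon> * n\<^sup>2 < t * (real (card X) * real (card Y))"
    using XY(3) unfolding sum_eq_dens[OF fin ne] t_def by (simp add: abs_mult)
  have "t * (real (card X) * real (card Y)) \<le> 1 * (real (card X) * n)"
    using t1 t0 cn by (intro mult_mono) auto
  then have "(\<epsilon> * n) * n \<le> real (card X) * n" using big by (simp add: power2_eq_square)
  then have X: "\<epsilon> * n \<le> card X" using npos by simp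
  have "t * (real (card X) * real (card Y)) \<le> 1 * (n * real (card Y))"
    using t1 t0 cn by (intro mult_mono) auto
  then have "(\<epsilon> * n) * n \<le> real (card Y) * n" using big by (simp add: power2_eq_square mult.commute[of n "real (card Y)"])
  then have Y: "\<epsilon> * n \<le> card Y" using npos by simp
  have "t * (real (card X) * real (card Y)) \<le> t * (n * n)"
    using t0 cn by (intro mult_mono) auto
  then have "\<epsilon> * (n * n) \<le> t * (n * n)" using big by (simp add: power2_eq_square)
  then have "\<epsilon> \<le> t" using npos by simp
  then show ?thesis using XY ne X Y unfolding t_def n_def by blast
qed

lemma dens_sym: "dens (adj G) A B = dens (adj G) B A"
  unfolding dens_def by (subst sum.swap) (simp add: adj_sym mult.commute)

definition hereditary_error :: "ugraph \<Rightarrow> real \<Rightarrow> real \<Rightarrow> ugraph \<Rightarrow> bool" where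
  "hereditary_error F p \<delta> G \<longleftrightarrow> (\<forall>U\<subseteq>verts G.
     \<bar>real (ind_embs_into F G U) - beta F p * real (card U) ^ num_verts F\<bar> \<le> \<delta> * real (num_verts G) ^ num_verts F)"

lemma half_floor_div:
  fixes m s :: nat
  assumes "0 < m" "m \<le> s"
  shows "real s / (2 * m) \<le> real (s div m)" and "0 < s div m"
proof -
  show q: "0 < s div m" using assms by (simp add: div_greater_zero_iff)
  have "s < m * Suc (s div m)" using dividend_less_times_div[OF assms(1), of s] by simp
  also have "\<dots> \<le> m * (2 * (s div m))" using q by (intro mult_le_mono2) linarith
  finally have "s \<le> 2 * m * (s div m)" by simp
  then have "real s \<le> real (2 * m * (s div m))" by (rule of_nat_mono)
  then show "real s / (2 * m) \<le> real (s div m)"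
    using assms(1) by (simp add: field_simps)
qed

text \<open>The quantitative core of (iv) implies (i). If both alternatives fail, each failure gives
  a large pair, first made regular while staying biased. All four sets are then cut into
  \<open>N\<close> disjoint pieces, which are made pairwise regular. The pieces keep the bias, and
  their densities form an array excluded by \<open>rigid_arrays\<close>. The constants must be fixed
  backwards, from the array to the graph.\<close>

lemma rigid_imp_cut_close:
  assumes F: "simple_graph F" and V: "verts F = {1..k}" and k: "k > 1" and p: "0 < p" "p < 1"
    and rigid: "rigid F p" and \<epsilon>: "0 < \<epsilon>" "\<epsilon> \<le> 1"
  shows "\<exists>\<delta>0 n0. 0 < \<delta>0 \<and> (\<forall>G. simple_graph G \<longrightarrow> n0 \<le> num_verts G \<longrightarrow> hereditary_error F p \<delta>0 G \<longrightarrow>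
     cut_close G (\<lambda>_ _. p) \<epsilon> \<or> cut_close G (\<lambda>_ _. conjugate F p) \<epsilon>)"
proof -
  define p' where "p' = conjugate F p"
  have fin: "finite (verts F)" and nv: "num_verts F = k" by (auto simp: V num_verts_def)
  have p01: "p \<in> {0..1}" "p' \<in> {0..1}" using p beta_conjugate(1)[OF F _ p] k by (auto simp: p'_def nv)
  have "0 < \<epsilon> / 2" using \<epsilon> by simp
  from rigid_arrays[OF F V k p rigid this] obtain N :: nat and \<delta>c where \<delta>c: "0 < \<delta>c" and
    core: "\<forall>m. \<not> (array_near F p N \<delta>c m \<and>
     (\<forall>i j. i < j \<longrightarrow> j < N \<longrightarrow> \<epsilon> / 2 \<le> \<bar>m 0 1 i j - p\<bar>) \<and>
     (\<forall>i j. i < j \<longrightarrow> j < N \<longrightarrow> \<epsilon> / 2 \<le> \<bar>m 2 3 i j - conjugate F p\<bar>))" by (elim exE conjE) (rule that)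
  \<comment> \<open>There are \<open>4 * N\<close> pieces; the extra 1 keeps the divisor
    positive.\<close>
  define m where "m = 4 * N + 1"
  \<comment> \<open>Half of the tolerance \<open>\<delta>c\<close> goes to the counting error; the
    doubled \<open>\<delta>2\<close> in it comes from \<open>reg_dens\<close>.\<close>
  define \<delta>2 where "\<delta>2 = min 1 (\<delta>c / (4 * (real k)\<^sup>2))"
  have \<delta>2: "0 < \<delta>2" "\<delta>2 \<le> 1" "(real k)\<^sup>2 * (2 * \<delta>2) \<le> \<delta>c / 2"
  proof -
    have "(real k)\<^sup>2 * (2 * \<delta>2) \<le> (real k)\<^sup>2 * (2 * (\<delta>c / (4 * (real k)\<^sup>2)))"
      unfolding \<delta>2_def by (intro mult_left_mono) auto
    also have "\<dots> = \<delta>c / 2" using k by simp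
    finally show "(real k)\<^sup>2 * (2 * \<delta>2) \<le> \<delta>c / 2" .
  qed (use \<delta>c k in \<open>auto simp: \<delta>2_def\<close>)
  define I where "I = {..<4::nat} \<times> {..<N}"
  define Ps where "Ps = {(i, j). i \<in> I \<and> j \<in> I \<and> i \<noteq> j}"
  have Ps: "Ps \<subseteq> {(i, j). i \<in> I \<and> j \<in> I \<and> i \<noteq> j}" by (simp add: Ps_def)
  have "finite Ps" unfolding Ps_def I_def
    by (rule finite_subset[of _ "({..<4} \<times> {..<N}) \<times> ({..<4} \<times> {..<N})"]) auto
  from regular_tuple[OF this Ps \<delta>2(1,2)] obtain c2 :: real where c2: "0 < c2" "c2 \<le> 1" and
    tup: "\<forall>(a :: nat \<Rightarrow> nat \<Rightarrow> real) T. (\<forall>x y. a x y \<in> {0..1}) \<longrightarrow> (\<forall>i\<in>I. finite (T i) \<and> T i \<noteq> {}) \<longrightarrow>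
    (\<exists>T'. (\<forall>i\<in>I. T' i \<subseteq> T i \<and> T' i \<noteq> {} \<and> c2 * card (T i) \<le> card (T' i)) \<and>
       (\<forall>(i, j)\<in>Ps. \<exists>d. reg a \<delta>2 d (T' i) (T' j)))" by (elim exE conjE) (rule that)
  \<comment> \<open>The fraction of its group that a final piece retains: 1 / (2 * m) after rounding
    down in the cutting, and \<open>c2\<close> for making the pieces regular.\<close>
  define \<alpha> where "\<alpha> = c2 / (2 * m)"
  have \<alpha>: "0 < \<alpha>" using c2 by (simp add: \<alpha>_def m_def)
  \<comment> \<open>The large pairs have to be so regular that densities between \<alpha> fractions
    move by at most \<open>\<epsilon> / 2\<close>, leaving half of the bias.\<close>
  define \<delta>1 where "\<delta>1 = min 1 (\<epsilon> / 2 * \<alpha>\<^sup>2)"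
  have \<delta>1: "0 < \<delta>1" "\<delta>1 \<le> 1" "\<delta>1 / \<alpha>\<^sup>2 \<le> \<epsilon> / 2"
    using \<epsilon> \<alpha> by (auto simp: \<delta>1_def pos_divide_le_eq)
  from regular_pair[OF \<delta>1(1,2)] obtain c1 :: real where c1: "0 < c1" "c1 \<le> 1" and
    pair': "\<forall>(a :: nat \<Rightarrow> nat \<Rightarrow> real) A B t. (\<forall>x y. a x y \<in> {0..1}) \<longrightarrow> finite A \<longrightarrow> finite B \<longrightarrow> A \<noteq> {} \<longrightarrow> B \<noteq> {} \<longrightarrow>
    (\<exists>A' B'. A' \<subseteq> A \<and> B' \<subseteq> B \<and> A' \<noteq> {} \<and> B' \<noteq> {} \<and> c1 * card A \<le> card A' \<and> c1 * card B \<le> card B' \<and>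
       \<bar>dens a A B - t\<bar> \<le> \<bar>dens a A' B' - t\<bar> \<and> reg a \<delta>1 (dens a A' B') A' B')" by (elim exE conjE) (rule that)
  define \<kappa> where "\<kappa> = \<alpha> * (c1 * \<epsilon>)"
  have \<kappa>: "0 < \<kappa>" using \<alpha> c1 \<epsilon> by (simp add: \<kappa>_def)
  \<comment> \<open>Makes the polarization error equal to the other half of
    \<open>\<delta>c\<close>, since \<open>\<kappa>\<close> is the fraction of all vertices in a
    final piece.\<close>
  define \<delta>0 where "\<delta>0 = \<delta>c / 2 * \<kappa> ^ k / 2 ^ k"
  have \<delta>0: "0 < \<delta>0" "2 ^ k * \<delta>0 / \<kappa> ^ k = \<delta>c / 2" using \<delta>c \<kappa> by (auto simp: \<delta>0_def)
  \<comment> \<open>From this order on every group has at least \<open>m\<close> elements, so none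
    of its pieces is empty.\<close>
  define n0 where "n0 = nat \<lceil>m / (c1 * \<epsilon>)\<rceil> + 1"
  have "cut_close G (\<lambda>_ _. p) \<epsilon> \<or> cut_close G (\<lambda>_ _. p') \<epsilon>"
    if G: "simple_graph G" and n: "n0 \<le> num_verts G" and hered: "hereditary_error F p \<delta>0 G" for G
  proof (rule ccontr)
    assume "\<not> ?thesis"
    then have nc: "\<not> cut_close G (\<lambda>_ _. p) \<epsilon>" "\<not> cut_close G (\<lambda>_ _. p') \<epsilon>" by auto
    have finG: "finite (verts G)" using G by (simp add: simple_graph_def)
    define n where "n = real (num_verts G)"
    have nm: "m \<le> c1 * \<epsilon> * n" "0 < num_verts G"
    proof -
      have "m / (c1 * \<epsilon>) \<le> real n0" unfolding n0_def by linarith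
      also have "\<dots> \<le> n" using n by (simp add: n_def)
      finally show "m \<le> c1 * \<epsilon> * n" using c1 \<epsilon> by (simp add: pos_divide_le_eq mult.commute)
      show "0 < num_verts G" using n by (simp add: n0_def)
    qed
    have get: "\<exists>A B. A \<subseteq> verts G \<and> B \<subseteq> verts G \<and> c1 * \<epsilon> * n \<le> card A \<and> c1 * \<epsilon> * n \<le> card B \<and>
       \<epsilon> \<le> \<bar>dens (adj G) A B - q\<bar> \<and> reg (adj G) \<delta>1 (dens (adj G) A B) A B"
      if q: "q \<in> {0..1}" "\<not> cut_close G (\<lambda>_ _. q) \<epsilon>" for q
    proof -
      obtain X Y where XY: "X \<subseteq> verts G" "Y \<subseteq> verts G" "X \<noteq> {}" "Y \<noteq> {}" "\<epsilon> * num_verts G \<le> card X"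
        "\<epsilon> * num_verts G \<le> card Y" "\<epsilon> \<le> \<bar>dens (adj G) X Y - q\<bar>"
        using not_cut_close[OF G q(1) \<epsilon>(1) q(2)] by (elim exE conjE) (rule that)
      have finXY: "finite X" "finite Y" using XY finG finite_subset by auto
      have adj01: "\<forall>x y. adj G x y \<in> {0..1}" using fac_bounds(1) by blast
      obtain A B where AB: "A \<subseteq> X" "B \<subseteq> Y" "c1 * card X \<le> card A" "c1 * card Y \<le> card B"
        "\<bar>dens (adj G) X Y - q\<bar> \<le> \<bar>dens (adj G) A B - q\<bar>" "reg (adj G) \<delta>1 (dens (adj G) A B) A B"
        using pair'[THEN spec[of _ "adj G"], THEN spec[of _ X], THEN spec[of _ Y], THEN spec[of _ q],
            THEN mp, OF adj01, THEN mp, OF finXY(1), THEN mp, OF finXY(2), THEN mp, OF XY(3), THEN mp, OF XY(4)]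
        by (elim exE conjE) (rule that)
      have "c1 * (\<epsilon> * n) \<le> c1 * card X" "c1 * (\<epsilon> * n) \<le> c1 * card Y"
        using XY c1 by (auto simp: n_def intro!: mult_left_mono)
      then have "c1 * \<epsilon> * n \<le> card A" "c1 * \<epsilon> * n \<le> card B" using AB(3,4) by (simp_all only: mult.assoc)
      moreover have "\<epsilon> \<le> \<bar>dens (adj G) A B - q\<bar>" using AB(5) XY(7) by simp
      ultimately show ?thesis using AB(1,2,6) XY(1,2) by (intro exI[of _ A] exI[of _ B] conjI) auto
    qed
    obtain A B where AB: "A \<subseteq> verts G" "B \<subseteq> verts G" "c1 * \<epsilon> * n \<le> card A" "c1 * \<epsilon> * n \<le> card B"
       "\<epsilon> \<le> \<bar>dens (adj G) A B - p\<bar>" "reg (adj G) \<delta>1 (dens (adj G) A B) A B"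
      using get[OF p01(1) nc(1)] by (elim exE conjE) (rule that)
    obtain C D where CD: "C \<subseteq> verts G" "D \<subseteq> verts G" "c1 * \<epsilon> * n \<le> card C" "c1 * \<epsilon> * n \<le> card D"
       "\<epsilon> \<le> \<bar>dens (adj G) C D - p'\<bar>" "reg (adj G) \<delta>1 (dens (adj G) C D) C D"
      using get[OF p01(2) nc(2)] by (elim exE conjE) (rule that)
    define Z where "Z a = (if a = 0 then A else if a = 1 then B else if a = 2 then C else D)" for a :: nat
    have Z: "Z a \<subseteq> verts G" "c1 * \<epsilon> * n \<le> card (Z a)" "finite (Z a)" for a
      using AB CD finG finite_subset by (auto simp: Z_def)
    have mZ: "m \<le> card (Z a)" for a using nm(1) Z(2)[of a] by linarith
    have cI: "finite I" "card I \<le> m" by (auto simp: I_def m_def card_cartesian_product)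
    \<comment> \<open>The sets of the two witnesses may overlap, whereas the blocks of transversals
      must be disjoint.\<close>
    have "\<exists>T. (\<forall>i\<in>I. T i \<subseteq> Z (fst i) \<and> card (T i) = card (Z (fst i)) div m) \<and> disjoint_family_on T I"
      by (rule disjoint_subsets[OF cI(1) Z(3) cI(2)])
    then obtain T where T0: "\<forall>i\<in>I. T i \<subseteq> Z (fst i) \<and> card (T i) = card (Z (fst i)) div m"
      and Tdisj: "disjoint_family_on T I" by (elim exE conjE) (rule that)
    have T: "T i \<subseteq> Z (fst i)" "card (T i) = card (Z (fst i)) div m" if "i \<in> I" for i
      using T0 that by blast+
    have finT: "finite (T i)" if "i \<in> I" for i using T(1)[OF that] Z(3) finite_subset by blast
    have Tcard: "card (Z (fst i)) / (2 * m) \<le> card (T i)" "T i \<noteq> {}" if "i \<in> I" for i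
      using half_floor_div[of m "card (Z (fst i))"] mZ[of "fst i"] T(2)[OF that] by (auto simp: m_def)
    have "\<forall>i\<in>I. finite (T i) \<and> T i \<noteq> {}" using finT Tcard(2) by blast
    moreover have "\<forall>x y. adj G x y \<in> {0..1}" using fac_bounds(1) by blast
    ultimately obtain T' where T': "\<forall>i\<in>I. T' i \<subseteq> T i \<and> T' i \<noteq> {} \<and> c2 * card (T i) \<le> card (T' i)"
       "\<forall>(i, j)\<in>Ps. \<exists>d. reg (adj G) \<delta>2 d (T' i) (T' j)"
      using tup[THEN spec[of _ "adj G"], THEN spec[of _ T]] by (elim impE exE conjE) (assumption | rule that)+
    have T'sub: "T' i \<subseteq> T i" "T' i \<noteq> {}" "T' i \<subseteq> Z (fst i)" "T' i \<subseteq> verts G" "finite (T' i)" if "i \<in> I" for i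
      using T'(1) T(1)[OF that] Z(1)[of "fst i"] finT[OF that] that finite_subset by blast+
    have T'card: "\<alpha> * card (Z (fst i)) \<le> card (T' i)" if "i \<in> I" for i
    proof -
      have "c2 * (card (Z (fst i)) / (2 * m)) \<le> c2 * card (T i)" using Tcard(1)[OF that] c2 by (intro mult_left_mono) auto
      then show ?thesis using T'(1) that by (force simp: \<alpha>_def)
    qed
    have T'reg: "reg (adj G) (2 * \<delta>2) (dens (adj G) (T' i) (T' j)) (T' i) (T' j)" if "i \<in> I" "j \<in> I" "i \<noteq> j" for i j
    proof -
      have "(i, j) \<in> Ps" using that by (simp add: Ps_def)
      then obtain d where "reg (adj G) \<delta>2 d (T' i) (T' j)" using T'(2) by blast
      then show ?thesis using T'sub[OF that(1)] T'sub[OF that(2)] by (intro reg_dens) auto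
    qed
    have T'disj: "T' i \<inter> T' j = {}" if "i \<in> I" "j \<in> I" "i \<noteq> j" for i j
      using disjoint_family_onD[OF Tdisj that] T'sub(1)[OF that(1)] T'sub(1)[OF that(2)] by blast
    define mm where "mm a b i j = dens (adj G) (T' (a, i)) (T' (b, j))" for a b i j
    have near: "array_near F p N \<delta>c mm"
      unfolding array_near_def
    proof (intro conjI allI impI)
      fix a b i j :: nat assume "a < 4" "b < 4" "i < N" "j < N"
      then have "(a, i) \<in> I" "(b, j) \<in> I" by (auto simp: I_def)
      then show "mm a b i j \<in> {0..1}" unfolding mm_def using T'sub(5) by (intro dens_bounds fac_bounds) auto
      show "mm a b i j = mm b a j i" unfolding mm_def by (rule dens_sym)
    next
      fix g \<iota> :: "nat \<Rightarrow> nat"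
      assume g: "g ` verts F \<subseteq> {..<4}" and \<iota>: "\<iota> ` verts F \<subseteq> {..<N}" "inj_on \<iota> (verts F)"
      define ix where "ix s = (g s, \<iota> s)" for s
      have ix: "ix s \<in> I" if "s \<in> verts F" for s using that g \<iota>(1) by (auto simp: ix_def I_def)
      have ix_ne: "ix s \<noteq> ix t" if "s \<in> verts F" "t \<in> verts F" "s \<noteq> t" for s t
        using inj_onD[OF \<iota>(2) _ that(1,2)] that(3) by (auto simp: ix_def)
      \<comment> \<open>The value 0 off \<open>verts F\<close> makes the array bounded at all
        indices, as \<open>regular_transversals_sym_pat\<close> demands.\<close>
      define Dm where "Dm s t = (if s \<in> verts F \<and> t \<in> verts F then dens (adj G) (T' (ix s)) (T' (ix t)) else 0)" for s t
      have "\<bar>sym_pat F Dm - beta F p\<bar> \<le> 2 ^ num_verts F * \<delta>0 / \<kappa> ^ num_verts F + (real (num_verts F))\<^sup>2 * (2 * \<delta>2)"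
      proof (rule regular_transversals_sym_pat[OF G fin, where A = "\<lambda>s. T' (ix s)"])
        show "T' (ix s) \<subseteq> verts G" if "s \<in> verts F" for s using T'sub(4)[OF ix[OF that]] .
        show "disjoint_family_on (\<lambda>s. T' (ix s)) (verts F)"
          unfolding disjoint_family_on_def using T'disj ix ix_ne by blast
        show "Dm s t \<in> {0..1}" for s t
          unfolding Dm_def using dens_bounds[of "adj G", OF fac_bounds(1) T'sub(5)[OF ix] T'sub(5)[OF ix], of s t] by simp
        show "reg (adj G) (2 * \<delta>2) (Dm s t) (T' (ix s)) (T' (ix t))" if "s \<in> verts F" "t \<in> verts F" "s \<noteq> t" for s t
          using T'reg[OF ix[OF that(1)] ix[OF that(2)] ix_ne[OF that]] that by (simp add: Dm_def)
        show "\<bar>real (ind_embs_into F G U) - beta F p * real (card U) ^ num_verts F\<bar> \<le> \<delta>0 * real (num_verts G) ^ num_verts F"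
          if "U \<subseteq> verts G" for U using hered that unfolding hereditary_error_def by blast
        show "\<kappa> * num_verts G \<le> card (T' (ix s))" if "s \<in> verts F" for s
        proof -
          have "\<alpha> * (c1 * \<epsilon> * n) \<le> \<alpha> * card (Z (fst (ix s)))" using Z(2) \<alpha> by (intro mult_left_mono) auto
          then show ?thesis using T'card[OF ix[OF that]] by (simp add: \<kappa>_def n_def mult.assoc)
        qed
      qed (use \<delta>2 \<kappa> nm \<delta>0 in auto)
      also have "\<dots> \<le> \<delta>c" unfolding nv \<delta>0(2) using \<delta>2(3) by linarith
      also have "sym_pat F Dm = sym_pat F (\<lambda>s t. mm (g s) (g t) (\<iota> s) (\<iota> t))"
        by (intro sym_pat_cong) (simp add: Dm_def mm_def ix_def)
      finally show "\<bar>sym_pat F (\<lambda>s t. mm (g s) (g t) (\<iota> s) (\<iota> t)) - beta F p\<bar> \<le> \<delta>c" .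
    qed
    have far: "\<epsilon> / 2 \<le> \<bar>mm a b i j - q\<bar>"
      if r: "reg (adj G) \<delta>1 (dens (adj G) (Z a) (Z b)) (Z a) (Z b)" and q: "\<epsilon> \<le> \<bar>dens (adj G) (Z a) (Z b) - q\<bar>"
        and ab: "a < 4" "b < 4" "i < N" "j < N" for a b i j q
    proof -
      have I: "(a, i) \<in> I" "(b, j) \<in> I" using ab by (auto simp: I_def)
      have "reg (adj G) (\<delta>1 / \<alpha>\<^sup>2) (dens (adj G) (Z a) (Z b)) (T' (a, i)) (T' (b, j))"
        using T'sub(3)[OF I(1)] T'sub(3)[OF I(2)] T'card[OF I(1)] T'card[OF I(2)] \<alpha> \<delta>1(1)
        by (intro reg_subset[OF r]) auto
      then have "\<bar>mm a b i j - dens (adj G) (Z a) (Z b)\<bar> \<le> \<delta>1 / \<alpha>\<^sup>2"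
        unfolding mm_def using T'sub[OF I(1)] T'sub[OF I(2)] by (intro reg_dens_near) auto
      then show ?thesis using \<delta>1(3) q by linarith
    qed
    have "\<epsilon> / 2 \<le> \<bar>mm 0 1 i j - p\<bar>" if "i < j" "j < N" for i j
      using that AB by (intro far) (auto simp: Z_def)
    moreover have "\<epsilon> / 2 \<le> \<bar>mm 2 3 i j - p'\<bar>" if "i < j" "j < N" for i j
      using that CD by (intro far) (auto simp: Z_def)
    ultimately show False using core near unfolding p'_def by blast
  qed
  then show ?thesis using \<delta>0(1) unfolding p'_def by blast
qed

section \<open>From cut closeness to quasi-randomness\<close>

lemma quasi_randomI:
  assumes G: "\<And>n. simple_graph (G n)" and lim: "order_to_infinity G" and q: "q \<in> {0..1}"
    and cc: "\<And>\<epsilon>. 0 < \<epsilon> \<Longrightarrow> \<forall>\<^sub>F n in sequentially. cut_close (G n) (\<lambda>_ _. q) \<epsilon>"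
  shows "quasi_random q G"
  unfolding quasi_random_def
proof (intro conjI allI impI lim)
  fix H assume H: "simple_graph H"
  let ?h = "num_verts H"
  show "(\<lambda>n. real (inj_homs H (G n)) - q ^ num_edges H * real (num_verts (G n)) ^ ?h)
      \<in> o(\<lambda>n. real (num_verts (G n)) ^ ?h)"
  proof (rule landau_o.smallI)
    fix c :: real assume c: "0 < c"
    \<comment> \<open>The summand 1 avoids division by 0 when \<open>H\<close> has no
      vertices.\<close>
    define \<delta> where "\<delta> = c / (2 * (real ?h)\<^sup>2 + 1)"
    have \<delta>: "0 < \<delta>" using c by (auto simp: \<delta>_def intro!: divide_pos_pos add_nonneg_pos)
    have le: "(real ?h)\<^sup>2 * (2 * \<delta>) \<le> c"
    proof -
      have "(real ?h)\<^sup>2 * (2 * \<delta>) \<le> (2 * (real ?h)\<^sup>2 + 1) * \<delta>" using \<delta> by (simp add: algebra_simps)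
      also have "\<dots> = c" unfolding \<delta>_def by (simp add: add_nonneg_eq_0_iff)
      finally show ?thesis .
    qed
    have "\<forall>\<^sub>F n in sequentially. nat \<lceil>1 / \<delta>\<rceil> \<le> num_verts (G n)"
      using lim unfolding order_to_infinity_def filterlim_at_top by blast
    with cc[OF \<delta>] show "\<forall>\<^sub>F n in sequentially. norm (real (inj_homs H (G n)) - q ^ num_edges H * real (num_verts (G n)) ^ ?h)
        \<le> c * norm (real (num_verts (G n)) ^ ?h)"
    proof eventually_elim
      case (elim n)
      have "1 / \<delta> \<le> num_verts (G n)" using elim(2) by linarith
      then have "1 \<le> \<delta> * num_verts (G n)" using \<delta> by (simp add: pos_divide_le_eq mult.commute)
      then have "\<bar>real (inj_homs H (G n)) - q ^ num_edges H * real (num_verts (G n)) ^ ?h\<bar> \<le>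
         (real ?h)\<^sup>2 * (2 * \<delta>) * real (num_verts (G n)) ^ ?h"
        using \<delta> by (intro cut_close_const_inj_homs[OF G H elim(1) _ _ q]) auto
      also have "\<dots> \<le> c * real (num_verts (G n)) ^ ?h" using le by (intro mult_right_mono) auto
      finally show ?case by simp
    qed
  qed
qed

lemma order_to_infinity_subseq:
  assumes "order_to_infinity G" "strict_mono r"
  shows "order_to_infinity (G \<circ> r)"
  using filterlim_compose[OF _ filterlim_subseq[OF assms(2)]] assms(1)
  unfolding order_to_infinity_def o_def by blast

lemma cut_close_mono: "cut_close G W \<delta> \<Longrightarrow> \<delta> \<le> \<delta>' \<Longrightarrow> cut_close G W \<delta>'"
  unfolding cut_close_def by (meson mult_right_mono order_trans zero_le_power2)

lemma rigid_imp_hereditary_induced_forcing: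
  assumes F: "simple_graph F" and V: "verts F = {1..k}" and k: "k > 1" and p: "0 < p" "p < 1"
    and rigid: "rigid F p"
  shows "hereditary_induced_forcing F p"
  unfolding hereditary_induced_forcing_def
proof (intro allI impI, elim conjE)
  fix G assume G: "\<forall>n. simple_graph (G n)" and lim: "order_to_infinity G"
    and hered: "\<forall>\<epsilon>>0. \<forall>\<^sub>F n in sequentially. \<forall>U\<subseteq>verts (G n).
      \<bar>real (ind_embs_into F (G n) U) - beta F p * real (card U) ^ num_verts F\<bar> \<le> \<epsilon> * real (num_verts (G n)) ^ num_verts F"
  define p' where "p' = conjugate F p"
  have nv: "num_verts F = k" by (simp add: V num_verts_def)
  have p01: "p \<in> {0..1}" "p' \<in> {0..1}" using p beta_conjugate(1)[OF F _ p] k by (auto simp: p'_def nv)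
  define c where "c q \<epsilon> n \<longleftrightarrow> cut_close (G n) (\<lambda>_ _. q) \<epsilon>" for q \<epsilon> n
  have mono: "c q \<epsilon>' n" if "c q \<epsilon> n" "\<epsilon> \<le> \<epsilon>'" for q \<epsilon> \<epsilon>' n
    using cut_close_mono that unfolding c_def by blast
  have ev: "\<forall>\<^sub>F n in sequentially. c p \<epsilon> n \<or> c p' \<epsilon> n" if "0 < \<epsilon>" for \<epsilon>
  proof -
    define \<epsilon>' where "\<epsilon>' = min \<epsilon> 1"
    have "0 < \<epsilon>'" "\<epsilon>' \<le> 1" using that by (auto simp: \<epsilon>'_def)
    from rigid_imp_cut_close[OF F V k p rigid this] obtain \<delta>0 n0 where "0 < \<delta>0" and
      close: "\<forall>G. simple_graph G \<longrightarrow> n0 \<le> num_verts G \<longrightarrow> hereditary_error F p \<delta>0 G \<longrightarrow>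
     cut_close G (\<lambda>_ _. p) \<epsilon>' \<or> cut_close G (\<lambda>_ _. conjugate F p) \<epsilon>'" by (elim exE conjE) (rule that)
    have "\<forall>\<^sub>F n in sequentially. hereditary_error F p \<delta>0 (G n)"
      unfolding hereditary_error_def using hered \<open>0 < \<delta>0\<close> by blast
    moreover have "\<forall>\<^sub>F n in sequentially. n0 \<le> num_verts (G n)"
      using lim unfolding order_to_infinity_def filterlim_at_top by blast
    ultimately show ?thesis
    proof eventually_elim
      case (elim n)
      then have "c p \<epsilon>' n \<or> c p' \<epsilon>' n" using close G unfolding c_def p'_def by blast
      then show ?case using mono[of _ \<epsilon>' n \<epsilon>] by (auto simp: \<epsilon>'_def)
    qed
  qed
  \<comment> \<open>the \<open>n\<close> for which \<open>G n\<close> is at least as close to \<open>p\<close> as to \<open>p'\<close>\<close>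
  define I1 where "I1 = {n. \<forall>\<epsilon>. c p' \<epsilon> n \<longrightarrow> c p \<epsilon> n}"
  have sub: "quasi_random q (G \<circ> enumerate I)" if I: "infinite I" and q: "q \<in> {0..1}"
    and all: "\<And>\<epsilon> n. n \<in> I \<Longrightarrow> c p \<epsilon> n \<or> c p' \<epsilon> n \<Longrightarrow> c q \<epsilon> n" for I q
  proof (rule quasi_randomI)
    have sm: "strict_mono (enumerate I)" using I by (rule strict_mono_enumerate)
    show "order_to_infinity (G \<circ> enumerate I)" using lim sm by (rule order_to_infinity_subseq)
    fix \<epsilon> :: real assume "0 < \<epsilon>"
    from filterlim_subseq[OF sm] ev[OF this]
    have "\<forall>\<^sub>F n in sequentially. c p \<epsilon> (enumerate I n) \<or> c p' \<epsilon> (enumerate I n)"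
      unfolding filterlim_iff by blast
    then show "\<forall>\<^sub>F n in sequentially. cut_close ((G \<circ> enumerate I) n) (\<lambda>_ _. q) \<epsilon>"
    proof eventually_elim
      case (elim n)
      then show ?case using all[OF enumerate_in_set[OF I]] by (simp add: c_def)
    qed
  qed (use G q in auto)
  show "mixed_quasi_random p (conjugate F p) G"
    unfolding mixed_quasi_random_def p'_def[symmetric]
  proof (rule exI[of _ I1], rule exI[of _ "- I1"], intro conjI impI)
    show "quasi_random p (G \<circ> enumerate I1)" if "infinite I1"
      using that p01(1) by (rule sub) (auto simp: I1_def)
    show "quasi_random p' (G \<circ> enumerate (- I1))" if "infinite (- I1)"
      using that p01(2)
    proof (rule sub)
      fix \<epsilon> n assume "n \<in> - I1" and c: "c p \<epsilon> n \<or> c p' \<epsilon> n"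
      \<comment> \<open>If \<open>G n\<close> is \<epsilon>-close to \<open>p\<close>, then
        \<epsilon> > \<epsilon>0 by monotonicity, so closeness to \<open>p'\<close> at \<epsilon>0
        carries over to \<epsilon>.\<close>
      then obtain \<epsilon>0 where "c p' \<epsilon>0 n" "\<not> c p \<epsilon>0 n" by (auto simp: I1_def)
      then show "c p' \<epsilon> n" using c mono by (meson linear)
    qed
  qed auto
qed

section \<open>Pseudo-random graphs with two blocks\<close>

text \<open>If \<open>snd x \<noteq> snd x'\<close>, then \<open>(hash P x y, hash P x' y)\<close> takes each pair of residues exactly once as \<open>y\<close>
  varies. Hence thresholding \<open>hash\<close> at \<open>t * P\<close> gives a symmetric relation with density close to \<open>t\<close> and
  nearly uncorrelated rows.\<close>

definition hash :: "int \<Rightarrow> int \<times> int \<Rightarrow> int \<times> int \<Rightarrow> int" where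
  "hash P x y = (fst x + fst y + snd x * snd y) mod P"

definition thr :: "int \<Rightarrow> real \<Rightarrow> int \<Rightarrow> real" where
  "thr P t r = (if real_of_int r < t * real_of_int P then 1 else 0) - t"

lemma thr_abs_le: "t \<in> {0..1} \<Longrightarrow> \<bar>thr P t r\<bar> \<le> 1"
  by (auto simp: thr_def)

text \<open>The number of residues below the threshold is t * P rounded up, and subtracting t once
  per residue leaves only the rounding error.\<close>

lemma sum_thr_le:
  assumes P: "0 < P" and t: "t \<in> {0..1}"
  shows "\<bar>\<Sum>r\<in>{0..<P}. thr P t r\<bar> \<le> 1"
proof -
  let ?c = "\<lceil>t * real_of_int P\<rceil>"
  have tP: "0 \<le> t * real_of_int P" "t * real_of_int P \<le> real_of_int P"
    using P t by (auto intro: mult_left_le_one_le)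
  have c: "0 \<le> ?c" "?c \<le> P" using tP by (simp_all add: ceiling_le_iff)
  have set: "{r \<in> {0..<P}. real_of_int r < t * real_of_int P} = {0..<?c}"
  proof -
    have "x < P" if "real_of_int x < t * real_of_int P" for x using that tP(2) by linarith
    then show ?thesis by (auto simp: less_ceiling_iff)
  qed
  have "(\<Sum>r\<in>{0..<P}. thr P t r) = (\<Sum>r\<in>{0..<P}. if real_of_int r < t * real_of_int P then 1 else 0) - real (nat P) * t"
    unfolding thr_def by (simp add: sum_subtractf)
  also have "(\<Sum>r\<in>{0..<P}. if real_of_int r < t * real_of_int P then 1 else 0 :: real) = real (card {0..<?c})"
    unfolding set[symmetric] by (subst sum.inter_filter[symmetric]) auto
  also have "\<dots> - real (nat P) * t = real_of_int ?c - t * real_of_int P" using c P by simp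
  finally show ?thesis by linarith
qed

text \<open>If y and z have the same image, subtracting the two congruences gives (snd x - snd x') *
  (snd y - snd z) = 0 modulo the prime P. This determines the second coordinate, and then the
  first.\<close>

lemma hash_pair_bij:
  assumes P: "prime P" and x: "snd x \<in> {0..<P}" "snd x' \<in> {0..<P}" "snd x \<noteq> snd x'"
  shows "bij_betw (\<lambda>y. (hash P x y, hash P x' y)) ({0..<P} \<times> {0..<P}) ({0..<P} \<times> {0..<P})"
proof -
  let ?E = "{0..<P} \<times> {0..<P}"
  let ?\<phi> = "\<lambda>y. (hash P x y, hash P x' y)"
  have P0: "0 < P" using P by (rule prime_gt_0_int)
  have small: "a = b" if "a \<in> {0..<P}" "b \<in> {0..<P}" "P dvd a - b" for a b
  proof -
    have "a mod P = b mod P" using that(3) by (simp add: mod_eq_dvd_iff)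
    then show ?thesis using that by simp
  qed
  have inj: "inj_on ?\<phi> ?E"
  proof (rule inj_onI)
    fix y z assume y: "y \<in> ?E" and z: "z \<in> ?E" and eq: "?\<phi> y = ?\<phi> z"
    have 1: "P dvd (fst x + fst y + snd x * snd y) - (fst x + fst z + snd x * snd z)"
      using eq by (simp add: hash_def mod_eq_dvd_iff)
    have 2: "P dvd (fst x' + fst y + snd x' * snd y) - (fst x' + fst z + snd x' * snd z)"
      using eq by (simp add: hash_def mod_eq_dvd_iff)
    have "P dvd (snd x - snd x') * (snd y - snd z)"
      using dvd_diff[OF 1 2] by (simp add: algebra_simps)
    then have "P dvd snd x - snd x' \<or> P dvd snd y - snd z" using P by (simp add: prime_dvd_mult_iff)
    then have s: "snd y = snd z" using small x y z by auto
    then have "P dvd fst y - fst z" using 1 by simp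
    then have "fst y = fst z" using small y z by auto
    then show "y = z" using s by (simp add: prod_eq_iff)
  qed
  have "?\<phi> ` ?E \<subseteq> ?E" using P0 by (auto simp: hash_def)
  then have "?\<phi> ` ?E = ?E" by (intro endo_inj_surj inj) auto
  then show ?thesis using inj by (simp add: bij_betw_def)
qed

text \<open>For different second coordinates the bijection factorizes the sum into the square of a
  single sum over residues, which is at most 1.\<close>

lemma thr_correlation:
  assumes P: "prime P" and t: "t \<in> {0..1}" and x: "snd x \<in> {0..<P}" "snd x' \<in> {0..<P}"
  shows "(\<Sum>y\<in>{0..<P} \<times> {0..<P}. thr P t (hash P x y) * thr P t (hash P x' y)) \<le>
     (if snd x = snd x' then (real_of_int P)\<^sup>2 else 1)"
proof (cases "snd x = snd x'")
  case True
  have "thr P t r * thr P t r' \<le> 1" for r r'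
  proof -
    have "\<bar>thr P t r * thr P t r'\<bar> \<le> 1" unfolding abs_mult using thr_abs_le[OF t] by (intro mult_le_one) auto
    then show ?thesis by linarith
  qed
  then have "(\<Sum>y\<in>{0..<P} \<times> {0..<P}. thr P t (hash P x y) * thr P t (hash P x' y)) \<le> (\<Sum>y\<in>{0..<P} \<times> {0..<P}. 1)"
    by (intro sum_mono)
  also have "\<dots> = (real_of_int P)\<^sup>2"
    using prime_gt_0_int[OF P] by (simp add: card_cartesian_product power2_eq_square)
  finally show ?thesis using True by simp
next
  case False
  let ?S = "\<Sum>r\<in>{0..<P}. thr P t r"
  have "(\<Sum>y\<in>{0..<P} \<times> {0..<P}. thr P t (hash P x y) * thr P t (hash P x' y)) =
      (\<Sum>y\<in>{0..<P} \<times> {0..<P}. (\<lambda>(r, r'). thr P t r * thr P t r') (hash P x y, hash P x' y))" by simp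
  also have "\<dots> = (\<Sum>(r, r')\<in>{0..<P} \<times> {0..<P}. thr P t r * thr P t r')"
    by (rule sum.reindex_bij_betw[OF hash_pair_bij[OF P x False]])
  also have "\<dots> = ?S * ?S" by (simp add: sum_product sum.cartesian_product)
  also have "\<dots> = \<bar>?S\<bar> * \<bar>?S\<bar>" by simp
  also have "\<dots> \<le> 1" using sum_thr_le[OF prime_gt_0_int[OF P] t] by (intro mult_le_one) auto
  finally show ?thesis using False by simp
qed

text \<open>Cauchy-Schwarz in y, then expansion of the square. The at most P^3 pairs x, x' with
  equal second coordinates contribute P^2 each, the at most P^4 others 1 each; with the factor P^2
  for |Y| this gives 2 * P^7, against the trivial P^8.\<close>

lemma hash_discrepancy:
  assumes P: "prime P" and t: "t \<in> {0..1}" and X: "X \<subseteq> {0..<P} \<times> {0..<P}" and Y: "Y \<subseteq> {0..<P} \<times> {0..<P}"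
  shows "(\<Sum>x\<in>X. \<Sum>y\<in>Y. thr P t (hash P x y))\<^sup>2 \<le> 2 * real_of_int P ^ 7"
proof -
  let ?E = "{0..<P} \<times> {0..<P}"
  let ?f = "\<lambda>x y. thr P t (hash P x y)"
  define p where "p = real_of_int P"
  have P1: "1 \<le> p" using prime_gt_0_int[OF P] by (simp add: p_def)
  have fin: "finite X" "finite Y" using X Y by (auto intro: finite_subset)
  have cE: "real (card ?E) = p\<^sup>2" using prime_gt_0_int[OF P] by (simp add: p_def card_cartesian_product power2_eq_square)
  have cY: "real (card Y) \<le> p\<^sup>2" unfolding cE[symmetric] using Y by (intro of_nat_mono card_mono) auto
  have "(\<Sum>x\<in>X. \<Sum>y\<in>Y. ?f x y)\<^sup>2 = (\<Sum>y\<in>Y. 1 * (\<Sum>x\<in>X. ?f x y))\<^sup>2" by (subst sum.swap) simp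
  also have "\<dots> \<le> (\<Sum>y\<in>Y. 1\<^sup>2) * (\<Sum>y\<in>Y. (\<Sum>x\<in>X. ?f x y)\<^sup>2)" by (rule Cauchy_Schwarz_ineq_sum)
  also have "\<dots> \<le> p\<^sup>2 * (\<Sum>y\<in>?E. (\<Sum>x\<in>X. ?f x y)\<^sup>2)"
    using cY Y by (intro mult_mono sum_mono2 sum_nonneg) auto
  also have "(\<Sum>y\<in>?E. (\<Sum>x\<in>X. ?f x y)\<^sup>2) = (\<Sum>y\<in>?E. \<Sum>x\<in>X. \<Sum>x'\<in>X. ?f x y * ?f x' y)"
    by (simp add: power2_eq_square sum_product)
  also have "\<dots> = (\<Sum>x\<in>X. \<Sum>x'\<in>X. \<Sum>y\<in>?E. ?f x y * ?f x' y)"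
    by (subst sum.swap, rule sum.cong[OF refl], rule sum.swap)
  also have "\<dots> \<le> (\<Sum>x\<in>X. \<Sum>x'\<in>X. if snd x = snd x' then p\<^sup>2 else 1)"
    unfolding p_def using X by (intro sum_mono thr_correlation P t) auto
  also have "\<dots> \<le> (\<Sum>x\<in>?E. \<Sum>x'\<in>?E. if snd x = snd x' then p\<^sup>2 else 1)"
  proof -
    have "(\<Sum>x'\<in>X. if snd x = snd x' then p\<^sup>2 else 1) \<le> (\<Sum>x'\<in>?E. if snd x = snd x' then p\<^sup>2 else 1)" for x :: "int \<times> int"
      using X by (intro sum_mono2) auto
    then have "(\<Sum>x\<in>X. \<Sum>x'\<in>X. if snd x = snd x' then p\<^sup>2 else 1) \<le> (\<Sum>x\<in>X. \<Sum>x'\<in>?E. if snd x = snd x' then p\<^sup>2 else 1)"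
      by (intro sum_mono)
    also have "\<dots> \<le> (\<Sum>x\<in>?E. \<Sum>x'\<in>?E. if snd x = snd x' then p\<^sup>2 else 1)"
      using X by (intro sum_mono2 sum_nonneg) auto
    finally show ?thesis .
  qed
  also have "\<dots> \<le> (\<Sum>x\<in>?E. 2 * p ^ 3)"
  proof (intro sum_mono)
    fix x :: "int \<times> int" assume "x \<in> ?E"
    then have x: "snd x \<in> {0..<P}" by auto
    have "(\<Sum>x'\<in>?E. if snd x = snd x' then p\<^sup>2 else 1) \<le> (\<Sum>x'\<in>?E. (if snd x = snd x' then p\<^sup>2 else 0) + 1)"
      by (intro sum_mono) auto
    also have "\<dots> = (\<Sum>(a, b)\<in>?E. if snd x = b then p\<^sup>2 else 0) + p\<^sup>2"
      unfolding sum.distrib case_prod_unfold cE[symmetric] by simp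
    also have "(\<Sum>(a, b)\<in>?E. if snd x = b then p\<^sup>2 else 0) = (\<Sum>a\<in>{0..<P}. \<Sum>b\<in>{0..<P}. if snd x = b then p\<^sup>2 else 0)"
      by (rule sum.cartesian_product[symmetric])
    also have "\<dots> + p\<^sup>2 = p * p\<^sup>2 + p\<^sup>2" using x prime_gt_0_int[OF P] by (simp add: p_def)
    also have "\<dots> \<le> 2 * p ^ 3"
    proof -
      have "1 * p\<^sup>2 \<le> p * p\<^sup>2" using P1 by (intro mult_right_mono) auto
      then show ?thesis by (simp add: power2_eq_square power3_eq_cube)
    qed
    finally show "(\<Sum>x'\<in>?E. if snd x = snd x' then p\<^sup>2 else 1) \<le> 2 * p ^ 3" .
  qed
  also have "\<dots> = p\<^sup>2 * (2 * p ^ 3)" using cE by simp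
  finally have "(\<Sum>x\<in>X. \<Sum>y\<in>Y. ?f x y)\<^sup>2 \<le> p\<^sup>2 * (p\<^sup>2 * (2 * p ^ 3))" by (simp add: mult_left_mono)
  also have "\<dots> = 2 * p ^ 7" by (simp add: power2_eq_square power3_eq_cube eval_nat_numeral)
  finally show ?thesis by (simp only: p_def)
qed

text \<open>The vertices \<open>x < 2 * P\<^sup>2\<close> are identified with triples of base \<open>P\<close> digits; the leading digit \<open>blk P x\<close> is
  0 or 1.\<close>

definition blk :: "nat \<Rightarrow> nat \<Rightarrow> nat" where "blk P x = x div P div P"

definition coords :: "nat \<Rightarrow> nat \<Rightarrow> int \<times> int" where "coords P x = (int (x mod P), int (x div P mod P))"

definition blk_weight :: "nat \<Rightarrow> real \<Rightarrow> real \<Rightarrow> real \<Rightarrow> nat \<Rightarrow> nat \<Rightarrow> real" where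
  "blk_weight P u v s x y = (if blk P x = 0 \<and> blk P y = 0 then u else if blk P x \<noteq> 0 \<and> blk P y \<noteq> 0 then v else s)"

text \<open>Both blocks carry the same hash coordinates; only the threshold depends on the blocks,
  so all four block pairs reduce to one discrepancy estimate.\<close>

definition blk_graph :: "nat \<Rightarrow> real \<Rightarrow> real \<Rightarrow> real \<Rightarrow> ugraph" where
  "blk_graph P u v s = \<lparr>verts = {..<2 * P\<^sup>2},
     edges = {{x, y} | x y. x < 2 * P\<^sup>2 \<and> y < 2 * P\<^sup>2 \<and> x \<noteq> y \<and>
       real_of_int (hash (int P) (coords P x) (coords P y)) < blk_weight P u v s x y * real P}\<rparr>"

lemma blk_weight_sym: "blk_weight P u v s x y = blk_weight P u v s y x"
  by (auto simp: blk_weight_def)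

lemma hash_sym: "hash P x y = hash P y x"
  by (simp add: hash_def algebra_simps)

lemma simple_blk_graph: "simple_graph (blk_graph P u v s)"
  by (auto simp: simple_graph_def blk_graph_def)

lemma num_verts_blk_graph: "num_verts (blk_graph P u v s) = 2 * P\<^sup>2"
  by (simp add: num_verts_def blk_graph_def)

lemma adj_blk_graph:
  assumes "x < 2 * P\<^sup>2" "y < 2 * P\<^sup>2"
  shows "adj (blk_graph P u v s) x y - blk_weight P u v s x y =
    thr (int P) (blk_weight P u v s x y) (hash (int P) (coords P x) (coords P y)) +
    (if x = y then - (if real_of_int (hash (int P) (coords P x) (coords P y)) < blk_weight P u v s x y * real P then 1 else 0) else 0)"
proof -
  have "{x, y} \<in> edges (blk_graph P u v s) \<longleftrightarrow> x \<noteq> y \<and>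
     real_of_int (hash (int P) (coords P x) (coords P y)) < blk_weight P u v s x y * real P"
    using assms by (auto simp: blk_graph_def doubleton_eq_iff blk_weight_sym hash_sym)
  then show ?thesis by (simp add: adj_def thr_def)
qed

lemma blk_eq_0_iff: "0 < P \<Longrightarrow> blk P x = 0 \<longleftrightarrow> x < P\<^sup>2"
  by (simp add: blk_def power2_eq_square div_eq_0_iff flip: div_mult2_eq)

lemma blk_le_1:
  assumes "0 < P" "x < 2 * P\<^sup>2" shows "blk P x \<le> 1"
proof -
  have "x div P\<^sup>2 < 2" using assms by (simp add: div_less_iff_less_mult)
  then show ?thesis by (simp add: blk_def power2_eq_square div_mult2_eq)
qed

lemma coords_inj:
  assumes "blk P x = blk P y" "coords P x = coords P y" shows "x = y"
proof -
  have 1: "x mod P = y mod P" "x div P mod P = y div P mod P" using assms(2) by (auto simp: coords_def)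
  have "x div P = x div P div P * P + x div P mod P" by simp
  also have "\<dots> = y div P div P * P + y div P mod P" using assms(1) 1 by (simp only: blk_def)
  also have "\<dots> = y div P" by simp
  finally have 2: "x div P = y div P" .
  have "x = x div P * P + x mod P" by simp
  also have "\<dots> = y div P * P + y mod P" by (simp only: 1 2)
  also have "\<dots> = y" by simp
  finally show ?thesis .
qed

lemma coords_range: "0 < P \<Longrightarrow> coords P x \<in> {0..<int P} \<times> {0..<int P}"
  by (simp add: coords_def)

text \<open>Within one block the coordinates determine the vertex, so the sum is one over subsets of
  the P by P grid.\<close>

lemma blk_discrepancy:
  assumes P: "prime P" and t: "t \<in> {0..1}"
    and X: "\<And>x. x \<in> X \<Longrightarrow> blk P x = a" and Y: "\<And>y. y \<in> Y \<Longrightarrow> blk P y = b"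
  shows "\<bar>\<Sum>x\<in>X. \<Sum>y\<in>Y. thr (int P) t (hash (int P) (coords P x) (coords P y))\<bar> \<le> 3 / 2 * sqrt P ^ 7"
proof -
  have P0: "0 < P" using P by (rule prime_gt_0_nat)
  have inj: "inj_on (coords P) X" "inj_on (coords P) Y"
    by (rule inj_onI, rule coords_inj[of P], simp_all add: X Y)+
  have "(\<Sum>x\<in>X. \<Sum>y\<in>Y. thr (int P) t (hash (int P) (coords P x) (coords P y))) =
     (\<Sum>x\<in>coords P ` X. \<Sum>y\<in>coords P ` Y. thr (int P) t (hash (int P) x y))" (is "?S = _")
    by (simp add: sum.reindex[OF inj(1)] sum.reindex[OF inj(2)])
  then have "?S\<^sup>2 \<le> 2 * real P ^ 7"
    using hash_discrepancy[of "int P" t "coords P ` X" "coords P ` Y"] P t coords_range[OF P0] by auto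
  also have "real P ^ 7 = (sqrt P ^ 7)\<^sup>2"
  proof -
    have "(sqrt P ^ 7)\<^sup>2 = ((sqrt P)\<^sup>2) ^ 7" unfolding power_mult[symmetric] by simp
    then show ?thesis by simp
  qed
  \<comment> \<open>The constant 3/2 is a rational upper bound for the square root of 2.\<close>
  also have "2 * (sqrt P ^ 7)\<^sup>2 \<le> (3 / 2 * sqrt P ^ 7)\<^sup>2" by (simp add: power2_eq_square)
  finally have "\<bar>?S\<bar> \<le> \<bar>3 / 2 * sqrt P ^ 7\<bar>" unfolding abs_le_square_iff .
  then show ?thesis by simp
qed

text \<open>With q the square root of P, the four block pairs contribute at most 3/2 * q^7 each and
  the missing loops at most 2 * q^7. The total 8 * q^7 is 2 / q times the squared order 4 *
  q^8.\<close>

lemma cut_close_blk_graph: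
  assumes P: "prime P" and uvs: "u \<in> {0..1}" "v \<in> {0..1}" "s \<in> {0..1}"
  shows "cut_close (blk_graph P u v s) (blk_weight P u v s) (2 / sqrt P)"
  unfolding cut_close_def
proof (intro allI impI)
  fix X Y assume X: "X \<subseteq> verts (blk_graph P u v s)" and Y: "Y \<subseteq> verts (blk_graph P u v s)"
  define q where "q = sqrt (real P)"
  have P0: "0 < P" using P by (rule prime_gt_0_nat)
  have q1: "1 \<le> q" using P0 by (simp add: q_def)
  have qP: "real P = q\<^sup>2" by (simp add: q_def)
  have lt: "x < 2 * P\<^sup>2" if "x \<in> X \<union> Y" for x using X Y that by (auto simp: blk_graph_def)
  have fin: "finite X" "finite Y" using X Y by (auto simp: blk_graph_def intro: finite_subset)
  have blk01: "blk P x = 0 \<or> blk P x = 1" if "x \<in> X \<union> Y" for x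
    using blk_le_1[OF P0 lt[OF that]] by linarith
  define B where "B Z a = {x \<in> Z. blk P x = a}" for Z a
  have split: "(\<Sum>x\<in>Z. \<phi> x) = (\<Sum>x\<in>B Z 0. \<phi> x) + (\<Sum>x\<in>B Z 1. \<phi> x)" if "Z \<subseteq> X \<union> Y" for Z and \<phi> :: "nat \<Rightarrow> real"
  proof -
    have "finite Z" using that fin finite_subset by blast
    moreover have "Z = B Z 0 \<union> B Z 1" using blk01 that by (auto simp: B_def)
    moreover have "B Z 0 \<inter> B Z 1 = {}" by (auto simp: B_def)
    ultimately show ?thesis by (metis sum.union_disjoint finite_Un)
  qed
  let ?f = "\<lambda>x y. thr (int P) (blk_weight P u v s x y) (hash (int P) (coords P x) (coords P y))"
  let ?g = "\<lambda>x y. if x = y then - (if real_of_int (hash (int P) (coords P x) (coords P y)) < blk_weight P u v s x y * real P then 1 else 0) else (0::real)"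
  define t where "t a b = (if a = 0 \<and> b = 0 then u else if a \<noteq> 0 \<and> b \<noteq> 0 then v else s)" for a b :: nat
  have part: "\<bar>\<Sum>x\<in>B X a. \<Sum>y\<in>B Y b. ?f x y\<bar> \<le> 3 / 2 * q ^ 7" for a b
  proof -
    have "(\<Sum>x\<in>B X a. \<Sum>y\<in>B Y b. ?f x y) = (\<Sum>x\<in>B X a. \<Sum>y\<in>B Y b. thr (int P) (t a b) (hash (int P) (coords P x) (coords P y)))"
      by (intro sum.cong refl) (simp add: B_def blk_weight_def t_def)
    moreover have "t a b \<in> {0..1}" using uvs by (simp add: t_def)
    ultimately show ?thesis unfolding q_def using P by (simp only:) (intro blk_discrepancy, auto simp: B_def)
  qed
  have "(\<Sum>x\<in>X. \<Sum>y\<in>Y. adj (blk_graph P u v s) x y - blk_weight P u v s x y) = (\<Sum>x\<in>X. \<Sum>y\<in>Y. ?f x y + ?g x y)"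
    using lt by (intro sum.cong refl adj_blk_graph) auto
  also have "\<dots> = (\<Sum>x\<in>X. \<Sum>y\<in>Y. ?f x y) + (\<Sum>x\<in>X. \<Sum>y\<in>Y. ?g x y)" by (simp only: sum.distrib)
  finally have eq: "(\<Sum>x\<in>X. \<Sum>y\<in>Y. adj (blk_graph P u v s) x y - blk_weight P u v s x y) = (\<Sum>x\<in>X. \<Sum>y\<in>Y. ?f x y) + (\<Sum>x\<in>X. \<Sum>y\<in>Y. ?g x y)" .
  have "\<bar>\<Sum>x\<in>X. \<Sum>y\<in>Y. ?g x y\<bar> \<le> card X" using fin by (intro sum_diag_le) auto
  also have "\<dots> \<le> 2 * q ^ 4"
  proof -
    have "card X \<le> card {..<2 * P\<^sup>2}" using lt by (intro card_mono) auto
    then have "real (card X) \<le> real (2 * P\<^sup>2)" by (simp only: card_lessThan of_nat_mono)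
    then show ?thesis by (simp add: qP flip: power_mult)
  qed
  also have "\<dots> \<le> 2 * q ^ 7" using q1 by (simp add: power_increasing)
  finally have G: "\<bar>\<Sum>x\<in>X. \<Sum>y\<in>Y. ?g x y\<bar> \<le> 2 * q ^ 7" .
  have "(\<Sum>x\<in>X. \<Sum>y\<in>Y. ?f x y) =
     (\<Sum>x\<in>B X 0. \<Sum>y\<in>B Y 0. ?f x y) + (\<Sum>x\<in>B X 0. \<Sum>y\<in>B Y 1. ?f x y) +
     ((\<Sum>x\<in>B X 1. \<Sum>y\<in>B Y 0. ?f x y) + (\<Sum>x\<in>B X 1. \<Sum>y\<in>B Y 1. ?f x y))"
    unfolding split[OF Un_upper1] split[OF Un_upper2] by (simp only: sum.distrib)
  then have "\<bar>\<Sum>x\<in>X. \<Sum>y\<in>Y. ?f x y\<bar> \<le> 6 * q ^ 7"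
    using part[of 0 0] part[of 0 1] part[of 1 0] part[of 1 1] by linarith
  then have "\<bar>\<Sum>x\<in>X. \<Sum>y\<in>Y. adj (blk_graph P u v s) x y - blk_weight P u v s x y\<bar> \<le> 8 * q ^ 7"
    unfolding eq using G by linarith
  also have "8 * q ^ 7 = 2 / q * (real (num_verts (blk_graph P u v s)))\<^sup>2"
    using q1 by (simp add: num_verts_blk_graph qP power2_eq_square eval_nat_numeral field_simps)
  finally show "\<bar>\<Sum>x\<in>X. \<Sum>y\<in>Y. adj (blk_graph P u v s) x y - blk_weight P u v s x y\<bar> \<le>
     2 / sqrt P * (real (num_verts (blk_graph P u v s)))\<^sup>2" by (simp only: q_def)
qed

section \<open>Hereditary induced counts in the block graphs\<close>

lemma sum_PiE_permute:
  assumes s: "\<sigma> permutes V"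
  shows "(\<Sum>x\<in>PiE V (\<lambda>_. U). \<phi> (\<lambda>i. x (\<sigma> i))) = (\<Sum>x\<in>PiE V (\<lambda>_. U). \<phi> x)"
proof (rule sum.reindex_bij_witness[of _ "\<lambda>x i. x (inv \<sigma> i)" "\<lambda>x i. x (\<sigma> i)"])
  have inv: "inv \<sigma> permutes V" using s by (rule permutes_inv)
  have mem: "(\<lambda>i. x (\<tau> i)) \<in> PiE V (\<lambda>_. U)" if "\<tau> permutes V" "x \<in> PiE V (\<lambda>_. U)" for \<tau> x
  proof (rule PiE_I)
    show "x (\<tau> i) \<in> U" if "i \<in> V" for i
      using PiE_mem[OF \<open>x \<in> PiE V (\<lambda>_. U)\<close>] permutes_in_image[OF \<open>\<tau> permutes V\<close>] that by blast
    show "x (\<tau> i) = undefined" if "i \<notin> V" for i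
      using PiE_arb[OF \<open>x \<in> PiE V (\<lambda>_. U)\<close> that] permutes_not_in[OF \<open>\<tau> permutes V\<close> that] by simp
  qed
  show "(\<lambda>i. x (\<sigma> i)) \<in> PiE V (\<lambda>_. U)" if "x \<in> PiE V (\<lambda>_. U)" for x using mem[OF s that] .
  show "(\<lambda>i. x (inv \<sigma> i)) \<in> PiE V (\<lambda>_. U)" if "x \<in> PiE V (\<lambda>_. U)" for x using mem[OF inv that] .
qed (simp_all add: permutes_inverses[OF s])

text \<open>Permuting coordinates is a bijection of the tuples over a single set \<open>U\<close>,
  so counts inside \<open>U\<close> see only the symmetrized density.\<close>

lemma sum_pat_eq_sum_sym_pat:
  assumes V: "finite (verts F)"
  shows "(\<Sum>x\<in>PiE (verts F) (\<lambda>_. U). pat F (\<lambda>i j. W (x i) (x j))) =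
     (\<Sum>x\<in>PiE (verts F) (\<lambda>_. U). sym_pat F (\<lambda>i j. W (x i) (x j)))"
proof -
  let ?\<phi> = "\<lambda>x. pat F (\<lambda>i j. W (x i) (x j))"
  have "(\<Sum>x\<in>PiE (verts F) (\<lambda>_. U). sym_pat F (\<lambda>i j. W (x i) (x j))) =
      (\<Sum>\<sigma> | \<sigma> permutes verts F. \<Sum>x\<in>PiE (verts F) (\<lambda>_. U). ?\<phi> (\<lambda>i. x (\<sigma> i))) / fact (num_verts F)"
    unfolding sym_pat_def by (subst sum.swap) (simp add: sum_divide_distrib)
  also have "(\<Sum>\<sigma> | \<sigma> permutes verts F. \<Sum>x\<in>PiE (verts F) (\<lambda>_. U). ?\<phi> (\<lambda>i. x (\<sigma> i))) =
      (\<Sum>\<sigma> | \<sigma> permutes verts F. \<Sum>x\<in>PiE (verts F) (\<lambda>_. U). ?\<phi> x)"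
  proof (rule sum.cong[OF refl])
    fix \<sigma> assume "\<sigma> \<in> {\<sigma>. \<sigma> permutes verts F}"
    then have "\<sigma> permutes verts F" by simp
    then show "(\<Sum>x\<in>PiE (verts F) (\<lambda>_. U). ?\<phi> (\<lambda>i. x (\<sigma> i))) = (\<Sum>x\<in>PiE (verts F) (\<lambda>_. U). ?\<phi> x)"
      by (rule sum_PiE_permute[where \<phi> = ?\<phi>])
  qed
  also have "\<dots> / fact (num_verts F) = (\<Sum>x\<in>PiE (verts F) (\<lambda>_. U). ?\<phi> x)"
    using V by (simp add: card_permutations num_verts_def)
  finally show ?thesis ..
qed

lemma one_le_blk_error:
  assumes "prime P"
  shows "1 \<le> 2 / sqrt P * real (num_verts (blk_graph P u v s))"
proof -
  have P1: "1 \<le> real P" using prime_gt_0_nat[OF assms] by simp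
  have "sqrt P \<le> real P" using P1 by (intro real_le_lsqrt) (auto simp: power2_eq_square)
  also have "\<dots> \<le> 2 * (2 * (real P)\<^sup>2)" using P1 by (simp add: power2_eq_square)
  finally show ?thesis using P1 by (simp add: num_verts_blk_graph field_simps)
qed

text \<open>At every tuple the block weights form a two-type array with symmetrized density exactly
  \<open>beta F p\<close>. Only the error of the cut approximation remains.\<close>

lemma blk_graph_hereditary:
  assumes F: "simple_graph F" and uvs: "u \<in> {0..1}" "v \<in> {0..1}" "s \<in> {0..1}"
    and uv: "beta F u = beta F p" "beta F v = beta F p"
    and Q: "\<And>j. j \<in> {1..num_verts F - 1} \<Longrightarrow> Q F j u v s = real (num_verts F choose j) * beta F p"
    and P: "prime P" and U: "U \<subseteq> verts (blk_graph P u v s)"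
  shows "\<bar>real (ind_embs_into F (blk_graph P u v s) U) - beta F p * real (card U) ^ num_verts F\<bar> \<le>
     (real (num_verts F))\<^sup>2 * (2 * (2 / sqrt P)) * real (num_verts (blk_graph P u v s)) ^ num_verts F"
proof -
  have fin: "finite (verts F)" using F by (simp add: simple_graph_def)
  have sp: "sym_pat F (\<lambda>i j. blk_weight P u v s (x i) (x j)) = beta F p" for x
  proof -
    have "sym_pat F (\<lambda>i j. blk_weight P u v s (x i) (x j)) = sym_pat F (two_type {i \<in> verts F. blk P (x i) = 0} u v s)"
      by (intro sym_pat_cong) (auto simp: blk_weight_def two_type_def)
    also have "\<dots> = beta F p" using F uv Q by (intro sym_pat_two_type_eq_beta) auto
    finally show ?thesis .
  qed
  have "(\<Sum>x\<in>PiE (verts F) (\<lambda>_. U). pat F (\<lambda>i j. blk_weight P u v s (x i) (x j))) = beta F p * real (card U) ^ num_verts F"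
    unfolding sum_pat_eq_sum_sym_pat[OF fin] sp using fin by (simp add: card_funcsetE num_verts_def)
  moreover note one_le_blk_error[OF P, of u v s]
  ultimately show ?thesis
    using ind_embs_into_approx[OF simple_blk_graph fin cut_close_blk_graph[OF P uvs] _ _ _ U] uvs
    by (simp add: blk_weight_def)
qed

lemma sum_blk:
  fixes f :: "nat \<Rightarrow> real"
  assumes P: "0 < P"
  shows "(\<Sum>x<2 * P\<^sup>2. f (blk P x)) = (real P)\<^sup>2 * (f 0 + f 1)"
proof -
  have un: "{..<2 * P\<^sup>2} = {..<P\<^sup>2} \<union> {P\<^sup>2..<2 * P\<^sup>2}" by auto
  have "(\<Sum>x<2 * P\<^sup>2. f (blk P x)) = (\<Sum>x<P\<^sup>2. f (blk P x)) + (\<Sum>x\<in>{P\<^sup>2..<2 * P\<^sup>2}. f (blk P x))"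
    unfolding un by (rule sum.union_disjoint) auto
  also have "(\<Sum>x<P\<^sup>2. f (blk P x)) = (\<Sum>x<P\<^sup>2. f 0)"
  proof (intro sum.cong refl)
    fix x assume "x \<in> {..<P\<^sup>2}"
    then have "blk P x = 0" unfolding blk_eq_0_iff[OF P] by simp
    then show "f (blk P x) = f 0" by simp
  qed
  also have "(\<Sum>x\<in>{P\<^sup>2..<2 * P\<^sup>2}. f (blk P x)) = (\<Sum>x\<in>{P\<^sup>2..<2 * P\<^sup>2}. f 1)"
  proof (intro sum.cong refl)
    fix x assume "x \<in> {P\<^sup>2..<2 * P\<^sup>2}"
    then have "blk P x \<noteq> 0" "blk P x \<le> 1" unfolding blk_eq_0_iff[OF P] using blk_le_1[OF P, of x] by auto
    then have "blk P x = 1" by linarith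
    then show "f (blk P x) = f 1" by simp
  qed
  finally show ?thesis by (simp add: algebra_simps)
qed

lemma verts_blk_graph: "verts (blk_graph P u v s) = {..<2 * P\<^sup>2}"
  by (simp add: blk_graph_def)

section \<open>Homomorphism densities of the block graphs along a subsequence\<close>

definition next_prime :: "nat \<Rightarrow> nat" where "next_prime n = (SOME p. prime p \<and> n < p)"

lemma next_prime: "prime (next_prime n)" "n < next_prime n"
  using someI_ex[OF bigger_prime[of n]] unfolding next_prime_def by auto

lemma next_prime_at_top:
  assumes "\<And>n. n \<le> r n"
  shows "filterlim (\<lambda>n. next_prime (r n)) at_top sequentially"
proof (rule filterlim_at_top_mono[OF filterlim_ident])
  show "\<forall>\<^sub>F n in sequentially. n \<le> next_prime (r n)"
    using assms next_prime(2) by (intro always_eventually allI) (meson less_imp_le order_trans)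
qed

lemma div_sqrt_next_prime_tendsto:
  assumes "\<And>n. n \<le> r n"
  shows "(\<lambda>n. c / sqrt (next_prime (r n))) \<longlonglongrightarrow> 0"
proof (rule tendsto_divide_0[OF tendsto_const])
  have "filterlim (\<lambda>n. real (next_prime (r n))) at_top sequentially"
    by (rule filterlim_compose[OF filterlim_real_sequentially next_prime_at_top[OF assms]])
  then have "filterlim (\<lambda>n. sqrt (real (next_prime (r n)))) at_top sequentially"
    by (rule filterlim_compose[OF sqrt_at_top])
  then show "filterlim (\<lambda>n. sqrt (real (next_prime (r n)))) at_infinity sequentially"
    by (rule filterlim_at_top_imp_at_infinity)
qed

text \<open>Here \<open>t\<close> is the density of \<open>H\<close> in the two-block weights. The
  normalized counts tend to \<open>t\<close> by cut closeness and to \<open>q ^ num_edges H\<close>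
  by quasi-randomness.\<close>

lemma blk_hom_density:
  assumes uvs: "u \<in> {0..1}" "v \<in> {0..1}" "s \<in> {0..1}" and H: "simple_graph H"
    and r: "strict_mono r" and qr: "quasi_random q ((\<lambda>n. blk_graph (next_prime n) u v s) \<circ> r)"
    and t: "\<And>P. 0 < P \<Longrightarrow> (\<Sum>x\<in>PiE (verts H) (\<lambda>_. {..<2 * P\<^sup>2}).
        \<Prod>e\<in>pairs (verts H). if {fst e, snd e} \<in> edges H then blk_weight P u v s (x (fst e)) (x (snd e)) else 1) =
        t * (2 * (real P)\<^sup>2) ^ num_verts H"
  shows "t = q ^ num_edges H"
proof -
  let ?h = "num_verts H"
  define G where "G n = blk_graph (next_prime (r n)) u v s" for n
  define N where "N n = real (num_verts (G n))" for n
  have N: "N n = 2 * (real (next_prime (r n)))\<^sup>2" for n by (simp add: N_def G_def num_verts_blk_graph)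
  have N0: "0 < N n" for n using prime_gt_0_nat[OF next_prime(1)] by (simp add: N)
  have "(\<lambda>n. real (inj_homs H (G n)) - q ^ num_edges H * N n ^ ?h) \<in> o(\<lambda>n. N n ^ ?h)"
    using qr H unfolding quasi_random_def G_def N_def o_def by blast
  then have 1: "(\<lambda>n. (real (inj_homs H (G n)) - q ^ num_edges H * N n ^ ?h) / N n ^ ?h) \<longlonglongrightarrow> 0"
    by (rule smalloD_tendsto)
  have 2: "(\<lambda>n. (real (inj_homs H (G n)) - t * N n ^ ?h) / N n ^ ?h) \<longlonglongrightarrow> 0"
  proof (rule Lim_null_comparison[OF _ div_sqrt_next_prime_tendsto])
    show "n \<le> r n" for n by (rule seq_suble[OF r])
    show "\<forall>\<^sub>F n in sequentially. norm ((real (inj_homs H (G n)) - t * N n ^ ?h) / N n ^ ?h) \<le>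
        ((real ?h)\<^sup>2 * 4) / sqrt (next_prime (r n))"
    proof (intro always_eventually allI)
      fix n
      let ?P = "next_prime (r n)"
      have "\<bar>real (inj_homs H (G n)) - t * N n ^ ?h\<bar> \<le> (real ?h)\<^sup>2 * (2 * (2 / sqrt ?P)) * N n ^ ?h"
      proof -
        have w01: "blk_weight ?P u v s x y \<in> {0..1}" for x y using uvs by (simp add: blk_weight_def)
        have vG: "verts (G n) = {..<2 * ?P\<^sup>2}" by (simp add: G_def verts_blk_graph)
        have "0 \<le> 2 / sqrt ?P" by simp
        from inj_homs_approx[OF simple_blk_graph H cut_close_blk_graph[OF next_prime(1)[of "r n"] uvs]
          one_le_blk_error[OF next_prime(1)[of "r n"]] this w01]
        show ?thesis
          unfolding G_def[symmetric] N_def[symmetric] vG t[OF prime_gt_0_nat[OF next_prime(1)[of "r n"]]] N[symmetric] .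
      qed
      then have "\<bar>real (inj_homs H (G n)) - t * N n ^ ?h\<bar> / N n ^ ?h \<le> (real ?h)\<^sup>2 * (2 * (2 / sqrt ?P))"
        using N0[of n] by (simp add: pos_divide_le_eq)
      then show "norm ((real (inj_homs H (G n)) - t * N n ^ ?h) / N n ^ ?h) \<le> ((real ?h)\<^sup>2 * 4) / sqrt ?P"
        using N0[of n] by (simp add: abs_divide)
    qed
  qed
  have "(\<lambda>n. t - q ^ num_edges H) \<longlonglongrightarrow> 0 - 0"
  proof (rule Lim_transform_eventually[OF tendsto_diff[OF 1 2]])
    show "\<forall>\<^sub>F n in sequentially. (real (inj_homs H (G n)) - q ^ num_edges H * N n ^ ?h) / N n ^ ?h -
        (real (inj_homs H (G n)) - t * N n ^ ?h) / N n ^ ?h = t - q ^ num_edges H"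
    proof (intro always_eventually allI)
      fix n
      have "N n ^ ?h \<noteq> 0" using N0[of n] by simp
      then show "(real (inj_homs H (G n)) - q ^ num_edges H * N n ^ ?h) / N n ^ ?h -
        (real (inj_homs H (G n)) - t * N n ^ ?h) / N n ^ ?h = t - q ^ num_edges H"
        by (simp add: diff_divide_distrib)
    qed
  qed
  then show ?thesis by (simp add: LIMSEQ_const_iff)
qed

lemma pairs_2_3: "pairs {0, 1} = {(0, 1)}" "pairs {0, 1, 2} = {(0, 1), (0, 2), (1, 2)}"
  by (auto simp: pairs_def)

lemma sum_PiE_2: "(\<Sum>x\<in>PiE {0, 1 :: nat} (\<lambda>_. V). f (x 0) (x 1)) = (\<Sum>a\<in>V. \<Sum>b\<in>V. f a b)"
  by (subst sum.swap) (simp add: sum_PiE_insert)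

lemma sum_PiE_3:
  "(\<Sum>x\<in>PiE {0, 1, 2 :: nat} (\<lambda>_. V). f (x 0) (x 1) (x 2)) = (\<Sum>a\<in>V. \<Sum>b\<in>V. \<Sum>c\<in>V. f c b a)"
  by (simp add: sum_PiE_insert)

text \<open>A single edge gives the mean and the path with two edges the second moment of the
  degrees (u + s) / 2 and (v + s) / 2, so equality of these degrees follows from zero variance. Then
  the triangle sees the remaining eigenvalue (v - s) / 2.\<close>

lemma blk_quasi_random_imp_const:
  assumes uvs: "u \<in> {0..1}" "v \<in> {0..1}" "s \<in> {0..1}"
    and r: "strict_mono r" and qr: "quasi_random q ((\<lambda>n. blk_graph (next_prime n) u v s) \<circ> r)"
  shows "u = v \<and> v = s"
proof -
  define M where "M a b = (if a = 0 \<and> b = 0 then u else if a \<noteq> 0 \<and> b \<noteq> 0 then v else s)" for a b :: nat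
  have w: "blk_weight P u v s x y = M (blk P x) (blk P y)" for P x y by (simp add: blk_weight_def M_def)
  have s3: "(\<Sum>a<2 * P\<^sup>2. \<Sum>b<2 * P\<^sup>2. \<Sum>c<2 * P\<^sup>2. g (blk P a) (blk P b) (blk P c)) =
     (real P)\<^sup>2 * ((real P)\<^sup>2 * ((real P)\<^sup>2 * (g 0 0 0 + g 0 0 1) + (real P)\<^sup>2 * (g 0 1 0 + g 0 1 1)) +
       (real P)\<^sup>2 * ((real P)\<^sup>2 * (g 1 0 0 + g 1 0 1) + (real P)\<^sup>2 * (g 1 1 0 + g 1 1 1)))"
    if "0 < P" for P and g :: "nat \<Rightarrow> nat \<Rightarrow> nat \<Rightarrow> real"
    using sum_blk[OF that, of "\<lambda>a. \<Sum>b<2 * P\<^sup>2. \<Sum>c<2 * P\<^sup>2. g a (blk P b) (blk P c)"]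
      sum_blk[OF that, of "\<lambda>b. \<Sum>c<2 * P\<^sup>2. g 0 b (blk P c)"] sum_blk[OF that, of "\<lambda>b. \<Sum>c<2 * P\<^sup>2. g 1 b (blk P c)"]
      sum_blk[OF that, of "\<lambda>c. g 0 0 c"] sum_blk[OF that, of "\<lambda>c. g 0 1 c"]
      sum_blk[OF that, of "\<lambda>c. g 1 0 c"] sum_blk[OF that, of "\<lambda>c. g 1 1 c"] by simp
  have s2: "(\<Sum>a<2 * P\<^sup>2. \<Sum>b<2 * P\<^sup>2. g (blk P a) (blk P b)) =
     (real P)\<^sup>2 * ((real P)\<^sup>2 * (g 0 0 + g 0 1) + (real P)\<^sup>2 * (g 1 0 + g 1 1))"
    if "0 < P" for P and g :: "nat \<Rightarrow> nat \<Rightarrow> real"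
    using sum_blk[OF that, of "\<lambda>a. \<Sum>b<2 * P\<^sup>2. g a (blk P b)"]
      sum_blk[OF that, of "\<lambda>b. g 0 b"] sum_blk[OF that, of "\<lambda>b. g 1 b"] by simp
  have e1: "(u + v + 2 * s) / 4 = q"
  proof -
    define H where "H = \<lparr>verts = {0, 1 :: nat}, edges = {{0, 1}}\<rparr>"
    have sH: "simple_graph H" by (auto simp: H_def simple_graph_def nsets_def)
    have "(u + v + 2 * s) / 4 = q ^ num_edges H"
    proof (rule blk_hom_density[OF uvs sH r qr])
      fix P :: nat assume P: "0 < P"
      have "(\<Sum>x\<in>PiE (verts H) (\<lambda>_. {..<2 * P\<^sup>2}).
        \<Prod>e\<in>pairs (verts H). if {fst e, snd e} \<in> edges H then blk_weight P u v s (x (fst e)) (x (snd e)) else 1) =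
          (\<Sum>x\<in>PiE {0, 1 :: nat} (\<lambda>_. {..<2 * P\<^sup>2}). (\<lambda>a b. M (blk P a) (blk P b)) (x 0) (x 1))"
        unfolding H_def ugraph.simps pairs_2_3 by (rule sum.cong[OF refl]) (simp add: w doubleton_eq_iff)
      also have "\<dots> = (\<Sum>a<2 * P\<^sup>2. \<Sum>b<2 * P\<^sup>2. (\<lambda>a b. M a b) (blk P a) (blk P b))"
        by (rule sum_PiE_2[where f = "\<lambda>a b. M (blk P a) (blk P b)"])
      also note s2[OF P, of "\<lambda>a b. M a b"]
      finally show "(\<Sum>x\<in>PiE (verts H) (\<lambda>_. {..<2 * P\<^sup>2}).
        \<Prod>e\<in>pairs (verts H). if {fst e, snd e} \<in> edges H then blk_weight P u v s (x (fst e)) (x (snd e)) else 1) =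
        (u + v + 2 * s) / 4 * (2 * (real P)\<^sup>2) ^ num_verts H"
        by (simp only:) (simp add: H_def num_verts_def M_def power2_eq_square power3_eq_cube field_simps)
    qed
    then show ?thesis by (simp add: H_def num_edges_def)
  qed
  have e2: "((u + s)\<^sup>2 + (v + s)\<^sup>2) / 8 = q\<^sup>2"
  proof -
    define H where "H = \<lparr>verts = {0, 1, 2 :: nat}, edges = {{0, 1}, {0, 2}}\<rparr>"
    have sH: "simple_graph H" by (auto simp: H_def simple_graph_def nsets_def)
    have "((u + s)\<^sup>2 + (v + s)\<^sup>2) / 8 = q ^ num_edges H"
    proof (rule blk_hom_density[OF uvs sH r qr])
      fix P :: nat assume P: "0 < P"
      have "(\<Sum>x\<in>PiE (verts H) (\<lambda>_. {..<2 * P\<^sup>2}).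
        \<Prod>e\<in>pairs (verts H). if {fst e, snd e} \<in> edges H then blk_weight P u v s (x (fst e)) (x (snd e)) else 1) =
          (\<Sum>x\<in>PiE {0, 1, 2 :: nat} (\<lambda>_. {..<2 * P\<^sup>2}). (\<lambda>a b c. M (blk P a) (blk P b) * M (blk P a) (blk P c)) (x 0) (x 1) (x 2))"
        unfolding H_def ugraph.simps pairs_2_3 by (rule sum.cong[OF refl]) (simp add: w doubleton_eq_iff)
      \<comment> \<open>\<open>sum_PiE_3\<close> puts the sum over the last coordinate outermost,
        hence the reversed arguments.\<close>
      also have "\<dots> = (\<Sum>a<2 * P\<^sup>2. \<Sum>b<2 * P\<^sup>2. \<Sum>c<2 * P\<^sup>2. (\<lambda>c b a. M a b * M a c) (blk P a) (blk P b) (blk P c))"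
        by (rule sum_PiE_3[where f = "\<lambda>a b c. M (blk P a) (blk P b) * M (blk P a) (blk P c)"])
      also note s3[OF P, of "\<lambda>c b a. M a b * M a c"]
      finally show "(\<Sum>x\<in>PiE (verts H) (\<lambda>_. {..<2 * P\<^sup>2}).
        \<Prod>e\<in>pairs (verts H). if {fst e, snd e} \<in> edges H then blk_weight P u v s (x (fst e)) (x (snd e)) else 1) =
        ((u + s)\<^sup>2 + (v + s)\<^sup>2) / 8 * (2 * (real P)\<^sup>2) ^ num_verts H"
        by (simp only:) (simp add: H_def num_verts_def M_def power2_eq_square power3_eq_cube field_simps)
    qed
    moreover have "num_edges H = 2" by (simp add: H_def num_edges_def doubleton_eq_iff)
    ultimately show ?thesis by (simp only:)
  qed
  have e3: "(u ^ 3 + v ^ 3 + 3 * u * s\<^sup>2 + 3 * v * s\<^sup>2) / 8 = q ^ 3"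
  proof -
    define H where "H = \<lparr>verts = {0, 1, 2 :: nat}, edges = {{0, 1}, {0, 2}, {1, 2}}\<rparr>"
    have sH: "simple_graph H" by (auto simp: H_def simple_graph_def nsets_def)
    have "(u ^ 3 + v ^ 3 + 3 * u * s\<^sup>2 + 3 * v * s\<^sup>2) / 8 = q ^ num_edges H"
    proof (rule blk_hom_density[OF uvs sH r qr])
      fix P :: nat assume P: "0 < P"
      have "(\<Sum>x\<in>PiE (verts H) (\<lambda>_. {..<2 * P\<^sup>2}).
        \<Prod>e\<in>pairs (verts H). if {fst e, snd e} \<in> edges H then blk_weight P u v s (x (fst e)) (x (snd e)) else 1) =
          (\<Sum>x\<in>PiE {0, 1, 2 :: nat} (\<lambda>_. {..<2 * P\<^sup>2}). (\<lambda>a b c. M (blk P a) (blk P b) * (M (blk P a) (blk P c) * M (blk P b) (blk P c))) (x 0) (x 1) (x 2))"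
        unfolding H_def ugraph.simps pairs_2_3 by (rule sum.cong[OF refl]) (simp add: w doubleton_eq_iff)
      also have "\<dots> = (\<Sum>a<2 * P\<^sup>2. \<Sum>b<2 * P\<^sup>2. \<Sum>c<2 * P\<^sup>2. (\<lambda>c b a. M a b * (M a c * M b c)) (blk P a) (blk P b) (blk P c))"
        by (rule sum_PiE_3[where f = "\<lambda>a b c. M (blk P a) (blk P b) * (M (blk P a) (blk P c) * M (blk P b) (blk P c))"])
      also note s3[OF P, of "\<lambda>c b a. M a b * (M a c * M b c)"]
      finally show "(\<Sum>x\<in>PiE (verts H) (\<lambda>_. {..<2 * P\<^sup>2}).
        \<Prod>e\<in>pairs (verts H). if {fst e, snd e} \<in> edges H then blk_weight P u v s (x (fst e)) (x (snd e)) else 1) =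
        (u ^ 3 + v ^ 3 + 3 * u * s\<^sup>2 + 3 * v * s\<^sup>2) / 8 * (2 * (real P)\<^sup>2) ^ num_verts H"
        by (simp only:) (simp add: H_def num_verts_def M_def power2_eq_square power3_eq_cube field_simps)
    qed
    moreover have "num_edges H = 3" by (simp add: H_def num_edges_def doubleton_eq_iff)
    ultimately show ?thesis by (simp only:)
  qed
  have "((u + s)\<^sup>2 + (v + s)\<^sup>2) / 8 = ((u + v + 2 * s) / 4)\<^sup>2" using e2 unfolding e1[symmetric] .
  \<comment> \<open>The variance of the degrees is ((u - v) / 4)^2.\<close>
  then have "(u - v)\<^sup>2 = 0" by (simp add: power2_eq_square field_simps)
  then have uv: "u = v" by simp
  have "(v ^ 3 + v ^ 3 + 3 * v * s\<^sup>2 + 3 * v * s\<^sup>2) / 8 = ((v + v + 2 * s) / 4) ^ 3"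
    using e3 unfolding e1[symmetric] uv .
  \<comment> \<open>For u = v the triangle density is ((v + s) / 2)^3 + ((v - s) / 2)^3, and the
    first term is already the cube of the edge density.\<close>
  then have "(v - s) ^ 3 = 0" by (simp add: power2_eq_square power3_eq_cube field_simps)
  then show ?thesis using uv by simp
qed

text \<open>A solution of the equations of (iv) yields block graphs satisfying the hereditary
  hypothesis, so (i) makes a subsequence of them quasi-random, which is possible only for constant
  weights.\<close>

lemma hereditary_induced_forcing_imp_rigid:
  assumes F: "simple_graph F" and k: "num_verts F > 1" and p: "0 < p" "p < 1"
    and hif: "hereditary_induced_forcing F p"
  shows "rigid F p"
  unfolding rigid_def
proof (intro ballI impI)
  fix u v s
  assume uv: "u \<in> {p, conjugate F p}" "v \<in> {p, conjugate F p}" and s: "s \<in> {0..1}"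
    and Q: "\<forall>j\<in>{1..num_verts F - 1}. Q F j u v s = real (num_verts F choose j) * beta F p"
  have b: "u \<in> {0..1}" "v \<in> {0..1}" "beta F u = beta F p" "beta F v = beta F p"
    using uv p beta_conjugate(1,2)[OF F k p] by auto
  define G where "G n = blk_graph (next_prime n) u v s" for n
  have "order_to_infinity G"
    unfolding order_to_infinity_def
  proof (rule filterlim_at_top_mono[OF next_prime_at_top[of "\<lambda>n. n"]])
    show "\<forall>\<^sub>F n in sequentially. next_prime n \<le> num_verts (G n)"
      by (intro always_eventually allI) (simp add: G_def num_verts_blk_graph power2_eq_square)
  qed simp
  moreover have "\<forall>\<^sub>F n in sequentially. \<forall>U\<subseteq>verts (G n).
      \<bar>real (ind_embs_into F (G n) U) - beta F p * real (card U) ^ num_verts F\<bar> \<le> \<epsilon> * real (num_verts (G n)) ^ num_verts F"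
    if "0 < \<epsilon>" for \<epsilon>
  proof -
    have "\<forall>\<^sub>F n in sequentially. ((real (num_verts F))\<^sup>2 * 4) / sqrt (next_prime n) < \<epsilon>"
      using order_tendstoD(2)[OF div_sqrt_next_prime_tendsto[of "\<lambda>n. n"] that] by simp
    then show ?thesis
    proof eventually_elim
      case (elim n)
      show ?case
      proof (intro allI impI)
        fix U assume "U \<subseteq> verts (G n)"
        then have "\<bar>real (ind_embs_into F (G n) U) - beta F p * real (card U) ^ num_verts F\<bar> \<le>
           (real (num_verts F))\<^sup>2 * (2 * (2 / sqrt (next_prime n))) * real (num_verts (G n)) ^ num_verts F"
          unfolding G_def using Q b s by (intro blk_graph_hereditary F next_prime(1)) auto
        also have "\<dots> \<le> \<epsilon> * real (num_verts (G n)) ^ num_verts F"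
          using elim by (intro mult_right_mono) (auto simp: field_simps)
        finally show "\<bar>real (ind_embs_into F (G n) U) - beta F p * real (card U) ^ num_verts F\<bar> \<le> \<epsilon> * real (num_verts (G n)) ^ num_verts F" .
      qed
    qed
  qed
  moreover have "\<forall>n. simple_graph (G n)" by (simp add: G_def simple_blk_graph)
  ultimately have "mixed_quasi_random p (conjugate F p) G"
    using hif unfolding hereditary_induced_forcing_def by blast
  then obtain I1 I2 where I: "I1 \<union> I2 = UNIV" "infinite I1 \<longrightarrow> quasi_random p (G \<circ> enumerate I1)"
    "infinite I2 \<longrightarrow> quasi_random (conjugate F p) (G \<circ> enumerate I2)"
    unfolding mixed_quasi_random_def by blast
  \<comment> \<open>One quasi-random subsequence is enough, whichever of the two densities it
    has.\<close>
  have "infinite I1 \<or> infinite I2" using I(1) by (metis finite_UnI infinite_UNIV_nat)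
  then obtain I q where "infinite I" "quasi_random q (G \<circ> enumerate I)" using I by blast
  then show "u = v \<and> v = s"
    using blk_quasi_random_imp_const[OF b(1,2) s strict_mono_enumerate, of I q] by (simp add: G_def[abs_def])
qed

section \<open>Assembly of the equivalences through (iv)\<close>

theorem theorem7p6:
  fixes F :: ugraph and k :: nat and p :: real
  assumes "simple_graph F" and "verts F = {1..k}" and "k > 1" and "0 < p" and "p < 1"
  shows "let
      stmt_i = hereditary_induced_forcing F p;
      stmt_ii = (\<forall>W. graphon W \<longrightarrow>
        (AE x in cube {1..k}. Psi_sym F W x = beta F p) \<longrightarrow>
        (AE (x, y) in lebesgue_on ({0..1} \<times> {0..1}). W x y = p) \<or>
        (AE (x, y) in lebesgue_on ({0..1} \<times> {0..1}). W x y = conjugate F p));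
      stmt_iii = (\<forall>W. graphon W \<longrightarrow>
        (\<forall>x \<in> {1..k} \<rightarrow> {0..1}. Psi_sym F W x = beta F p) \<longrightarrow>
        (\<forall>x\<in>{0..1}. \<forall>y\<in>{0..1}. W x y = p) \<or>
        (\<forall>x\<in>{0..1}. \<forall>y\<in>{0..1}. W x y = conjugate F p));
      stmt_iv = (\<forall>u \<in> {p, conjugate F p}. \<forall>v \<in> {p, conjugate F p}. \<forall>s \<in> {0..1}.
        (\<forall>j \<in> {1..k-1}. Q F j u v s = real (k choose j) * beta F p) \<longrightarrow> u = v \<and> v = s)
    in (stmt_i \<longleftrightarrow> stmt_ii) \<and> (stmt_ii \<longleftrightarrow> stmt_iii) \<and> (stmt_iii \<longleftrightarrow> stmt_iv)"
proof -
  note F = assms(1) and V = assms(2) and k = assms(3) and p = assms(4,5)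
  have nv: "num_verts F = k" by (simp add: V num_verts_def)
  have k': "num_verts F > 1" using k by (simp add: nv)
  define ii where "ii \<longleftrightarrow> (\<forall>W. graphon W \<longrightarrow>
        (AE x in cube {1..k}. Psi_sym F W x = beta F p) \<longrightarrow>
        (AE (x, y) in lebesgue_on ({0..1} \<times> {0..1}). W x y = p) \<or>
        (AE (x, y) in lebesgue_on ({0..1} \<times> {0..1}). W x y = conjugate F p))"
  define iii where "iii \<longleftrightarrow> (\<forall>W. graphon W \<longrightarrow>
        (\<forall>x \<in> {1..k} \<rightarrow> {0..1}. Psi_sym F W x = beta F p) \<longrightarrow>
        (\<forall>x\<in>{0..1}. \<forall>y\<in>{0..1}. W x y = p) \<or>
        (\<forall>x\<in>{0..1}. \<forall>y\<in>{0..1}. W x y = conjugate F p))"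
  define iv where "iv \<longleftrightarrow> (\<forall>u \<in> {p, conjugate F p}. \<forall>v \<in> {p, conjugate F p}. \<forall>s \<in> {0..1}.
        (\<forall>j \<in> {1..k-1}. Q F j u v s = real (k choose j) * beta F p) \<longrightarrow> u = v \<and> v = s)"
  have iv: "iv \<longleftrightarrow> rigid F p" unfolding iv_def rigid_def nv ..
  have i: "hereditary_induced_forcing F p \<longleftrightarrow> rigid F p"
    using hereditary_induced_forcing_imp_rigid[OF F k' p] rigid_imp_hereditary_induced_forcing[OF F V k p] by blast
  have ii: "ii \<longleftrightarrow> rigid F p"
  proof
    assume ii: ii
    show "rigid F p"
    proof (rule graphon_const_imp_rigid[OF F k' p])
      fix u v s assume W: "graphon (step_graphon u v s)" and Psi: "\<And>x. Psi_sym F (step_graphon u v s) x = beta F p"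
      have "AE x in cube {1..k}. Psi_sym F (step_graphon u v s) x = beta F p" by (rule AE_I2) (rule Psi)
      with ii W have "(AE (x, y) in lebesgue_on ({0..1} \<times> {0..1}). step_graphon u v s x y = p) \<or>
        (AE (x, y) in lebesgue_on ({0..1} \<times> {0..1}). step_graphon u v s x y = conjugate F p)"
        unfolding ii_def by blast
      then show "u = v \<and> v = s"
        using step_graphon_ae_const[of u v s p] step_graphon_ae_const[of u v s "conjugate F p"] by (elim disjE) simp_all
    qed
  next
    assume "rigid F p"
    then show ii unfolding ii_def using rigid_imp_graphon_ae[OF F V k p] by blast
  qed
  have iii: "iii \<longleftrightarrow> rigid F p"
  proof
    assume iii: iii
    show "rigid F p"
    proof (rule graphon_const_imp_rigid[OF F k' p])
      fix u v s assume W: "graphon (step_graphon u v s)" and Psi: "\<And>x. Psi_sym F (step_graphon u v s) x = beta F p"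
      have "\<forall>x \<in> {1..k} \<rightarrow> {0..1}. Psi_sym F (step_graphon u v s) x = beta F p" using Psi by blast
      with iii W have "(\<forall>x\<in>{0..1}. \<forall>y\<in>{0..1}. step_graphon u v s x y = p) \<or>
        (\<forall>x\<in>{0..1}. \<forall>y\<in>{0..1}. step_graphon u v s x y = conjugate F p)"
        unfolding iii_def by blast
      then show "u = v \<and> v = s"
        using step_graphon_const[of u v s p] step_graphon_const[of u v s "conjugate F p"] by (elim disjE) simp_all
    qed
  next
    assume "rigid F p"
    then show iii unfolding iii_def using rigid_imp_graphon_const[OF F V k p] by blast
  qed
  show ?thesis
    unfolding Let_def ii_def[symmetric] iii_def[symmetric] iv_def[symmetric] using i ii iii iv by blast
qed

end
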